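(* Let $G$ be a (topologically) finitely generated infinite profinite group that is Fitting-free and let $c$ be a non-negative integer. Then the following conditions are equivalent: (i) $G$ is hereditarily JNN$_c$F; (ii) the set $\mathcal{A}^*_H=\{\gamma_{c+1}(K)\mid K \text{ an open subgroup of } G \text{ with } H\leq \mathrm{N}_G(K) \text{ and } \gamma_{c+1}(K)\not\leq H\}$ is finite for every open subgroup $H$ of $G$; (iii) the set $\mathcal{C}^*_H=\{\gamma_{c+1}(K)\mid K \text{ a closed subgroup of } G \text{ with } H\leq \mathrm{N}_G(K) \text{ and } \gamma_{c+1}(K)\not\leq H\}$ is finite for every open subgroup $H$ of $G$.
   Context: For closed subgroups $K,L$ of a profinite group, $[K,L]$ denotes the closed subgroup generated by all commutators $[x,y]$ with $x\in K$, $y\in L$. The lower central series is $\gamma_1(K)=K$, $\gamma_{i+1}(K)=[\gamma_i(K),K]$. A profinite group is virtually class-$c$ nilpotent if it has a subgroup $H$ of finite index (equivalently, an open subgroup $H$) with $\gamma_{c+1}(H)=1$. A profinite group $G$ is JNN$_c$F if $G$ is not virtually class-$c$ nilpotent but $G/N$ is virtually class-$c$ nilpotent for every non-trivial closed normal subgroup $N$ of $G$; it is hereditarily JNN$_c$F if every open subgroup of $G$ is JNN$_c$F. A profinite group is Fitting-free if it has no non-trivial abelian closed normal subgroup. $\mathrm{N}_G(K)$ is the normalizer of $K$ in $G$. *)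

theory Defs
  imports "HOL-Analysis.Analysis" "HOL-Algebra.Algebra"
begin

locale topological_group = group G for G :: "('a, 'b) monoid_scheme" (structure) + fixes T :: "'a topology"
  assumes topspace_eq: "topspace T = carrier G"
    and continuous_mult: "continuous_map (prod_topology T T) T (\<lambda>(x, y). x \<otimes> y)"
    and continuous_inv: "continuous_map T T (\<lambda>x. inv x)"

locale profinite_group = topological_group +
  assumes compact: "compact_space T"
    and Hausdorff: "Hausdorff_space T"
    and totally_disconnected:
      "x \<in> carrier G \<Longrightarrow> connected_component_of_set T x = {x}"

definition closed_subgroup :: "('a, 'b) monoid_scheme \<Rightarrow> 'a topology \<Rightarrow> 'a set \<Rightarrow> bool" where
  "closed_subgroup G T K \<longleftrightarrow> subgroup K G \<and> closedin T K"

definition open_subgroup :: "('a, 'b) monoid_scheme \<Rightarrow> 'a topology \<Rightarrow> 'a set \<Rightarrow> bool" where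
  "open_subgroup G T K \<longleftrightarrow> subgroup K G \<and> openin T K"

definition closed_normal_subgroup ::
    "('a, 'b) monoid_scheme \<Rightarrow> 'a topology \<Rightarrow> 'a set \<Rightarrow> bool" where
  "closed_normal_subgroup G T N \<longleftrightarrow> N \<lhd> G \<and> closedin T N"

text \<open>The hull operator yields the intersection of all closed subgroups that contain the
  given set.\<close>

definition closed_generate :: "('a, 'b) monoid_scheme \<Rightarrow> 'a topology \<Rightarrow> 'a set \<Rightarrow> 'a set" where
  "closed_generate G T S = closed_subgroup G T hull S"

definition topologically_fg :: "('a, 'b) monoid_scheme \<Rightarrow> 'a topology \<Rightarrow> bool" where
  "topologically_fg G T \<longleftrightarrow>
     (\<exists>S. finite S \<and> S \<subseteq> carrier G \<and> closed_generate G T S = carrier G)"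

definition commutator :: "('a, 'b) monoid_scheme \<Rightarrow> 'a \<Rightarrow> 'a \<Rightarrow> 'a" where
  "commutator G x y = inv\<^bsub>G\<^esub> x \<otimes>\<^bsub>G\<^esub> inv\<^bsub>G\<^esub> y \<otimes>\<^bsub>G\<^esub> x \<otimes>\<^bsub>G\<^esub> y"

definition commutator_subgroup ::
    "('a, 'b) monoid_scheme \<Rightarrow> 'a topology \<Rightarrow> 'a set \<Rightarrow> 'a set \<Rightarrow> 'a set" where
  "commutator_subgroup G T K L = closed_generate G T {commutator G x y |x y. x \<in> K \<and> y \<in> L}"

text \<open>The lower central series is indexed from \<open>1\<close>; the value at \<open>0\<close> is a dummy.\<close>

fun lower_central ::
    "('a, 'b) monoid_scheme \<Rightarrow> 'a topology \<Rightarrow> 'a set \<Rightarrow> nat \<Rightarrow> 'a set" where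
  "lower_central G T K 0 = K"
| "lower_central G T K (Suc 0) = K"
| "lower_central G T K (Suc (Suc i)) = commutator_subgroup G T (lower_central G T K (Suc i)) K"

definition virtually_nilpotent ::
    "nat \<Rightarrow> ('a, 'b) monoid_scheme \<Rightarrow> 'a topology \<Rightarrow> bool" where
  "virtually_nilpotent c G T \<longleftrightarrow>
     (\<exists>H. open_subgroup G T H \<and> lower_central G T H (c + 1) = {\<one>\<^bsub>G\<^esub>})"

definition quotient_topology ::
    "('a, 'b) monoid_scheme \<Rightarrow> 'a topology \<Rightarrow> 'a set \<Rightarrow> 'a set topology" where
  "quotient_topology G T N = topology (\<lambda>U. U \<subseteq> carrier (G Mod N) \<and>
     openin T {x \<in> topspace T. N #>\<^bsub>G\<^esub> x \<in> U})"

lemma openin_quotient_topology: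
  "openin (quotient_topology G T N) U \<longleftrightarrow>
     U \<subseteq> carrier (G Mod N) \<and> openin T {x \<in> topspace T. N #>\<^bsub>G\<^esub> x \<in> U}"
proof -
  let ?P = "\<lambda>U. U \<subseteq> carrier (G Mod N) \<and> openin T {x \<in> topspace T. N #>\<^bsub>G\<^esub> x \<in> U}"
  have "?P (U \<inter> V)" if "?P U" "?P V" for U V
  proof -
    have "{x \<in> topspace T. N #>\<^bsub>G\<^esub> x \<in> U \<inter> V} =
        {x \<in> topspace T. N #>\<^bsub>G\<^esub> x \<in> U} \<inter> {x \<in> topspace T. N #>\<^bsub>G\<^esub> x \<in> V}"
      by blast
    with that show ?thesis by auto
  qed
  moreover have "?P (\<Union>\<U>)" if "\<And>U. U \<in> \<U> \<Longrightarrow> ?P U" for \<U>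
  proof -
    have "{x \<in> topspace T. N #>\<^bsub>G\<^esub> x \<in> \<Union>\<U>} =
        (\<Union>U\<in>\<U>. {x \<in> topspace T. N #>\<^bsub>G\<^esub> x \<in> U})"
      by blast
    with that show ?thesis by auto
  qed
  ultimately have "istopology ?P"
    unfolding istopology_def by blast
  then show ?thesis
    unfolding quotient_topology_def by (simp add: topology_inverse')
qed

lemma (in topological_group) topspace_quotient_topology:
  "topspace (quotient_topology G T N) = carrier (G Mod N)"
proof -
  have "{x \<in> topspace T. N #> x \<in> carrier (G Mod N)} = topspace T"
    by (auto simp: FactGroup_def RCOSETS_def topspace_eq)
  then have "openin (quotient_topology G T N) (carrier (G Mod N))"
    by (simp add: openin_quotient_topology)
  then show ?thesis
    by (metis openin_quotient_topology openin_subset openin_topspace subset_antisym)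
qed

lemma (in topological_group) quotient_map_quotient_topology:
  "quotient_map T (quotient_topology G T N) (\<lambda>x. N #> x)"
  unfolding quotient_map_def topspace_quotient_topology
  by (auto simp: openin_quotient_topology FactGroup_def RCOSETS_def topspace_eq)

definition JNNF :: "nat \<Rightarrow> ('a, 'b) monoid_scheme \<Rightarrow> 'a topology \<Rightarrow> bool" where
  "JNNF c G T \<longleftrightarrow> \<not> virtually_nilpotent c G T \<and>
     (\<forall>N. closed_normal_subgroup G T N \<and> N \<noteq> {\<one>\<^bsub>G\<^esub>} \<longrightarrow>
        virtually_nilpotent c (G Mod N) (quotient_topology G T N))"

definition hereditarily_JNNF :: "nat \<Rightarrow> ('a, 'b) monoid_scheme \<Rightarrow> 'a topology \<Rightarrow> bool" where
  "hereditarily_JNNF c G T \<longleftrightarrow>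
     (\<forall>H. open_subgroup G T H \<longrightarrow> JNNF c (G\<lparr>carrier := H\<rparr>) (subtopology T H))"

definition Fitting_free :: "('a, 'b) monoid_scheme \<Rightarrow> 'a topology \<Rightarrow> bool" where
  "Fitting_free G T \<longleftrightarrow>
     \<not> (\<exists>N. closed_normal_subgroup G T N \<and> comm_group (G\<lparr>carrier := N\<rparr>) \<and> N \<noteq> {\<one>\<^bsub>G\<^esub>})"

definition A_star ::
    "nat \<Rightarrow> ('a, 'b) monoid_scheme \<Rightarrow> 'a topology \<Rightarrow> 'a set \<Rightarrow> 'a set set" where
  "A_star c G T H = {lower_central G T K (c + 1) |K.
     open_subgroup G T K \<and> H \<subseteq> normalizer G K \<and> \<not> lower_central G T K (c + 1) \<subseteq> H}"

definition C_star ::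
    "nat \<Rightarrow> ('a, 'b) monoid_scheme \<Rightarrow> 'a topology \<Rightarrow> 'a set \<Rightarrow> 'a set set" where
  "C_star c G T H = {lower_central G T K (c + 1) |K.
     closed_subgroup G T K \<and> H \<subseteq> normalizer G K \<and> \<not> lower_central G T K (c + 1) \<subseteq> H}"

end

theory Submission
  imports Defs
begin

text \<open>The implication from (iii) to (ii) is trivial, since open subgroups are closed.

  From (ii) to (i): if \<open>N\<close> is a non-trivial closed normal subgroup of an open subgroup \<open>L\<close>, then
  \<open>\<gamma>\<^sub>c\<^sub>+\<^sub>1(N) \<noteq> 1\<close> because no open subgroup has a non-trivial nilpotent normal subgroup. For a small
  open \<open>H\<close>, the groups \<open>\<gamma>\<^sub>c\<^sub>+\<^sub>1(NU)\<close> with \<open>U\<close> open normal in \<open>G\<close> belong to a finite set, and their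
  intersection lies in \<open>N\<close>; hence one of them lies in \<open>N\<close>.

  From (i) to (iii) we may take \<open>H\<close> normal. The closed subgroups \<open>K\<close> normalized by \<open>H\<close> with
  \<open>\<gamma>\<^sub>c\<^sub>+\<^sub>1(K)\<close> not contained in \<open>H\<close> form a compact space. If \<open>P\<close> is non-trivial, closed and normal in
  \<open>H\<close>, then every closed normal subgroup \<open>P'\<close> of \<open>H\<close> sufficiently close to \<open>P\<close> contains
  \<open>\<gamma>\<^sub>c\<^sub>+\<^sub>1(P)\<close>: otherwise \<open>\<gamma>\<^sub>c\<^sub>+\<^sub>1(P)\<close> has non-trivial perfect quotients by subgroups arbitrarily close
  to it, whereas its maximal kernels with perfect quotient all contain a fixed open part of it.
  Applied to \<open>P = \<gamma>\<^sub>c\<^sub>+\<^sub>1(K) \<inter> H\<close>, this and compactness give one open normal \<open>V\<close> with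
  \<open>\<gamma>\<^sub>c\<^sub>+\<^sub>1(V) \<subseteq> \<gamma>\<^sub>c\<^sub>+\<^sub>1(K)\<close> for all these \<open>K\<close>. Now \<open>F = KV\<close> runs through finitely many groups, and
  Fitting's theorem modulo \<open>\<gamma>\<^sub>c\<^sub>+\<^sub>1(K)\<close> gives
  \<open>\<gamma>\<^sub>2\<^sub>c\<^sub>+\<^sub>2(F) \<gamma>\<^sub>c\<^sub>+\<^sub>1(V) \<subseteq> \<gamma>\<^sub>c\<^sub>+\<^sub>1(K) \<subseteq> \<gamma>\<^sub>c\<^sub>+\<^sub>1(F)\<close>. The index of the first group in the last is
  finite, since for \<open>i > c\<close> each \<open>\<gamma>\<^sub>i(F) / \<gamma>\<^sub>i\<^sub>+\<^sub>1(F) \<gamma>\<^sub>c\<^sub>+\<^sub>1(V)\<close> is abelian, finitely generated and, by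
  multilinearity of commutators, of exponent dividing \<open>|F : V|\<^sup>i\<close>.\<close>

section \<open>Commutators and normalizing subgroups\<close>

text \<open>Agreement of \<open>P\<close> and \<open>P'\<close> modulo a small \<open>U\<close> says
  nothing about what \<open>P'\<close> contains inside \<open>U\<close>, so containment cannot be
  read off from closeness. The only obstruction is a perfect quotient of S = \<gamma>(P): once
  \<gamma>(U) lies in [S, S], the quotient S / (P' \<inter> S) is perfect, while [S, P'] falls into
  P' \<inter> S and [S, U] into U \<inter> S. So a uniform bound for the kernels of perfect
  quotients is all that is missing. The requirement that \<gamma>(K) is not inside H makes
  \<gamma>(K) \<inter> H non-trivial: otherwise \<gamma>(K) would centralize H, and the centralizer
  of H is trivial because G itself is JNN. Finite generation turns bounded exponent into finiteness
  for the abelian factors; infinitude keeps open subgroups of a Fitting-free group from being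
  nilpotent. The space of closed subgroups is never topologized: a subgroup is handled through its
  products \<open>K <#> U\<close> with open normal \<open>U\<close>.\<close>

context group
begin

text \<open>Only an inclusion is demanded, and \<open>N\<close> may be any set; when
  \<open>L\<close> is a subgroup, inverses turn it into an equality. This form passes easily through
  intersections, products and closed hulls.\<close>

definition normalizes :: "'a set \<Rightarrow> 'a set \<Rightarrow> bool" where
  "normalizes L N \<longleftrightarrow> (\<forall>g\<in>L. \<forall>n\<in>N. g \<otimes> n \<otimes> inv g \<in> N)"

lemma inv_mult_cancel:
  assumes "x \<in> carrier G" "y \<in> carrier G"
  shows "inv x \<otimes> (x \<otimes> y) = y" "x \<otimes> (inv x \<otimes> y) = y"
  using assms by (simp_all add: m_assoc[symmetric])

lemmas word_simps = m_assoc inv_mult_group inv_mult_cancel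

lemma commutator_closed [simp, intro]:
  "x \<in> carrier G \<Longrightarrow> y \<in> carrier G \<Longrightarrow> commutator G x y \<in> carrier G"
  by (simp add: commutator_def)

lemma normalizesD: "normalizes L N \<Longrightarrow> g \<in> L \<Longrightarrow> n \<in> N \<Longrightarrow> g \<otimes> n \<otimes> inv g \<in> N"
  by (simp add: normalizes_def)

lemma normalizesD_inv:
  "normalizes L N \<Longrightarrow> subgroup L G \<Longrightarrow> g \<in> L \<Longrightarrow> n \<in> N \<Longrightarrow> inv g \<otimes> n \<otimes> g \<in> N"
  using normalizesD[of L N "inv g" n] by (simp add: subgroup.m_inv_closed subgroup.mem_carrier)

lemma normalizes_mono: "normalizes L N \<Longrightarrow> L' \<subseteq> L \<Longrightarrow> normalizes L' N"
  by (auto simp: normalizes_def)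

lemma normalizes_Int: "normalizes L N \<Longrightarrow> normalizes L N' \<Longrightarrow> normalizes L (N \<inter> N')"
  by (auto simp: normalizes_def)

lemma normalizes_self: "subgroup L G \<Longrightarrow> normalizes L L"
  by (simp add: normalizes_def subgroup.m_closed subgroup.m_inv_closed)

lemma normal_iff_normalizes: "N \<lhd> G \<longleftrightarrow> subgroup N G \<and> normalizes (carrier G) N"
  by (simp add: normal_inv_iff normalizes_def)

text \<open>Bridge to the library \<open>normalizer\<close>, a stabilizer for the action
  \<open>g <# K #> inv g\<close>: there the conjugate must equal \<open>K\<close>, and the reverse
  inclusion comes from \<open>inv g\<close>, which lies in \<open>H\<close> as well.\<close>

lemma normalizer_subset_iff:
  assumes "subgroup H G" "subgroup K G"
  shows "H \<subseteq> normalizer G K \<longleftrightarrow> normalizes H K"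
proof -
  have K: "K \<subseteq> carrier G" and H: "H \<subseteq> carrier G"
    using assms subgroup.subset by auto
  have mem: "g \<in> normalizer G K \<longleftrightarrow> g \<in> carrier G \<and> g <# K #> inv g = K" for g
    using K by (auto simp: normalizer_def stabilizer_def)
  have conj: "g <# K #> inv g = (\<lambda>k. g \<otimes> k \<otimes> inv g) ` K" for g
    by (auto simp: l_coset_def r_coset_def)
  show ?thesis
  proof
    assume "H \<subseteq> normalizer G K"
    then show "normalizes H K"
      unfolding normalizes_def using mem conj by blast
  next
    assume n: "normalizes H K"
    show "H \<subseteq> normalizer G K"
    proof
      fix g assume g: "g \<in> H"
      then have gc: "g \<in> carrier G" using H by auto
      have "k \<in> (\<lambda>k. g \<otimes> k \<otimes> inv g) ` K" if "k \<in> K" for k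
      proof
        show "inv g \<otimes> k \<otimes> g \<in> K"
          using normalizesD_inv[OF n assms(1) g that] .
        show "k = g \<otimes> (inv g \<otimes> k \<otimes> g) \<otimes> inv g"
          using gc K that by (auto simp: word_simps)
      qed
      then have "(\<lambda>k. g \<otimes> k \<otimes> inv g) ` K = K"
        using n g by (auto simp: normalizes_def)
      then show "g \<in> normalizer G K" using mem conj gc by auto
    qed
  qed
qed

section \<open>Products of subgroups\<close>

lemma set_mult_memI: "a \<in> A \<Longrightarrow> b \<in> B \<Longrightarrow> a \<otimes> b \<in> A <#> B"
  by (auto simp: set_mult_def)

lemma set_mult_memE:
  assumes "x \<in> A <#> B"
  obtains a b where "a \<in> A" "b \<in> B" "x = a \<otimes> b"
  using assms by (auto simp: set_mult_def)

lemma set_mult_mono: "A \<subseteq> A' \<Longrightarrow> B \<subseteq> B' \<Longrightarrow> A <#> B \<subseteq> A' <#> B'"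
  by (auto simp: set_mult_def)

lemma subset_set_mult1: "A \<subseteq> carrier G \<Longrightarrow> subgroup B G \<Longrightarrow> A \<subseteq> A <#> B"
  by (force simp: set_mult_def dest: subgroup.one_closed)

lemma subset_set_mult2: "B \<subseteq> carrier G \<Longrightarrow> subgroup A G \<Longrightarrow> B \<subseteq> A <#> B"
  by (force simp: set_mult_def dest: subgroup.one_closed)

lemma subgroup_set_mult:
  assumes K: "subgroup K G" and N: "subgroup N G" and n: "normalizes K N"
  shows "subgroup (K <#> N) G"
proof
  have car: "k \<in> carrier G" if "k \<in> K \<or> k \<in> N" for k
    using K N subgroup.mem_carrier that by metis
  show "K <#> N \<subseteq> carrier G"
    using car by (auto simp: set_mult_def)
  show "\<one> \<in> K <#> N"
    using set_mult_memI[of \<one> K \<one> N] K N by (simp add: subgroup.one_closed)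
  fix x assume "x \<in> K <#> N"
  then obtain a u where x: "a \<in> K" "u \<in> N" "x = a \<otimes> u" by (rule set_mult_memE)
  have "inv x = inv a \<otimes> (a \<otimes> inv u \<otimes> inv a)"
    using x car by (simp add: word_simps)
  then show "inv x \<in> K <#> N"
    using x K N n by (simp add: set_mult_memI subgroup.m_inv_closed normalizesD)
  fix y assume "y \<in> K <#> N"
  then obtain b v where y: "b \<in> K" "v \<in> N" "y = b \<otimes> v" by (rule set_mult_memE)
  have "x \<otimes> y = (a \<otimes> b) \<otimes> ((inv b \<otimes> u \<otimes> b) \<otimes> v)"
    using x y car by (simp add: word_simps)
  then show "x \<otimes> y \<in> K <#> N"
    using x y K N normalizesD_inv[OF n K] by (simp add: set_mult_memI subgroup.m_closed)
qed

lemma set_mult_least: "A \<subseteq> C \<Longrightarrow> B \<subseteq> C \<Longrightarrow> subgroup C G \<Longrightarrow> A <#> B \<subseteq> C"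
  by (auto simp: set_mult_def dest: subgroup.m_closed)

lemma normalizes_set_mult:
  assumes "normalizes L A" "normalizes L B" "L \<subseteq> carrier G" "A \<subseteq> carrier G" "B \<subseteq> carrier G"
  shows "normalizes L (A <#> B)"
  unfolding normalizes_def
proof (intro ballI)
  fix g n assume g: "g \<in> L" and "n \<in> A <#> B"
  then obtain a b where n: "a \<in> A" "b \<in> B" "n = a \<otimes> b" by (auto elim: set_mult_memE)
  have "g \<otimes> n \<otimes> inv g = (g \<otimes> a \<otimes> inv g) \<otimes> (g \<otimes> b \<otimes> inv g)"
    using n g assms(3-5)[THEN subsetD] by (simp add: word_simps)
  then show "g \<otimes> n \<otimes> inv g \<in> A <#> B"
    using n g assms by (simp add: set_mult_memI normalizesD)
qed

section \<open>Commutator identities and commutators modulo a normalized subgroup\<close>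

lemma commutator_mult_left:
  assumes "x \<in> carrier G" "y \<in> carrier G" "z \<in> carrier G"
  shows "commutator G (x \<otimes> y) z = (inv y \<otimes> commutator G x z \<otimes> y) \<otimes> commutator G y z"
  using assms by (simp add: commutator_def word_simps)

lemma commutator_mult_right:
  assumes "x \<in> carrier G" "y \<in> carrier G" "z \<in> carrier G"
  shows "commutator G x (y \<otimes> z) = commutator G x z \<otimes> (inv z \<otimes> commutator G x y \<otimes> z)"
  using assms by (simp add: commutator_def word_simps)

lemma commutator_conj:
  assumes "x \<in> carrier G" "y \<in> carrier G" "g \<in> carrier G"
  shows "g \<otimes> commutator G x y \<otimes> inv g = commutator G (g \<otimes> x \<otimes> inv g) (g \<otimes> y \<otimes> inv g)"
  using assms by (simp add: commutator_def word_simps)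

lemma inv_commutator:
  assumes "x \<in> carrier G" "y \<in> carrier G"
  shows "inv (commutator G x y) = commutator G y x"
  using assms by (simp add: commutator_def word_simps)

lemma commutator_eq_one_iff:
  assumes "x \<in> carrier G" "y \<in> carrier G"
  shows "commutator G x y = \<one> \<longleftrightarrow> x \<otimes> y = y \<otimes> x"
proof -
  have "commutator G x y = inv (y \<otimes> x) \<otimes> (x \<otimes> y)"
    using assms by (simp add: commutator_def word_simps)
  then show ?thesis
    using assms by (metis inv_closed inv_inv inv_unique l_inv m_closed)
qed

lemma commutator_mem_left:
  assumes "normalizes L N" "subgroup L G" "subgroup N G" "x \<in> N" "y \<in> L"
  shows "commutator G x y \<in> N"
proof -
  have "commutator G x y = inv x \<otimes> (inv y \<otimes> x \<otimes> y)"
    using assms by (simp add: commutator_def word_simps subgroup.mem_carrier)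
  then show ?thesis
    using assms normalizesD_inv[OF assms(1,2,5,4)]
    by (simp add: subgroup.m_closed subgroup.m_inv_closed)
qed

lemma commutator_mem_right:
  assumes "normalizes L N" "subgroup L G" "subgroup N G" "x \<in> L" "y \<in> N"
  shows "commutator G x y \<in> N"
proof -
  have "commutator G x y = inv (commutator G y x)"
    using assms by (simp add: inv_commutator subgroup.mem_carrier)
  then show ?thesis
    using commutator_mem_left[OF assms(1-3,5,4)] assms(3) by (simp add: subgroup.m_inv_closed)
qed

text \<open>The cosets \<open>x N\<close> with \<open>x \<in> F\<close> multiply and invert like
  elements of a quotient because \<open>F\<close> normalizes \<open>N\<close>, and a commutator is a
  word in its entries. \<open>N\<close> may lie outside \<open>F\<close>, so the lemma applies to
  products \<open>F <#> N\<close> without a quotient group.\<close>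

lemma commutator_cong_mod:
  assumes F: "subgroup F G" and N: "subgroup N G" and n: "normalizes F N"
    and a: "a \<in> F" "u \<in> N" and b: "b \<in> F" "v \<in> N"
  shows "\<exists>w\<in>N. commutator G (a \<otimes> u) (b \<otimes> v) = commutator G a b \<otimes> w"
proof -
  have car: "x \<in> carrier G" if "x \<in> F \<or> x \<in> N" for x
    using F N that subgroup.mem_carrier by metis
  have mult: "\<exists>w\<in>N. (x \<otimes> u) \<otimes> (y \<otimes> v) = (x \<otimes> y) \<otimes> w" if "x \<in> F" "y \<in> F" "u \<in> N" "v \<in> N" for x y u v
  proof
    show "(x \<otimes> u) \<otimes> (y \<otimes> v) = (x \<otimes> y) \<otimes> ((inv y \<otimes> u \<otimes> y) \<otimes> v)"
      using that car by (simp add: word_simps)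
    show "(inv y \<otimes> u \<otimes> y) \<otimes> v \<in> N"
      using that normalizesD_inv[OF n F] N by (simp add: subgroup.m_closed)
  qed
  have inv: "\<exists>w\<in>N. inv (x \<otimes> u) = inv x \<otimes> w" if "x \<in> F" "u \<in> N" for x u
  proof
    show "inv (x \<otimes> u) = inv x \<otimes> (x \<otimes> inv u \<otimes> inv x)"
      using that car by (simp add: word_simps)
    show "x \<otimes> inv u \<otimes> inv x \<in> N"
      using that n N by (simp add: normalizesD subgroup.m_inv_closed)
  qed
  obtain u' where u': "u' \<in> N" "inv (a \<otimes> u) = inv a \<otimes> u'" using inv a by blast
  obtain v' where v': "v' \<in> N" "inv (b \<otimes> v) = inv b \<otimes> v'" using inv b by blast
  have i: "inv a \<in> F" "inv b \<in> F" using a b F by (auto intro: subgroup.m_inv_closed)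
  obtain w1 where w1: "w1 \<in> N" "inv (a \<otimes> u) \<otimes> inv (b \<otimes> v) = (inv a \<otimes> inv b) \<otimes> w1"
    using mult[OF i u'(1) v'(1)] u' v' by auto
  obtain w2 where w2: "w2 \<in> N" "inv (a \<otimes> u) \<otimes> inv (b \<otimes> v) \<otimes> (a \<otimes> u) = (inv a \<otimes> inv b \<otimes> a) \<otimes> w2"
    using mult[of "inv a \<otimes> inv b" a w1 u] w1 a i F by (auto intro: subgroup.m_closed)
  obtain w3 where "w3 \<in> N" "inv (a \<otimes> u) \<otimes> inv (b \<otimes> v) \<otimes> (a \<otimes> u) \<otimes> (b \<otimes> v) = (inv a \<otimes> inv b \<otimes> a \<otimes> b) \<otimes> w3"
    using mult[of "inv a \<otimes> inv b \<otimes> a" b w2 v] w2 a b i F by (auto intro: subgroup.m_closed)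
  then show ?thesis by (auto simp: commutator_def)
qed

end

section \<open>Closed subgroups\<close>

context topological_group
begin

abbreviation closed_sg :: "'a set \<Rightarrow> bool" where
  "closed_sg \<equiv> closed_subgroup G T"

abbreviation open_sg :: "'a set \<Rightarrow> bool" where
  "open_sg \<equiv> open_subgroup G T"

text \<open>The index is shifted: \<open>\<gamma> K c\<close> is the term that is usually written \<open>\<gamma>\<^sub>c\<^sub>+\<^sub>1(K)\<close>.\<close>

abbreviation lcs :: "'a set \<Rightarrow> nat \<Rightarrow> 'a set" (\<open>\<gamma>\<close>) where
  "\<gamma> K i \<equiv> lower_central G T K (Suc i)"

abbreviation comm_sg :: "'a set \<Rightarrow> 'a set \<Rightarrow> 'a set" where
  "comm_sg \<equiv> commutator_subgroup G T"

definition open_normal :: "'a set \<Rightarrow> bool" where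
  "open_normal U \<longleftrightarrow> U \<lhd> G \<and> openin T U"

lemma closed_sgD:
  assumes "closed_sg K"
  shows "subgroup K G" "closedin T K" "K \<subseteq> carrier G" "\<one> \<in> K"
  using assms unfolding closed_subgroup_def by (auto dest: subgroup.subset subgroup.one_closed)

lemma open_sgD:
  assumes "open_sg K"
  shows "subgroup K G" "openin T K" "K \<subseteq> carrier G" "\<one> \<in> K"
  using assms unfolding open_subgroup_def by (auto dest: subgroup.subset subgroup.one_closed)

lemma open_normalD:
  assumes "open_normal U"
  shows "open_sg U" "subgroup U G" "openin T U" "U \<subseteq> carrier G" "normalizes (carrier G) U"
  using assms unfolding open_normal_def open_subgroup_def
  by (auto simp: normal_iff_normalizes dest: subgroup.subset)

lemma open_normal_Int: "open_normal U \<Longrightarrow> open_normal V \<Longrightarrow> open_normal (U \<inter> V)"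
  by (simp add: open_normal_def normal_subgroup_intersect openin_Int)

lemma open_normal_carrier: "open_normal (carrier G)"
  by (metis open_normal_def normal_iff_normalizes normalizes_self openin_topspace subgroup_self topspace_eq)

lemma closed_sg_Inter:
  assumes "\<A> \<noteq> {}" "\<And>A. A \<in> \<A> \<Longrightarrow> closed_sg A"
  shows "closed_sg (\<Inter>\<A>)"
  using assms unfolding closed_subgroup_def by (auto intro: subgroups_Inter closedin_Inter)

lemma closed_sg_Int: "closed_sg A \<Longrightarrow> closed_sg B \<Longrightarrow> closed_sg (A \<inter> B)"
  using closed_sg_Inter[of "{A, B}"] by auto

lemma closed_sg_carrier: "closed_sg (carrier G)"
  by (metis closed_subgroup_def closedin_topspace subgroup_self topspace_eq)

lemma closed_sg_closed_generate:
  assumes "S \<subseteq> carrier G"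
  shows "closed_sg (closed_generate G T S)"
  unfolding closed_generate_def hull_def
  by (rule closed_sg_Inter) (use assms closed_sg_carrier in auto)

lemma subset_closed_generate: "S \<subseteq> closed_generate G T S"
  unfolding closed_generate_def by (rule hull_subset)

lemma closed_generate_least: "S \<subseteq> K \<Longrightarrow> closed_sg K \<Longrightarrow> closed_generate G T S \<subseteq> K"
  unfolding closed_generate_def by (rule hull_minimal)

lemma closed_sg_comm_sg:
  assumes "K \<subseteq> carrier G" "L \<subseteq> carrier G"
  shows "closed_sg (comm_sg K L)"
  unfolding commutator_subgroup_def
  by (rule closed_sg_closed_generate) (use assms in auto)

lemma commutator_in_comm_sg: "x \<in> K \<Longrightarrow> y \<in> L \<Longrightarrow> commutator G x y \<in> comm_sg K L"
  unfolding commutator_subgroup_def by (rule subsetD[OF subset_closed_generate]) auto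

lemma comm_sg_least:
  assumes "\<And>x y. x \<in> K \<Longrightarrow> y \<in> L \<Longrightarrow> commutator G x y \<in> N" "closed_sg N"
  shows "comm_sg K L \<subseteq> N"
  unfolding commutator_subgroup_def
  by (rule closed_generate_least) (use assms in auto)

lemma comm_sg_mono:
  assumes "K \<subseteq> K'" "L \<subseteq> L'"
  shows "comm_sg K L \<subseteq> comm_sg K' L'"
proof -
  have "{commutator G x y |x y. x \<in> K \<and> y \<in> L} \<subseteq> {commutator G x y |x y. x \<in> K' \<and> y \<in> L'}"
  proof
    fix z assume "z \<in> {commutator G x y |x y. x \<in> K \<and> y \<in> L}"
    then obtain x y where "z = commutator G x y" "x \<in> K" "y \<in> L" by (elim CollectE exE conjE)
    moreover from this have "x \<in> K'" "y \<in> L'" using assms by (simp_all add: subsetD)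
    ultimately show "z \<in> {commutator G x y |x y. x \<in> K' \<and> y \<in> L'}"
      by (intro CollectI exI conjI)
  qed
  then show ?thesis
    unfolding commutator_subgroup_def closed_generate_def by (rule hull_mono)
qed

lemma closed_sg_lcs:
  assumes "closed_sg K"
  shows "closed_sg (\<gamma> K i)"
proof (induction i)
  case (Suc i)
  then show ?case using assms closed_sg_comm_sg closed_sgD by simp
qed (use assms in simp)

lemma lcs_mono: "K \<subseteq> L \<Longrightarrow> \<gamma> K i \<subseteq> \<gamma> L i"
proof (induction i)
  case (Suc i)
  then show ?case unfolding lower_central.simps by (intro comm_sg_mono) auto
qed simp

section \<open>Continuity of words and conjugates of closed subgroups\<close>

lemma continuous_map_mult:
  assumes "continuous_map Y T f" "continuous_map Y T g"
  shows "continuous_map Y T (\<lambda>x. f x \<otimes> g x)"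
  using continuous_map_compose[OF continuous_map_pairedI[OF assms] continuous_mult] by (simp add: o_def)

lemma continuous_map_inv:
  assumes "continuous_map Y T f"
  shows "continuous_map Y T (\<lambda>x. inv (f x))"
  using continuous_map_compose[OF assms continuous_inv] by (simp add: o_def)

lemma continuous_map_group_const: "a \<in> carrier G \<Longrightarrow> continuous_map Y T (\<lambda>x. a)"
  by (simp add: topspace_eq)

lemma continuous_map_nat_pow: "continuous_map T T (\<lambda>x. x [^] (n::nat))"
  by (induction n) (simp_all add: continuous_map_mult topspace_eq)

lemma continuous_map_const_mult:
  assumes "a \<in> carrier G" "b \<in> carrier G"
  shows "continuous_map T T (\<lambda>x. a \<otimes> x \<otimes> b)"
  by (intro continuous_map_mult continuous_map_group_const assms continuous_map_id[unfolded id_def])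

lemma closedin_conj_vimage:
  assumes "a \<in> carrier G" "b \<in> carrier G" "closedin T C"
  shows "closedin T {x \<in> carrier G. a \<otimes> x \<otimes> b \<in> C}"
  using closedin_continuous_map_preimage[OF continuous_map_const_mult[OF assms(1,2)] assms(3)]
  by (simp add: topspace_eq)

lemma openin_conj_vimage:
  assumes "a \<in> carrier G" "b \<in> carrier G" "openin T C"
  shows "openin T {x \<in> carrier G. a \<otimes> x \<otimes> b \<in> C}"
  using openin_continuous_map_preimage[OF continuous_map_const_mult[OF assms(1,2)] assms(3)]
  by (simp add: topspace_eq)

lemma conj_vimage_eq:
  assumes g: "g \<in> carrier G" and K: "K \<subseteq> carrier G"
  shows "(\<lambda>x. g \<otimes> x \<otimes> inv g) ` K = {x \<in> carrier G. inv g \<otimes> x \<otimes> g \<in> K}"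
proof (intro equalityI subsetI)
  fix x assume "x \<in> {x \<in> carrier G. inv g \<otimes> x \<otimes> g \<in> K}"
  then have "x = g \<otimes> (inv g \<otimes> x \<otimes> g) \<otimes> inv g" "inv g \<otimes> x \<otimes> g \<in> K"
    using g by (simp add: word_simps, simp)
  then show "x \<in> (\<lambda>x. g \<otimes> x \<otimes> inv g) ` K" by blast
next
  fix x assume "x \<in> (\<lambda>x. g \<otimes> x \<otimes> inv g) ` K"
  then obtain k where k: "k \<in> K" "x = g \<otimes> k \<otimes> inv g" by auto
  moreover have "k \<in> carrier G" using k K by blast
  ultimately show "x \<in> {x \<in> carrier G. inv g \<otimes> x \<otimes> g \<in> K}"
    using g by (simp add: word_simps)
qed

lemma subgroup_conj:
  assumes g: "g \<in> carrier G" and K: "subgroup K G"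
  shows "subgroup ((\<lambda>x. g \<otimes> x \<otimes> inv g) ` K) G"
proof
  have car: "k \<in> carrier G" if "k \<in> K" for k
    using that K subgroup.mem_carrier by metis
  show "(\<lambda>x. g \<otimes> x \<otimes> inv g) ` K \<subseteq> carrier G"
    using g car by auto
  have "\<one> = g \<otimes> \<one> \<otimes> inv g" using g by simp
  then show "\<one> \<in> (\<lambda>x. g \<otimes> x \<otimes> inv g) ` K"
    using K subgroup.one_closed by blast
  fix x assume "x \<in> (\<lambda>x. g \<otimes> x \<otimes> inv g) ` K"
  then obtain k where k: "k \<in> K" "x = g \<otimes> k \<otimes> inv g" by auto
  have "inv x = g \<otimes> inv k \<otimes> inv g"
    using k g car by (simp add: word_simps)
  then show "inv x \<in> (\<lambda>x. g \<otimes> x \<otimes> inv g) ` K"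
    using k K by (simp add: subgroup.m_inv_closed)
  fix y assume "y \<in> (\<lambda>x. g \<otimes> x \<otimes> inv g) ` K"
  then obtain l where l: "l \<in> K" "y = g \<otimes> l \<otimes> inv g" by auto
  have "x \<otimes> y = g \<otimes> (k \<otimes> l) \<otimes> inv g"
    using k l g car by (simp add: word_simps)
  then show "x \<otimes> y \<in> (\<lambda>x. g \<otimes> x \<otimes> inv g) ` K"
    using k l K by (simp add: subgroup.m_closed)
qed

lemma closed_sg_conj:
  assumes "g \<in> carrier G" "closed_sg K"
  shows "closed_sg ((\<lambda>x. g \<otimes> x \<otimes> inv g) ` K)"
proof -
  have "closedin T ((\<lambda>x. g \<otimes> x \<otimes> inv g) ` K)"
    using closedin_conj_vimage[of "inv g" g K] assms
    by (simp add: conj_vimage_eq closed_sgD)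
  then show ?thesis using subgroup_conj assms by (simp add: closed_subgroup_def)
qed

lemma closed_sg_conj_vimage:
  assumes "g \<in> carrier G" "closed_sg K"
  shows "closed_sg {x \<in> carrier G. g \<otimes> x \<otimes> inv g \<in> K}"
  using closed_sg_conj[of "inv g" K] conj_vimage_eq[of "inv g" K] assms closed_sgD by simp

text \<open>The elements whose conjugate by \<open>g\<close> lies in the target form a closed
  subgroup, so it suffices that this subgroup contains the commutators.\<close>

lemma comm_sg_conj:
  assumes "g \<in> carrier G" "K \<subseteq> carrier G" "L \<subseteq> carrier G" "x \<in> comm_sg K L"
    and K: "\<And>k. k \<in> K \<Longrightarrow> g \<otimes> k \<otimes> inv g \<in> K'" and L: "\<And>k. k \<in> L \<Longrightarrow> g \<otimes> k \<otimes> inv g \<in> L'"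
    and "K' \<subseteq> carrier G" "L' \<subseteq> carrier G"
  shows "g \<otimes> x \<otimes> inv g \<in> comm_sg K' L'"
proof -
  have "comm_sg K L \<subseteq> {x \<in> carrier G. g \<otimes> x \<otimes> inv g \<in> comm_sg K' L'}"
  proof (rule comm_sg_least)
    fix x y assume "x \<in> K" "y \<in> L"
    moreover then have "x \<in> carrier G" "y \<in> carrier G" using assms by auto
    ultimately show "commutator G x y \<in> {x \<in> carrier G. g \<otimes> x \<otimes> inv g \<in> comm_sg K' L'}"
      using assms(1) K L by (simp add: commutator_conj commutator_in_comm_sg)
  qed (use assms in \<open>auto intro!: closed_sg_conj_vimage closed_sg_comm_sg\<close>)
  with assms show ?thesis by auto
qed

lemma normalizes_comm_sg:
  assumes "normalizes L A" "normalizes L B" "L \<subseteq> carrier G" "A \<subseteq> carrier G" "B \<subseteq> carrier G"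
  shows "normalizes L (comm_sg A B)"
  using assms unfolding normalizes_def by (intro ballI comm_sg_conj) auto

lemma normalizes_lcs:
  assumes "normalizes L K" "L \<subseteq> carrier G" "closed_sg K"
  shows "normalizes L (\<gamma> K i)"
proof (induction i)
  case (Suc i)
  then show ?case
    using assms(1,2) closed_sgD(3)[OF assms(3)] closed_sgD(3)[OF closed_sg_lcs[OF assms(3), of i]]
    by (simp add: normalizes_comm_sg)
qed (use assms in simp)

lemma lcs_Suc_subset:
  assumes "closed_sg K"
  shows "\<gamma> K (Suc i) \<subseteq> \<gamma> K i"
  unfolding lower_central.simps
proof (rule comm_sg_least)
  fix x y assume "x \<in> \<gamma> K i" "y \<in> K"
  then show "commutator G x y \<in> \<gamma> K i"
    by (intro commutator_mem_left[of K "\<gamma> K i"] normalizes_lcs normalizes_self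
        closed_sgD[OF assms] closed_sgD(1)[OF closed_sg_lcs[OF assms]] assms)
qed (rule closed_sg_lcs[OF assms])

lemma lcs_antimono: "closed_sg K \<Longrightarrow> i \<le> j \<Longrightarrow> \<gamma> K j \<subseteq> \<gamma> K i"
  by (rule lift_Suc_antimono_le[of "\<gamma> K", OF lcs_Suc_subset])

lemma lcs_subset: "closed_sg K \<Longrightarrow> \<gamma> K i \<subseteq> K"
  using lcs_antimono[of K 0 i] unfolding lower_central.simps by blast

lemma centralizer_closed_sg:
  assumes "S \<subseteq> carrier G" and H: "Hausdorff_space T"
  shows "closed_sg {g \<in> carrier G. \<forall>s\<in>S. g \<otimes> s = s \<otimes> g}"
proof -
  have "subgroup {g \<in> carrier G. \<forall>s\<in>S. g \<otimes> s = s \<otimes> g} G"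
  proof
    fix x y assume "x \<in> {g \<in> carrier G. \<forall>s\<in>S. g \<otimes> s = s \<otimes> g}" "y \<in> {g \<in> carrier G. \<forall>s\<in>S. g \<otimes> s = s \<otimes> g}"
    moreover have "x \<otimes> y \<otimes> s = s \<otimes> (x \<otimes> y)"
      if "x \<in> carrier G" "y \<in> carrier G" "s \<in> carrier G" "x \<otimes> s = s \<otimes> x" "y \<otimes> s = s \<otimes> y" for s
      using m_assoc[OF that(1,2,3)] m_assoc[OF that(1,3,2)] m_assoc[OF that(3,1,2)] that(4,5) by argo
    ultimately show "x \<otimes> y \<in> {g \<in> carrier G. \<forall>s\<in>S. g \<otimes> s = s \<otimes> g}"
      using assms by blast
  next
    fix x assume x: "x \<in> {g \<in> carrier G. \<forall>s\<in>S. g \<otimes> s = s \<otimes> g}"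
    have "inv x \<otimes> s = s \<otimes> inv x" if "s \<in> S" for s
    proof -
      have "inv x \<otimes> (s \<otimes> x) \<otimes> inv x = inv x \<otimes> (x \<otimes> s) \<otimes> inv x" using x that by simp
      moreover have "s \<in> carrier G" "x \<in> carrier G" using x that assms by auto
      ultimately show ?thesis by (simp add: word_simps)
    qed
    then show "inv x \<in> {g \<in> carrier G. \<forall>s\<in>S. g \<otimes> s = s \<otimes> g}" using x by auto
  qed (use assms in auto)
  moreover have "closedin T {g \<in> carrier G. g \<otimes> s = s \<otimes> g}" if "s \<in> S" for s
  proof -
    have s: "s \<in> carrier G" using assms that by auto
    \<comment> \<open>Commutation is rewritten as an equation between two maps of the shape
      \<open>a \<otimes> g \<otimes> b\<close>, so that the set becomes an equalizer of continuous
      maps into a Hausdorff space.\<close>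
    have "inv s \<otimes> g \<otimes> s = \<one> \<otimes> g \<otimes> \<one> \<longleftrightarrow> g \<otimes> s = s \<otimes> g" if "g \<in> carrier G" for g
      using that s inv_solve_left'[of g s "g \<otimes> s"] by (auto simp: m_assoc)
    then have "{g \<in> carrier G. g \<otimes> s = s \<otimes> g} = {g \<in> topspace T. inv s \<otimes> g \<otimes> s = \<one> \<otimes> g \<otimes> \<one>}"
      by (auto simp: topspace_eq)
    moreover have "closedin T {g \<in> topspace T. inv s \<otimes> g \<otimes> s = \<one> \<otimes> g \<otimes> \<one>}"
      by (rule closedin_continuous_maps_eq[OF H continuous_map_const_mult continuous_map_const_mult])
         (use s in auto)
    ultimately show ?thesis by simp
  qed
  then have "closedin T (\<Inter>s\<in>S. {g \<in> carrier G. g \<otimes> s = s \<otimes> g})" if "S \<noteq> {}"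
    using that by (intro closedin_Inter) auto
  moreover have "{g \<in> carrier G. \<forall>s\<in>S. g \<otimes> s = s \<otimes> g} = (if S = {} then topspace T else (\<Inter>s\<in>S. {g \<in> carrier G. g \<otimes> s = s \<otimes> g}))"
    by (auto simp: topspace_eq)
  ultimately show ?thesis by (auto simp: closed_subgroup_def)
qed

end

section \<open>Open normal subgroups of profinite groups\<close>

text \<open>The finite intersection property in a form where no finite intersection has to be
  computed: by directedness some member of the family lies inside it.\<close>

lemma directed_Inter_nonempty:
  assumes compact: "compact_space Y" and "\<C> \<noteq> {}" and closed: "\<And>C. C \<in> \<C> \<Longrightarrow> closedin Y C" and ne: "\<And>C. C \<in> \<C> \<Longrightarrow> C \<noteq> {}"
    and directed: "\<And>A B. A \<in> \<C> \<Longrightarrow> B \<in> \<C> \<Longrightarrow> \<exists>C\<in>\<C>. C \<subseteq> A \<inter> B"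
  shows "\<Inter>\<C> \<noteq> {}"
proof -
  have "\<exists>C\<in>\<C>. C \<subseteq> \<Inter>\<F>" if "finite \<F>" "\<F> \<subseteq> \<C>" for \<F>
    using that
  proof (induction \<F>)
    case (insert A \<F>)
    then obtain B where B: "B \<in> \<C>" "B \<subseteq> \<Inter>\<F>" by auto
    then obtain C where "C \<in> \<C>" "C \<subseteq> A \<inter> B" using directed[of A B] insert.prems by auto
    with B show ?case by (intro bexI[of _ C]) auto
  qed (use assms in auto)
  then have "\<Inter>\<F> \<noteq> {}" if "finite \<F>" "\<F> \<subseteq> \<C>" for \<F>
    using that ne by (metis subset_empty)
  with compact closed show ?thesis
    unfolding compact_space_fip by blast
qed

context profinite_group
begin

text \<open>In a compact Hausdorff space components and quasi-components coincide, and points of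
  different quasi-components are separated by a clopen set.\<close>

lemma clopen_separation:
  assumes "x \<in> carrier G" "y \<in> carrier G" "x \<noteq> y"
  obtains C where "closedin T C" "openin T C" "x \<in> C" "y \<notin> C"
proof -
  have "quasi_component_of T x = connected_component_of T x"
    using quasi_eq_connected_components_of[of T] compact Hausdorff
      quasi_eq_connected_components_of_pointwise_alt[of T] by blast
  then have "\<not> quasi_component_of T x y"
    using totally_disconnected[OF assms(1)] assms by auto
  then show thesis
    using that assms unfolding quasi_component_of topspace_eq by auto
qed

text \<open>If \<open>C\<close> is a clopen set that contains \<open>\<one>\<close> but not \<open>x\<close>, the elements \<open>u\<close> that may be inserted
  between any two factors without leaving or entering \<open>C\<close> form an open normal subgroup; its
  complement is the projection of a compact set.\<close>

lemma open_normal_avoiding: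
  assumes x: "x \<in> carrier G" "x \<noteq> \<one>"
  shows "\<exists>U. open_normal U \<and> x \<notin> U"
proof -
  obtain C where C: "closedin T C" "openin T C" "\<one> \<in> C" "x \<notin> C"
    using clopen_separation[of \<one> x] x by auto
  define S where "S = {u \<in> carrier G. \<forall>a\<in>carrier G. \<forall>b\<in>carrier G. a \<otimes> b \<in> C \<longleftrightarrow> a \<otimes> u \<otimes> b \<in> C}"
  have S_iff: "a \<otimes> u \<otimes> b \<in> C \<longleftrightarrow> a \<otimes> b \<in> C" if "u \<in> S" "a \<in> carrier G" "b \<in> carrier G" for u a b
    using that by (simp add: S_def)
  have "subgroup S G"
  proof
    fix u v assume uv: "u \<in> S" "v \<in> S"
    then have car: "u \<in> carrier G" "v \<in> carrier G" by (auto simp: S_def)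
    have "a \<otimes> b \<in> C \<longleftrightarrow> a \<otimes> (u \<otimes> v) \<otimes> b \<in> C" if ab: "a \<in> carrier G" "b \<in> carrier G" for a b
      using S_iff[OF uv(2), of "a \<otimes> u" b] S_iff[OF uv(1) ab] ab car by (simp add: m_assoc)
    then show "u \<otimes> v \<in> S" using car by (simp add: S_def)
  next
    fix u assume u: "u \<in> S"
    then have car: "u \<in> carrier G" by (auto simp: S_def)
    have "a \<otimes> b \<in> C \<longleftrightarrow> a \<otimes> inv u \<otimes> b \<in> C" if ab: "a \<in> carrier G" "b \<in> carrier G" for a b
      using S_iff[OF u, of "a \<otimes> inv u" b] ab car by (simp add: word_simps)
    then show "inv u \<in> S" using car by (simp add: S_def)
  qed (auto simp: S_def)
  moreover have "normalizes (carrier G) S"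
    unfolding normalizes_def
  proof (intro ballI)
    fix g u assume g: "g \<in> carrier G" and u: "u \<in> S"
    then have car: "u \<in> carrier G" by (auto simp: S_def)
    have "a \<otimes> b \<in> C \<longleftrightarrow> a \<otimes> (g \<otimes> u \<otimes> inv g) \<otimes> b \<in> C" if ab: "a \<in> carrier G" "b \<in> carrier G" for a b
      using S_iff[OF u, of "a \<otimes> g" "inv g \<otimes> b"] g ab car by (simp add: word_simps)
    then show "g \<otimes> u \<otimes> inv g \<in> S" using g car by (simp add: S_def)
  qed
  moreover have "openin T S"
  proof -
    let ?P = "prod_topology (prod_topology T T) T"
    let ?f = "\<lambda>p. fst (fst p) \<otimes> snd (fst p)" and ?h = "\<lambda>p. fst (fst p) \<otimes> snd p \<otimes> snd (fst p)"
    have proj: "continuous_map ?P T (\<lambda>p. fst (fst p))" "continuous_map ?P T (\<lambda>p. snd (fst p))"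
      "continuous_map ?P T snd"
      by (auto intro: continuous_map_compose[OF continuous_map_fst, unfolded o_def]
          continuous_map_fst continuous_map_snd)
    have cf: "continuous_map ?P T ?f" and ch: "continuous_map ?P T ?h"
      by (intro continuous_map_mult proj)+
    have clopen: "closedin ?P {p \<in> topspace ?P. f p \<in> C}" "closedin ?P {p \<in> topspace ?P. f p \<notin> C}"
      if f: "continuous_map ?P T f" for f
    proof -
      show "closedin ?P {p \<in> topspace ?P. f p \<in> C}"
        by (rule closedin_continuous_map_preimage[OF f C(1)])
      have "closedin ?P (topspace ?P - {p \<in> topspace ?P. f p \<in> C})"
        by (intro closedin_diff closedin_topspace openin_continuous_map_preimage[OF f C(2)])
      moreover have "topspace ?P - {p \<in> topspace ?P. f p \<in> C} = {p \<in> topspace ?P. f p \<notin> C}" by auto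
      ultimately show "closedin ?P {p \<in> topspace ?P. f p \<notin> C}" by simp
    qed
    let ?D = "({p \<in> topspace ?P. ?f p \<in> C} \<inter> {p \<in> topspace ?P. ?h p \<notin> C}) \<union>
        ({p \<in> topspace ?P. ?f p \<notin> C} \<inter> {p \<in> topspace ?P. ?h p \<in> C})"
    have "compactin ?P ?D"
      by (rule closedin_compact_space)
        (intro compact closedin_Un closedin_Int clopen cf ch compact_space_prod_topology[THEN iffD2] disjI2 conjI)+
    then have "compactin T (snd ` ?D)"
      by (rule image_compactin[OF _ proj(3)])
    then have "closedin T (snd ` ?D)"
      by (rule compactin_imp_closedin[OF Hausdorff])
    moreover have "snd ` ?D = carrier G - S"
    proof (intro equalityI subsetI)
      fix u assume "u \<in> carrier G - S"
      then obtain a b where "a \<in> carrier G" "b \<in> carrier G" "u \<in> carrier G"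
        "\<not> (a \<otimes> b \<in> C \<longleftrightarrow> a \<otimes> u \<otimes> b \<in> C)"
        by (auto simp: S_def)
      then have "((a, b), u) \<in> ?D" by (auto simp: topspace_eq)
      then show "u \<in> snd ` ?D" by (rule rev_image_eqI) simp
    next
      fix u assume "u \<in> snd ` ?D"
      then obtain a b where "a \<in> carrier G" "b \<in> carrier G" "u \<in> carrier G"
        "\<not> (a \<otimes> b \<in> C \<longleftrightarrow> a \<otimes> u \<otimes> b \<in> C)"
        by (auto simp: topspace_eq)
      then show "u \<in> carrier G - S" by (auto simp: S_def)
    qed
    ultimately have "closedin T (carrier G - S)" by simp
    moreover have "S \<subseteq> carrier G" by (auto simp: S_def)
    ultimately show ?thesis by (simp add: openin_closedin topspace_eq)
  qed
  moreover have "x \<notin> S"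
    using S_iff[of x \<one> \<one>] x C by auto
  ultimately show ?thesis
    unfolding open_normal_def normal_iff_normalizes by blast
qed

text \<open>The sets \<open>C \<inter> U\<close> are closed, non-empty and directed, so they share a
  point, and \<open>\<one>\<close> is the only point common to all open normal subgroups. That these
  are closed is derived further down, whence the third premise.\<close>

lemma one_in_closed:
  assumes C: "closedin T C" and ne: "\<And>U. open_normal U \<Longrightarrow> C \<inter> U \<noteq> {}"
    and closed: "\<And>U. open_normal U \<Longrightarrow> closedin T U"
  shows "\<one> \<in> C"
proof -
  have "\<Inter>{C \<inter> U |U. open_normal U} \<noteq> {}"
  proof (rule directed_Inter_nonempty[OF compact])
    show "{C \<inter> U |U. open_normal U} \<noteq> {}" using open_normal_carrier by auto
    fix A B assume "A \<in> {C \<inter> U |U. open_normal U}" "B \<in> {C \<inter> U |U. open_normal U}"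
    then obtain U V where "open_normal U" "open_normal V" "A = C \<inter> U" "B = C \<inter> V" by auto
    then show "\<exists>D\<in>{C \<inter> U |U. open_normal U}. D \<subseteq> A \<inter> B"
      by (intro bexI[of _ "C \<inter> (U \<inter> V)"]) (auto intro: open_normal_Int)
  qed (use C ne closed in auto)
  then obtain x where x: "\<And>U. open_normal U \<Longrightarrow> x \<in> C \<inter> U" by auto
  then have "x \<in> carrier G" "x \<in> C" using open_normal_carrier by auto
  moreover have "x = \<one>" using open_normal_avoiding[of x] x \<open>x \<in> carrier G\<close> by auto
  ultimately show ?thesis by simp
qed

section \<open>Products of closed or open sets, and cosets of open subgroups\<close>

lemma closedin_set_mult:
  assumes A: "closedin T A" and B: "closedin T B"
  shows "closedin T (A <#> B)"
proof -
  have "compactin (prod_topology T T) (A \<times> B)"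
    by (intro compactin_Times[THEN iffD2] disjI2 conjI closedin_compact_space compact A B)
  then have "compactin T ((\<lambda>(x, y). x \<otimes> y) ` (A \<times> B))"
    by (rule image_compactin[OF _ continuous_mult])
  moreover have "(\<lambda>(x, y). x \<otimes> y) ` (A \<times> B) = A <#> B"
    by (auto simp: set_mult_def)
  ultimately show ?thesis using compactin_imp_closedin[OF Hausdorff] by simp
qed

lemma closed_sg_set_mult:
  "closed_sg K \<Longrightarrow> closed_sg N \<Longrightarrow> normalizes K N \<Longrightarrow> closed_sg (K <#> N)"
  by (simp add: closed_subgroup_def subgroup_set_mult closedin_set_mult)

lemma openin_set_mult:
  assumes A: "A \<subseteq> carrier G" and U: "openin T U"
  shows "openin T (A <#> U)"
proof -
  have "A <#> U = (\<Union>a\<in>A. {x \<in> carrier G. inv a \<otimes> x \<otimes> \<one> \<in> U})"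
  proof (intro equalityI subsetI)
    fix x assume "x \<in> A <#> U"
    then obtain a u where x: "a \<in> A" "u \<in> U" "x = a \<otimes> u" by (rule set_mult_memE)
    moreover have "a \<in> carrier G" "u \<in> carrier G"
      using x A openin_subset[OF U] by (auto simp: topspace_eq)
    ultimately show "x \<in> (\<Union>a\<in>A. {x \<in> carrier G. inv a \<otimes> x \<otimes> \<one> \<in> U})"
      by (intro UN_I[of a]) (simp_all add: inv_mult_cancel)
  next
    fix x assume "x \<in> (\<Union>a\<in>A. {x \<in> carrier G. inv a \<otimes> x \<otimes> \<one> \<in> U})"
    then obtain a where a: "a \<in> A" "x \<in> carrier G" "inv a \<otimes> x \<in> U" using A by auto
    then have "a \<otimes> (inv a \<otimes> x) = x" using A by (simp add: subsetD inv_mult_cancel)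
    then show "x \<in> A <#> U" using set_mult_memI[OF a(1,3)] by simp
  qed
  moreover have "openin T (\<Union>a\<in>A. {x \<in> carrier G. inv a \<otimes> x \<otimes> \<one> \<in> U})"
    using A U openin_conj_vimage[of _ \<one> U] by (intro openin_Union) (auto simp: subsetD)
  ultimately show ?thesis by simp
qed

lemma open_sg_set_mult:
  "subgroup K G \<Longrightarrow> open_sg U \<Longrightarrow> normalizes K U \<Longrightarrow> open_sg (K <#> U)"
  by (simp add: open_subgroup_def subgroup_set_mult openin_set_mult subgroup.subset)

lemma open_sg_closed:
  assumes "open_sg U"
  shows "closed_sg U"
proof -
  note U = open_sgD[OF assms]
  have "carrier G - U = (carrier G - U) <#> U"
  proof (intro equalityI subsetI)
    fix x assume "x \<in> carrier G - U"
    then show "x \<in> (carrier G - U) <#> U"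
      using set_mult_memI[of x "carrier G - U" \<one> U] U by simp
  next
    fix x assume "x \<in> (carrier G - U) <#> U"
    then obtain a u where x: "a \<in> carrier G" "a \<notin> U" "u \<in> U" "x = a \<otimes> u" by (auto elim: set_mult_memE)
    then have u: "u \<in> carrier G" using U by auto
    have "a \<otimes> u \<otimes> inv u = a" using x u by (simp add: word_simps)
    then have "x \<notin> U"
      using x(2-4) U(1) subgroup.m_closed[OF U(1), of x "inv u"] subgroup.m_inv_closed[OF U(1), of u] by auto
    then show "x \<in> carrier G - U" using x u by simp
  qed
  moreover have "openin T ((carrier G - U) <#> U)" using U(2) by (intro openin_set_mult) auto
  ultimately have "openin T (carrier G - U)" by simp
  then have "closedin T U" using U(3) by (simp add: closedin_def topspace_eq)
  then show ?thesis using U(1) by (simp add: closed_subgroup_def)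
qed

lemma open_normal_closed: "open_normal U \<Longrightarrow> closed_sg U"
  using open_normalD(1) open_sg_closed by simp

lemma open_normal_disjoint:
  assumes C: "closedin T C" and "\<one> \<notin> C"
  obtains U where "open_normal U" "C \<inter> U = {}"
  using one_in_closed[OF C] assms(2) open_normal_closed closed_sgD(2) by metis

lemma open_normal_in_open:
  assumes "openin T W" "\<one> \<in> W"
  obtains U where "open_normal U" "U \<subseteq> W"
proof -
  have "closedin T (topspace T - W)" using assms(1) by (simp add: closedin_def openin_subset Diff_Diff_Int inf_absorb2)
  then obtain U where "open_normal U" "(topspace T - W) \<inter> U = {}"
    using open_normal_disjoint assms(2) by (metis DiffD2)
  then show thesis using that[of U] open_normalD(4)[of U] by (auto simp: topspace_eq)
qed

lemma open_normal_in_open_sg: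
  assumes "open_sg L"
  obtains U where "open_normal U" "U \<subseteq> L"
  using open_normal_in_open[of L] open_sgD[OF assms] by metis

text \<open>A closed set is the intersection of its thickenings \<open>C <#> U\<close>: the set of
  \<open>y\<close> with \<open>x \<otimes> inv y \<in> C\<close> is closed and meets every
  \<open>U\<close>, so it contains \<open>\<one>\<close>.\<close>

lemma mem_closed_iff_cosets:
  assumes C: "closedin T C" and x: "\<And>U. open_normal U \<Longrightarrow> x \<in> C <#> U"
  shows "x \<in> C"
proof -
  have car: "C \<subseteq> carrier G" using closedin_subset[OF C] by (simp add: topspace_eq)
  have "x \<in> C <#> carrier G" using x[OF open_normal_carrier] .
  then have xc: "x \<in> carrier G" using car by (auto simp: set_mult_def)
  have ic: "continuous_map T T (\<lambda>y. x \<otimes> y \<otimes> \<one>)" by (intro continuous_map_const_mult xc one_closed)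
  have "continuous_map T T (\<lambda>y. x \<otimes> inv y)"
    by (rule continuous_map_eq[OF continuous_map_compose[OF continuous_inv ic]])
       (simp add: xc topspace_eq)
  then have "closedin T {y \<in> topspace T. x \<otimes> inv y \<in> C}"
    by (rule closedin_continuous_map_preimage[OF _ C])
  moreover have "{y \<in> topspace T. x \<otimes> inv y \<in> C} \<inter> U \<noteq> {}" if "open_normal U" for U
  proof -
    have "x \<in> C <#> U" using x[OF that] .
    then obtain c u where cu: "c \<in> C" "u \<in> U" "x = c \<otimes> u"
      by (rule set_mult_memE)
    moreover have "c \<in> carrier G" "u \<in> carrier G" using cu car open_normalD(4)[OF that] by auto
    ultimately have "u \<in> {y \<in> topspace T. x \<otimes> inv y \<in> C} \<inter> U"
      by (simp add: topspace_eq m_assoc)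
    then show ?thesis by blast
  qed
  ultimately have "\<one> \<in> {y \<in> topspace T. x \<otimes> inv y \<in> C}"
    using open_normal_closed closed_sgD(2) by (intro one_in_closed) auto
  then show ?thesis using xc by simp
qed

lemma finite_cosets:
  assumes "open_sg U"
  obtains R where "finite R" "R \<subseteq> carrier G" "carrier G = R <#> U"
proof -
  note U = open_sgD[OF assms]
  have "openin T ({a} <#> U)" if "a \<in> carrier G" for a
    using that U(2) by (intro openin_set_mult) auto
  moreover have "topspace T \<subseteq> \<Union>((\<lambda>a. {a} <#> U) ` carrier G)"
  proof
    fix a assume "a \<in> topspace T"
    then have a: "a \<in> carrier G" by (simp add: topspace_eq)
    then have "a \<in> {a} <#> U" using set_mult_memI[of a "{a}" \<one> U] U by simp
    then show "a \<in> \<Union>((\<lambda>a. {a} <#> U) ` carrier G)" using a by auto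
  qed
  ultimately obtain \<F> where F: "finite \<F>" "\<F> \<subseteq> (\<lambda>a. {a} <#> U) ` carrier G" "topspace T \<subseteq> \<Union>\<F>"
    using compact unfolding compact_space_alt by (metis (no_types, lifting) imageE)
  then obtain R where R: "R \<subseteq> carrier G" "finite R" "\<F> = (\<lambda>a. {a} <#> U) ` R"
    by (meson finite_subset_image)
  have "R <#> U = (\<Union>a\<in>R. {a} <#> U)" by (auto simp: set_mult_def)
  then have "carrier G \<subseteq> R <#> U" using F(3) R(3) by (simp add: topspace_eq)
  moreover have "R <#> U \<subseteq> carrier G" using R(1) U(3) by (auto simp: set_mult_def)
  ultimately show thesis using that R by blast
qed

text \<open>Modulo \<open>N\<close> every entry of a commutator may be replaced by its component in
  \<open>K\<close>.\<close>

lemma lcs_set_mult: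
  assumes K: "closed_sg K" and N: "closed_sg N" and n: "normalizes K N"
  shows "\<gamma> (K <#> N) i \<subseteq> \<gamma> K i <#> N"
proof (induction i)
  case (Suc i)
  note K' = closed_sgD[OF K] and N' = closed_sgD[OF N]
  have sub: "\<gamma> K j \<subseteq> K" for j by (rule lcs_subset[OF K])
  show ?case
    unfolding lower_central.simps
  proof (rule comm_sg_least)
    show "closed_sg (comm_sg (\<gamma> K i) K <#> N)"
      using closed_sg_set_mult[OF closed_sg_lcs[OF K, of "Suc i"] N] normalizes_mono[OF n sub[of "Suc i"]] by simp
    fix x y assume "x \<in> \<gamma> (K <#> N) i" "y \<in> K <#> N"
    then have "x \<in> \<gamma> K i <#> N" "y \<in> K <#> N" using Suc.IH by auto
    then obtain a u b v where xy: "a \<in> \<gamma> K i" "u \<in> N" "x = a \<otimes> u" "b \<in> K" "v \<in> N" "y = b \<otimes> v"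
      by (elim set_mult_memE)
    then have "a \<in> K" using sub by auto
    then obtain w where "w \<in> N" "commutator G x y = commutator G a b \<otimes> w"
      using commutator_cong_mod[OF K'(1) N'(1) n, of a u b v] xy by auto
    then show "commutator G x y \<in> comm_sg (\<gamma> K i) K <#> N"
      using xy by (simp add: set_mult_memI commutator_in_comm_sg)
  qed
qed simp

lemma lcs_set_mult_eq:
  assumes K: "closed_sg K" and N: "closed_sg N" and n: "normalizes K N"
  shows "\<gamma> (K <#> N) i <#> N = \<gamma> K i <#> N"
proof
  note K' = closed_sgD[OF K] and N' = closed_sgD[OF N]
  have "\<gamma> (K <#> N) i <#> N \<subseteq> (\<gamma> K i <#> N) <#> N"
    by (intro set_mult_mono lcs_set_mult assms subset_refl)
  also have "\<dots> = \<gamma> K i <#> N"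
    using closed_sgD(3)[OF closed_sg_lcs[OF K, of i]] N'(1,3)
    by (simp add: set_mult_assoc subgroup_mult_id)
  finally show "\<gamma> (K <#> N) i <#> N \<subseteq> \<gamma> K i <#> N" .
  show "\<gamma> K i <#> N \<subseteq> \<gamma> (K <#> N) i <#> N"
    by (intro set_mult_mono lcs_mono subset_set_mult1 K' N' subset_refl)
qed

end

section \<open>Finiteness modulo a subgroup\<close>

context group
begin

text \<open>The quotient \<open>F / B\<close> is handed out as an abstract group \<open>Q\<close>
  with a map \<open>h\<close> and computation rules, so that arguments in it never unfold cosets or
  the restricted record.\<close>

lemma quotient_hom:
  assumes F: "subgroup F G" and B: "subgroup B G" "B \<subseteq> F" and n: "normalizes F B"
  obtains Q :: "'a set monoid" and h where "group Q" "carrier Q = h ` F"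
    "\<And>x y. x \<in> F \<Longrightarrow> y \<in> F \<Longrightarrow> h (x \<otimes> y) = h x \<otimes>\<^bsub>Q\<^esub> h y"
    "\<And>x. x \<in> F \<Longrightarrow> h (inv x) = inv\<^bsub>Q\<^esub> (h x)"
    "\<And>x y. x \<in> F \<Longrightarrow> y \<in> F \<Longrightarrow> h (commutator G x y) = commutator Q (h x) (h y)"
    "\<And>x (k::nat). x \<in> F \<Longrightarrow> h (x [^] k) = h x [^]\<^bsub>Q\<^esub> k"
    "\<And>x. x \<in> F \<Longrightarrow> h x = \<one>\<^bsub>Q\<^esub> \<longleftrightarrow> x \<in> B"
proof -
  let ?F = "G\<lparr>carrier := F\<rparr>"
  let ?Q = "?F Mod B"
  let ?h = "\<lambda>x. B #>\<^bsub>?F\<^esub> x"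
  interpret F: group ?F by (rule subgroup_imp_group[OF F])
  have invF: "inv\<^bsub>?F\<^esub> x = inv x" if "x \<in> F" for x
    by (rule m_inv_consistent[OF F that])
  have BF: "subgroup B ?F" by (rule subgroup_incl[OF B(1) F B(2)])
  have N: "B \<lhd> ?F"
    unfolding F.normal_inv_iff using BF normalizesD[OF n] invF by simp
  interpret N: normal B ?F by (rule N)
  interpret Q: group ?Q by (rule N.factorgroup_is_group)
  have hom: "?h \<in> hom ?F ?Q" using normal.r_coset_hom_Mod[OF N] .
  interpret h: group_hom ?F ?Q ?h
    by (intro group_hom.intro group_hom_axioms.intro F.group_axioms Q.group_axioms hom)
  have Finv: "inv x \<in> F" if "x \<in> F" for x using F that by (rule subgroup.m_inv_closed)
  have mul: "?h (x \<otimes> y) = ?h x \<otimes>\<^bsub>?Q\<^esub> ?h y" if "x \<in> F" "y \<in> F" for x y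
    using h.hom_mult[of x y] that by simp
  have inv: "?h (inv x) = inv\<^bsub>?Q\<^esub> (?h x)" if "x \<in> F" for x
    using h.hom_inv[of x] that invF by simp
  have comm: "?h (commutator G x y) = commutator ?Q (?h x) (?h y)" if "x \<in> F" "y \<in> F" for x y
  proof -
    obtain Q h where Qh: "Q = ?Q" "h = ?h" by blast
    have "h (commutator G x y) = commutator Q (h x) (h y)"
      using that F mul[folded Qh] inv[folded Qh]
      by (simp add: commutator_def Finv subgroup.m_closed)
    then show ?thesis unfolding Qh .
  qed
  show thesis
  proof (rule that[of ?Q ?h])
    show "group ?Q" by (rule Q.group_axioms)
    show "carrier ?Q = ?h ` F" by (auto simp: FactGroup_def RCOSETS_def)
    show "?h (x \<otimes> y) = ?h x \<otimes>\<^bsub>?Q\<^esub> ?h y" if "x \<in> F" "y \<in> F" for x y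
      using mul that .
    show "?h (inv x) = inv\<^bsub>?Q\<^esub> (?h x)" if "x \<in> F" for x using inv that .
    show "?h (commutator G x y) = commutator ?Q (?h x) (?h y)" if "x \<in> F" "y \<in> F" for x y
      using comm that .
    show "?h (x [^] k) = ?h x [^]\<^bsub>?Q\<^esub> k" if "x \<in> F" for x and k :: nat
      using h.hom_nat_pow[of x k] that nat_pow_consistent[of x k F] by simp
    show "?h x = \<one>\<^bsub>?Q\<^esub> \<longleftrightarrow> x \<in> B" if "x \<in> F" for x
      using F.coset_join1[of B x] F.coset_join2[of x B] BF that N.subset by auto
  qed
qed

text \<open>Removes the conjugations that appear when a commutator with a power is expanded factor
  by factor.\<close>

lemma conj_nat_pow_commuting:
  assumes "x \<in> carrier G" "z \<in> carrier G" "z \<otimes> x = x \<otimes> z"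
  shows "inv x \<otimes> z [^] (k::nat) \<otimes> x = z [^] k"
  using assms group_commutes_pow[of z x k] by (simp add: m_assoc inv_mult_cancel)

lemma commutator_nat_pow_left:
  assumes x: "x \<in> carrier G" and f: "f \<in> carrier G"
    and comm: "commutator G x f \<otimes> x = x \<otimes> commutator G x f"
  shows "commutator G (x [^] (k::nat)) f = commutator G x f [^] k"
proof (induction k)
  case 0
  show ?case using f by (simp add: commutator_def)
next
  case (Suc k)
  then show ?case
    using x f conj_nat_pow_commuting[OF x _ comm, of k] by (simp add: commutator_mult_left)
qed

lemma commutator_nat_pow_right:
  assumes x: "x \<in> carrier G" and f: "f \<in> carrier G"
    and comm: "commutator G x f \<otimes> f = f \<otimes> commutator G x f"
  shows "commutator G x (f [^] (k::nat)) = commutator G x f [^] k"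
proof (induction k)
  case 0
  show ?case using x by (simp add: commutator_def)
next
  case (Suc k)
  have "commutator G x (f [^] Suc k) = commutator G x f \<otimes> commutator G x f [^] k"
    using Suc x f conj_nat_pow_commuting[OF f _ comm, of k] by (simp add: commutator_mult_right)
  also have "\<dots> = commutator G x f [^] Suc k"
    using x f by (simp add: nat_pow_Suc2[symmetric])
  finally show ?case .
qed

text \<open>A covering form of finite index: \<open>A\<close> and \<open>B\<close> are arbitrary
  sets, and \<open>B\<close> need not lie in \<open>A\<close>. Inside the carrier it is transitive
  without any normality, so chains of factors compose directly.\<close>

definition finite_modulo :: "'a set \<Rightarrow> 'a set \<Rightarrow> bool" where
  "finite_modulo A B \<longleftrightarrow> (\<exists>R. finite R \<and> R \<subseteq> carrier G \<and> A \<subseteq> R <#> B)"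

lemma finite_modulo_refl: "A \<subseteq> carrier G \<Longrightarrow> finite_modulo A A"
  unfolding finite_modulo_def by (rule exI[of _ "{\<one>}"]) (auto simp: set_mult_def subset_iff)

lemma finite_modulo_mono:
  "finite_modulo A B \<Longrightarrow> A' \<subseteq> A \<Longrightarrow> B \<subseteq> B' \<Longrightarrow> finite_modulo A' B'"
  unfolding finite_modulo_def by (meson set_mult_mono subset_refl subset_trans)

lemma finite_set_mult: "finite A \<Longrightarrow> finite B \<Longrightarrow> finite (A <#> B)"
  by (simp add: set_mult_def)

lemma finite_modulo_trans:
  assumes AB: "finite_modulo A B" and BC: "finite_modulo B C" and C: "C \<subseteq> carrier G"
  shows "finite_modulo A C"
proof -
  obtain R where R: "finite R" "R \<subseteq> carrier G" "A \<subseteq> R <#> B"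
    using AB by (auto simp: finite_modulo_def)
  obtain S where S: "finite S" "S \<subseteq> carrier G" "B \<subseteq> S <#> C"
    using BC by (auto simp: finite_modulo_def)
  have "A \<subseteq> R <#> (S <#> C)" using R(3) set_mult_mono[OF subset_refl S(3), of R] by simp
  also have "\<dots> = (R <#> S) <#> C" using R S C by (simp add: set_mult_assoc)
  finally have "A \<subseteq> (R <#> S) <#> C" .
  with finite_set_mult[OF R(1) S(1)] set_mult_closed[OF R(2) S(2)] show ?thesis
    unfolding finite_modulo_def by (intro exI[of _ "R <#> S"] conjI)
qed

text \<open>\<open>C\<close> is a union of left cosets of \<open>B\<close>, so it is recovered from
  the representatives that it contains, as \<open>(R \<inter> C) <#> B\<close>.\<close>

lemma finite_subgroups_between:
  assumes "finite_modulo A B"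
  shows "finite {C. subgroup C G \<and> B \<subseteq> C \<and> C \<subseteq> A}"
proof -
  obtain R where R: "finite R" "R \<subseteq> carrier G" "A \<subseteq> R <#> B"
    using assms by (auto simp: finite_modulo_def)
  have "C \<in> (\<lambda>S. S <#> B) ` Pow R" if C: "subgroup C G" "B \<subseteq> C" "C \<subseteq> A" for C
  proof
    show "C = (R \<inter> C) <#> B"
    proof
      show "C \<subseteq> (R \<inter> C) <#> B"
      proof
        fix x assume x: "x \<in> C"
        then have "x \<in> R <#> B" using C(3) R(3) by auto
        then obtain r b where rb: "r \<in> R" "b \<in> B" "x = r \<otimes> b" by (rule set_mult_memE)
        moreover have "b \<in> C" "b \<in> carrier G" "r \<in> carrier G"
          using rb C R subgroup.mem_carrier[OF C(1)] by auto
        ultimately have "r = x \<otimes> inv b" by (simp add: word_simps)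
        then have "r \<in> C"
          using x \<open>b \<in> C\<close> C(1) by (simp add: subgroup.m_closed subgroup.m_inv_closed)
        then show "x \<in> (R \<inter> C) <#> B" using rb by (simp add: set_mult_memI)
      qed
      show "(R \<inter> C) <#> B \<subseteq> C" by (rule set_mult_least) (use C in auto)
    qed
  qed auto
  then have "{C. subgroup C G \<and> B \<subseteq> C \<and> C \<subseteq> A} \<subseteq> (\<lambda>S. S <#> B) ` Pow R"
    by (intro subsetI, elim CollectE conjE)
  with R(1) show ?thesis by (meson finite_Pow_iff finite_surj)
qed

text \<open>\<open>K <#> V\<close> is a union of left cosets of \<open>V\<close> even when
  \<open>K\<close> is merely a set, so the representatives in it determine it.\<close>

lemma finite_set_mult_images:
  assumes V: "subgroup V G" and fm: "finite_modulo (carrier G) V"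
  shows "finite ((\<lambda>K. K <#> V) ` {K. K \<subseteq> carrier G})"
proof -
  obtain R where R: "finite R" "R \<subseteq> carrier G" "carrier G \<subseteq> R <#> V"
    using fm by (auto simp: finite_modulo_def)
  have "K <#> V \<in> (\<lambda>S. S <#> V) ` Pow R" if K: "K \<subseteq> carrier G" for K
  proof
    let ?S = "R \<inter> (K <#> V)"
    have KV: "(K <#> V) <#> V = K <#> V"
      using K V by (simp add: set_mult_assoc subgroup.subset subgroup_mult_id)
    show "K <#> V = ?S <#> V"
    proof
      show "?S <#> V \<subseteq> K <#> V" using set_mult_mono[of ?S "K <#> V" V V] KV by auto
      show "K <#> V \<subseteq> ?S <#> V"
      proof
        fix x assume x: "x \<in> K <#> V"
        then have "x \<in> R <#> V" using R(3) set_mult_closed[OF K subgroup.subset[OF V]] by auto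
        then obtain r v where rv: "r \<in> R" "v \<in> V" "x = r \<otimes> v" by (rule set_mult_memE)
        then have "r = x \<otimes> inv v" using R V by (auto simp: word_simps subgroup.mem_carrier subsetD)
        moreover have "x \<otimes> inv v \<in> (K <#> V) <#> V"
          using x rv(2) V by (intro set_mult_memI subgroup.m_inv_closed)
        ultimately have "r \<in> (K <#> V) <#> V" by simp
        then show "x \<in> ?S <#> V" using rv KV by (simp add: set_mult_memI)
      qed
    qed
  qed auto
  then have "(\<lambda>K. K <#> V) ` {K. K \<subseteq> carrier G} \<subseteq> (\<lambda>S. S <#> V) ` Pow R"
    by (intro subsetI, elim imageE CollectE) simp
  with R(1) show ?thesis by (meson finite_Pow_iff finite_surj)
qed

lemma subgroup_nat_pow_closed: "subgroup H G \<Longrightarrow> x \<in> H \<Longrightarrow> x [^] (k::nat) \<in> H"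
  by (induction k) (simp_all add: subgroup.one_closed subgroup.m_closed)

text \<open>The exponent is the order of \<open>F / V\<close>, which is finite because the
  representatives lying in \<open>F\<close> exhaust it.\<close>

lemma nat_pow_mem_of_finite_modulo:
  assumes F: "subgroup F G" and V: "subgroup V G" "V \<subseteq> F" "normalizes F V"
    and fm: "finite_modulo F V"
  shows "\<exists>n::nat. n > 0 \<and> (\<forall>f\<in>F. f [^] n \<in> V)"
proof -
  obtain Q :: "'a set monoid" and h where Q: "group Q" "carrier Q = h ` F"
    and mul: "\<And>x y. x \<in> F \<Longrightarrow> y \<in> F \<Longrightarrow> h (x \<otimes> y) = h x \<otimes>\<^bsub>Q\<^esub> h y"
    and pow: "\<And>x (k::nat). x \<in> F \<Longrightarrow> h (x [^] k) = h x [^]\<^bsub>Q\<^esub> k"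
    and one: "\<And>x. x \<in> F \<Longrightarrow> h x = \<one>\<^bsub>Q\<^esub> \<longleftrightarrow> x \<in> V"
    by (rule quotient_hom[OF F V]) blast
  interpret Q: group Q by (rule Q(1))
  obtain R where R: "finite R" "R \<subseteq> carrier G" "F \<subseteq> R <#> V"
    using fm by (auto simp: finite_modulo_def)
  have "carrier Q \<subseteq> h ` (R \<inter> F)"
  proof
    fix q assume "q \<in> carrier Q"
    then obtain x where x: "x \<in> F" "q = h x" using Q(2) by auto
    then have "x \<in> R <#> V" using R(3) by auto
    then obtain r v where rv: "r \<in> R" "v \<in> V" "x = r \<otimes> v" by (rule set_mult_memE)
    then have "r = x \<otimes> inv v" using R V by (auto simp: word_simps subgroup.mem_carrier subsetD)
    moreover have "x \<otimes> inv v \<in> F"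
      using x(1) rv(2) V F by (intro subgroup.m_closed subgroup.m_inv_closed) auto
    ultimately have rF: "r \<in> F" by simp
    have "v \<in> F" using rv V by auto
    then have "h x = h r \<otimes>\<^bsub>Q\<^esub> h v" using mul rv rF by simp
    also have "\<dots> = h r" using one[of v] rv \<open>v \<in> F\<close> rF Q(2) by simp
    finally show "q \<in> h ` (R \<inter> F)" using x rF rv by auto
  qed
  then have fin: "finite (carrier Q)" using R(1) finite_subset by blast
  have "f [^] order Q \<in> V" if "f \<in> F" for f
  proof -
    have "f [^] order Q \<in> F" using F that by (rule subgroup_nat_pow_closed)
    moreover have "h (f [^] order Q) = \<one>\<^bsub>Q\<^esub>"
      using that pow Q.pow_order_eq_1[of "h f"] Q(2) by simp
    ultimately show ?thesis using one by blast
  qed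
  moreover have "order Q > 0" using fin Q.order_gt_0_iff_finite by blast
  ultimately show ?thesis by blast
qed

end

context topological_group
begin

text \<open>The centralizer of \<open>S\<close> modulo \<open>B\<close>, taken in \<open>F\<close>.
  Closure under products rests on [xy, s] = [x, s]^y [y, s], where the conjugating element lies in
  \<open>F\<close>; hence it is \<open>F\<close> that has to normalize \<open>B\<close>.\<close>

lemma closed_sg_commutator_vimage:
  assumes F: "closed_sg F" and B: "closed_sg B" "normalizes F B" and S: "S \<subseteq> carrier G"
  shows "closed_sg {x \<in> F. \<forall>s\<in>S. commutator G x s \<in> B}"
proof -
  note F' = closed_sgD[OF F] and B' = closed_sgD[OF B(1)]
  have car: "x \<in> carrier G" if "x \<in> F \<or> x \<in> S \<or> x \<in> B" for x using that F' B' S by auto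
  have "subgroup {x \<in> F. \<forall>s\<in>S. commutator G x s \<in> B} G"
  proof
    fix x y assume xy: "x \<in> {x \<in> F. \<forall>s\<in>S. commutator G x s \<in> B}" "y \<in> {x \<in> F. \<forall>s\<in>S. commutator G x s \<in> B}"
    have "commutator G (x \<otimes> y) s \<in> B" if "s \<in> S" for s
    proof -
      have "inv y \<otimes> commutator G x s \<otimes> y \<in> B"
        using xy that by (intro normalizesD_inv[OF B(2) F'(1)]) auto
      then show ?thesis
        using xy that car B'(1) by (simp add: commutator_mult_left subgroup.m_closed)
    qed
    then show "x \<otimes> y \<in> {x \<in> F. \<forall>s\<in>S. commutator G x s \<in> B}"
      using xy F' by (simp add: subgroup.m_closed)
  next
    fix x assume x: "x \<in> {x \<in> F. \<forall>s\<in>S. commutator G x s \<in> B}"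
    have "commutator G (inv x) s \<in> B" if s: "s \<in> S" for s
    proof -
      have "commutator G (inv x) s = x \<otimes> inv (commutator G x s) \<otimes> inv x"
        using x s car by (simp add: commutator_def word_simps)
      moreover have "x \<otimes> inv (commutator G x s) \<otimes> inv x \<in> B"
        using x s B'(1) by (intro normalizesD[OF B(2)] subgroup.m_inv_closed) auto
      ultimately show ?thesis by simp
    qed
    then show "inv x \<in> {x \<in> F. \<forall>s\<in>S. commutator G x s \<in> B}"
      using x F' by (simp add: subgroup.m_inv_closed)
  next
    have "commutator G \<one> s \<in> B" if "s \<in> S" for s
      using car that B'(4) by (simp add: commutator_def)
    then show "\<one> \<in> {x \<in> F. \<forall>s\<in>S. commutator G x s \<in> B}" using F' by simp
  qed (use F' in auto)
  moreover have "closedin T {x \<in> topspace T. commutator G x s \<in> B}" if "s \<in> S" for s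
  proof (rule closedin_continuous_map_preimage[OF _ B'(2)])
    show "continuous_map T T (\<lambda>x. commutator G x s)"
      unfolding commutator_def
      by (intro continuous_map_mult continuous_map_inv continuous_map_group_const car continuous_map_id[unfolded id_def])
         (use that in auto)
  qed
  then have "closedin T (\<Inter>(insert F ((\<lambda>s. {x \<in> topspace T. commutator G x s \<in> B}) ` S)))"
    using F' by (intro closedin_Inter) auto
  moreover have "\<Inter>(insert F ((\<lambda>s. {x \<in> topspace T. commutator G x s \<in> B}) ` S)) = {x \<in> F. \<forall>s\<in>S. commutator G x s \<in> B}"
    using F' by (auto simp: topspace_eq)
  ultimately show ?thesis by (simp add: closed_subgroup_def)
qed

lemma commutator_mem_swap:
  assumes "subgroup B G" "x \<in> carrier G" "y \<in> carrier G"
  shows "commutator G x y \<in> B \<longleftrightarrow> commutator G y x \<in> B"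
  using assms by (metis inv_commutator subgroup.m_inv_closed)

section \<open>Fitting's theorem\<close>

text \<open>For \<open>E\<close> normal in \<open>F\<close> this is the preimage in \<open>F\<close>
  of the \<open>k\<close>-th term of the upper central series of \<open>F / E\<close>.\<close>

primrec upper_central :: "'a set \<Rightarrow> 'a set \<Rightarrow> nat \<Rightarrow> 'a set" where
  "upper_central F E 0 = E"
| "upper_central F E (Suc k) = {x \<in> F. \<forall>f\<in>F. commutator G x f \<in> upper_central F E k}"

lemma upper_central:
  assumes F: "closed_sg F" and E: "closed_sg E" "normalizes F E"
  shows "closed_sg (upper_central F E k) \<and> normalizes F (upper_central F E k)"
proof (induction k)
  case (Suc k)
  note F' = closed_sgD[OF F]
  let ?Z = "upper_central F E k"
  have "normalizes F (upper_central F E (Suc k))"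
    unfolding normalizes_def
  proof (intro ballI)
    fix g x assume g: "g \<in> F" and x: "x \<in> upper_central F E (Suc k)"
    have "commutator G (g \<otimes> x \<otimes> inv g) f \<in> ?Z" if f: "f \<in> F" for f
    proof -
      have "inv g \<otimes> f \<otimes> g \<in> F" using f g F' by (simp add: subgroup.m_closed subgroup.m_inv_closed)
      then have "g \<otimes> commutator G x (inv g \<otimes> f \<otimes> g) \<otimes> inv g \<in> ?Z"
        using x g Suc by (intro normalizesD[of F ?Z]) auto
      moreover have "x \<in> carrier G" "f \<in> carrier G" "g \<in> carrier G" using x f g F' by auto
      then have "g \<otimes> commutator G x (inv g \<otimes> f \<otimes> g) \<otimes> inv g = commutator G (g \<otimes> x \<otimes> inv g) f"
        by (simp add: commutator_def word_simps)
      ultimately show ?thesis by simp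
    qed
    then show "g \<otimes> x \<otimes> inv g \<in> upper_central F E (Suc k)"
      using g x F' by (simp add: subgroup.m_closed subgroup.m_inv_closed)
  qed
  moreover have "closed_sg (upper_central F E (Suc k))"
    using Suc F F' by (simp add: closed_sg_commutator_vimage)
  ultimately show ?case by simp
qed (use E in simp)

lemma lcs_subset_upper_central:
  assumes F: "closed_sg F" and E: "closed_sg E" "normalizes F E" and k: "F \<subseteq> upper_central F E k"
  shows "j \<le> k \<Longrightarrow> \<gamma> F j \<subseteq> upper_central F E (k - j)"
proof (induction j)
  case (Suc j)
  then obtain l where l: "k - j = Suc l" "k - Suc j = l" by (metis Suc_diff_Suc Suc_le_lessD)
  have IH: "\<gamma> F j \<subseteq> upper_central F E (Suc l)" using Suc l by simp
  have "comm_sg (\<gamma> F j) F \<subseteq> upper_central F E l"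
  proof (rule comm_sg_least)
    fix x y assume "x \<in> \<gamma> F j" "y \<in> F"
    then show "commutator G x y \<in> upper_central F E l" using IH by auto
  qed (use upper_central[OF F E] in blast)
  then show ?case using l by simp
qed (use k in simp)

text \<open>Weight argument: bracketing an element of \<gamma>_i(K) \<inter> \<gamma>_j(V) with a
  product of elements of \<open>K\<close> and \<open>V\<close> raises i or j, and from total weight
  2c + 1 on one index exceeds c. So the upper central series over \<open>E\<close> exhausts
  \<open>F\<close> after 2c + 1 steps. Counting starts with \<open>F\<close> in weight 0, which
  leads to \<open>\<gamma> F (2 * c + 1)\<close>, one term below the classical
  \<gamma>_{2c+1}(F).\<close>

lemma fitting:
  assumes K: "closed_sg K" and V: "closed_sg V" and F: "closed_sg F" "F = K <#> V"
    and n: "normalizes F K" "normalizes F V"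
    and E: "closed_sg E" "normalizes F E" "\<gamma> K c \<subseteq> E" "\<gamma> V c \<subseteq> E"
  shows "\<gamma> F (2 * c + 1) \<subseteq> E"
proof -
  note K' = closed_sgD[OF K] and V' = closed_sgD[OF V] and F' = closed_sgD[OF F(1)]
  \<comment> \<open>\<open>\<alpha> L i\<close> is \<gamma>_i(L) in the unshifted numbering,
    extended by \<open>F\<close> in degree 0 so that the induction covers
    \<open>F = \<alpha> K 0 \<inter> \<alpha> V 0\<close>.\<close>
  define \<alpha> where "\<alpha> L i = (case i of 0 \<Rightarrow> F | Suc j \<Rightarrow> \<gamma> L j)" for L i
  have KF: "K \<subseteq> F" and VF: "V \<subseteq> F"
    unfolding F(2) by (intro subset_set_mult1 subset_set_mult2 K' V')+
  have \<alpha>_cl: "closed_sg (\<alpha> L i)" "normalizes F (\<alpha> L i)" if "closed_sg L" "normalizes F L" for L i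
    using that F F' by (auto simp: \<alpha>_def closed_sg_lcs normalizes_lcs normalizes_self split: nat.split)
  have \<alpha>_comm: "commutator G x y \<in> \<alpha> L (Suc i)"
    if "closed_sg L" "normalizes F L" "x \<in> \<alpha> L i" "y \<in> L" for L i x y
  proof (cases i)
    case 0
    then have "commutator G x y \<in> L"
      using that F' closed_sgD(1)[OF that(1)] by (intro commutator_mem_right[of F L]) (simp_all add: \<alpha>_def)
    then show ?thesis using 0 by (simp add: \<alpha>_def)
  next
    case (Suc j)
    then show ?thesis using that by (simp add: \<alpha>_def commutator_in_comm_sg)
  qed
  have \<alpha>_sub: "\<alpha> L i \<subseteq> E" if "closed_sg L" "\<gamma> L c \<subseteq> E" "i \<ge> c + 1" for L i
  proof -
    obtain j where j: "i = Suc j" "c \<le> j" using \<open>i \<ge> c + 1\<close> by (cases i) auto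
    with lcs_antimono[OF that(1) j(2)] that(2) show ?thesis by (simp add: \<alpha>_def)
  qed
  have "\<alpha> K i \<inter> \<alpha> V j \<subseteq> upper_central F E k" if "i + j + k \<ge> 2 * c + 1" for i j k
    using that
  proof (induction k arbitrary: i j)
    case 0
    then have "i \<ge> c + 1 \<or> j \<ge> c + 1" by linarith
    then show ?case using \<alpha>_sub[OF K E(3)] \<alpha>_sub[OF V E(4)] by auto
  next
    case (Suc k)
    show ?case
    proof
      fix x assume x: "x \<in> \<alpha> K i \<inter> \<alpha> V j"
      have Z: "closed_sg (upper_central F E k)" using upper_central[OF F(1) E(1,2)] by blast
      have A: "normalizes F (\<alpha> K i \<inter> \<alpha> V j)" "closed_sg (\<alpha> K i \<inter> \<alpha> V j)" for i j
        using \<alpha>_cl[OF K n(1)] \<alpha>_cl[OF V n(2)] by (simp_all add: normalizes_Int closed_sg_Int)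
      have "\<alpha> K 0 = F" by (simp add: \<alpha>_def)
      have \<alpha>_dec: "\<alpha> L i \<subseteq> F" if "closed_sg L" "L \<subseteq> F" for L i
        using lcs_subset[OF that(1)] that(2) by (auto simp: \<alpha>_def split: nat.split)
      have xF: "x \<in> F" using x \<alpha>_dec[OF K KF] by auto
      have "commutator G x f \<in> upper_central F E k" if "f \<in> F" for f
      proof -
        have "f \<in> K <#> V" using that F(2) by simp
        then obtain a b where f: "a \<in> K" "b \<in> V" "f = a \<otimes> b" by (rule set_mult_memE)
        have aF: "a \<in> F" "b \<in> F" using f KF VF by auto
        have "commutator G x a \<in> \<alpha> K (Suc i) \<inter> \<alpha> V j"
          using \<alpha>_comm[OF K n(1), of x i a] commutator_mem_left[OF \<alpha>_cl(2)[OF V n(2), of j] F'(1)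
              closed_sgD(1)[OF \<alpha>_cl(1)[OF V n(2), of j]], of x a] x f aF by simp
        then have "inv b \<otimes> commutator G x a \<otimes> b \<in> \<alpha> K (Suc i) \<inter> \<alpha> V j"
          using aF by (intro normalizesD_inv[OF A(1) F'(1)])
        then have 1: "inv b \<otimes> commutator G x a \<otimes> b \<in> upper_central F E k"
          using Suc.IH[of "Suc i" j] Suc.prems by auto
        have "commutator G x b \<in> \<alpha> K i \<inter> \<alpha> V (Suc j)"
          using \<alpha>_comm[OF V n(2), of x j b] commutator_mem_left[OF \<alpha>_cl(2)[OF K n(1), of i] F'(1)
              closed_sgD(1)[OF \<alpha>_cl(1)[OF K n(1), of i]], of x b] x f aF by simp
        then have "commutator G x b \<in> upper_central F E k"
          using Suc.IH[of i "Suc j"] Suc.prems by auto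
        with 1 have "commutator G x b \<otimes> (inv b \<otimes> commutator G x a \<otimes> b) \<in> upper_central F E k"
          using closed_sgD(1)[OF Z] by (simp add: subgroup.m_closed)
        moreover have "x \<in> carrier G" "a \<in> carrier G" "b \<in> carrier G" using xF aF F' by auto
        ultimately show ?thesis using f by (simp add: commutator_mult_right)
      qed
      then show "x \<in> upper_central F E (Suc k)" using xF by simp
    qed
  qed
  from this[of 0 0 "2 * c + 1"] have "F \<subseteq> upper_central F E (2 * c + 1)" by (simp add: \<alpha>_def)
  from lcs_subset_upper_central[OF F(1) E(1,2) this, of "2 * c + 1"] show ?thesis by simp
qed

end

section \<open>Topologically finitely generated groups\<close>

context profinite_group
begin

lemma closedin_finite: "finite S \<Longrightarrow> S \<subseteq> carrier G \<Longrightarrow> closedin T S"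
  using closedin_Hausdorff_finite[OF Hausdorff] by (simp add: topspace_eq)

lemma finite_modulo_open:
  assumes "open_sg U"
  shows "finite_modulo (carrier G) U"
proof -
  obtain R where "finite R" "R \<subseteq> carrier G" "carrier G = R <#> U"
    using finite_cosets[OF assms] by blast
  then show ?thesis unfolding finite_modulo_def by (intro exI[of _ R]) simp
qed

text \<open>For a transversal \<open>\<tau>\<close> of \<open>F\<close>, the Schreier generators generate a closed subgroup \<open>Y\<close> of \<open>F\<close> such
  that the closed set \<open>\<tau>(G) Y\<close> is stable under the generators of \<open>G\<close>, hence is all of \<open>G\<close>.\<close>

lemma open_subgroup_fg:
  assumes fg: "topologically_fg G T" and F: "open_sg F"
  obtains S where "finite S" "S \<subseteq> F" "closed_generate G T S = F"
proof -
  note F' = open_sgD[OF F]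
  obtain S0 where S0: "finite S0" "S0 \<subseteq> carrier G" "closed_generate G T S0 = carrier G"
    using fg by (auto simp: topologically_fg_def)
  define S1 where "S1 = S0 \<union> (\<lambda>s. inv s) ` S0"
  have S1: "finite S1" "S1 \<subseteq> carrier G" using S0 by (auto simp: S1_def)
  obtain R where R: "finite R" "R \<subseteq> carrier G" "carrier G = R <#> F"
    by (rule finite_cosets[OF F])
  \<comment> \<open>The representative of \<open>F\<close> itself is forced to be
    \<open>\<one>\<close>: at the end a representative that lies in \<open>F\<close> must be
    \<open>\<one>\<close>, which places \<open>f\<close> in \<open>Y\<close>.\<close>
  define \<tau> where "\<tau> g = (if g \<in> F then \<one> else SOME r. r \<in> R \<and> inv r \<otimes> g \<in> F)" for g
  have \<tau>: "\<tau> g \<in> insert \<one> R" "\<tau> g \<in> carrier G" "inv (\<tau> g) \<otimes> g \<in> F" if g: "g \<in> carrier G" for g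
  proof -
    have "\<exists>r. r \<in> R \<and> inv r \<otimes> g \<in> F"
    proof -
      have "g \<in> R <#> F" using g R by simp
      then obtain r f where "r \<in> R" "f \<in> F" "g = r \<otimes> f" by (rule set_mult_memE)
      moreover then have "inv r \<otimes> g = f" using R(2) F'(3) by (auto simp: inv_mult_cancel subsetD)
      ultimately show ?thesis by auto
    qed
    then have "(SOME r. r \<in> R \<and> inv r \<otimes> g \<in> F) \<in> R \<and> inv (SOME r. r \<in> R \<and> inv r \<otimes> g \<in> F) \<otimes> g \<in> F"
      by (rule someI_ex)
    then show "\<tau> g \<in> insert \<one> R" "\<tau> g \<in> carrier G" "inv (\<tau> g) \<otimes> g \<in> F"
      using R(2) g by (auto simp: \<tau>_def)
  qed
  define P where "P = \<tau> ` carrier G"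
  have P: "finite P" "P \<subseteq> carrier G"
  proof -
    have "P \<subseteq> insert \<one> R" using \<tau>(1) by (auto simp: P_def)
    then show "finite P" using R(1) finite_subset by auto
    show "P \<subseteq> carrier G" using \<tau>(2) by (auto simp: P_def)
  qed
  have "\<one> = \<tau> \<one>" using F' by (simp add: \<tau>_def)
  then have one_P: "\<one> \<in> P" unfolding P_def by blast
  define S where "S = (\<lambda>(s, r). inv (\<tau> (s \<otimes> r)) \<otimes> (s \<otimes> r)) ` (S1 \<times> P)"
  have S: "finite S" "S \<subseteq> F"
    using S1 P \<tau>(3) by (auto simp: S_def subsetD)
  define Y where "Y = closed_generate G T S"
  have YF: "Y \<subseteq> F" unfolding Y_def by (rule closed_generate_least[OF S(2) open_sg_closed[OF F]])
  have Ycl: "closed_sg Y" unfolding Y_def using S F' by (intro closed_sg_closed_generate) auto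
  note Y' = closed_sgD[OF Ycl]
  have PY: "closedin T (P <#> Y)" by (intro closedin_set_mult closedin_finite P Y')
  have PYc: "P <#> Y \<subseteq> carrier G" by (rule set_mult_closed[OF P(2) Y'(3)])
  have step: "s \<otimes> p \<in> P <#> Y" if s: "s \<in> S1" and p: "p \<in> P <#> Y" for s p
  proof -
    obtain r y where ry: "r \<in> P" "y \<in> Y" "p = r \<otimes> y" using p by (rule set_mult_memE)
    have car: "s \<in> carrier G" "r \<in> carrier G" "y \<in> carrier G" using s ry S1 P Y' by auto
    let ?t = "\<tau> (s \<otimes> r)"
    have t: "?t \<in> P" "?t \<in> carrier G" using car \<tau>(2) by (auto simp: P_def)
    have "inv ?t \<otimes> (s \<otimes> r) \<in> S" using s ry(1) unfolding S_def by force
    then have "inv ?t \<otimes> (s \<otimes> r) \<in> Y" using subset_closed_generate[of S] by (auto simp: Y_def)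
    then have "inv ?t \<otimes> (s \<otimes> r) \<otimes> y \<in> Y" using ry Y'(1) by (simp add: subgroup.m_closed)
    then have "?t \<otimes> (inv ?t \<otimes> (s \<otimes> r) \<otimes> y) \<in> P <#> Y" using t(1) by (intro set_mult_memI)
    moreover have "?t \<otimes> (inv ?t \<otimes> (s \<otimes> r) \<otimes> y) = s \<otimes> p"
      using car t ry(3) by (simp add: word_simps)
    ultimately show ?thesis by simp
  qed
  \<comment> \<open>Demanding stability under \<open>g\<close> and under \<open>inv g\<close> makes
    closure under inverses automatic; \<open>S1\<close> contains the inverses of the generators for
    the same reason.\<close>
  define A where "A = {g \<in> carrier G. \<forall>p\<in>P <#> Y. g \<otimes> p \<in> P <#> Y \<and> inv g \<otimes> p \<in> P <#> Y}"
  have "closed_sg A"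
  proof -
    have "subgroup A G"
    proof
      fix x y assume "x \<in> A" "y \<in> A"
      then show "x \<otimes> y \<in> A"
        using PYc by (auto simp: A_def m_assoc inv_mult_group subsetD)
    qed (use PYc in \<open>auto simp: A_def subsetD\<close>)
    moreover have "closedin T {g \<in> topspace T. g \<otimes> p \<in> P <#> Y}"
      "closedin T {g \<in> topspace T. inv g \<otimes> p \<in> P <#> Y}" if "p \<in> P <#> Y" for p
      using that PYc
      by (intro closedin_continuous_map_preimage[OF _ PY] continuous_map_mult continuous_map_inv
          continuous_map_group_const continuous_map_id[unfolded id_def]; blast)+
    then have "closedin T (\<Inter>(insert (topspace T)
        ((\<lambda>p. {g \<in> topspace T. g \<otimes> p \<in> P <#> Y} \<inter> {g \<in> topspace T. inv g \<otimes> p \<in> P <#> Y}) ` (P <#> Y))))"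
      by (intro closedin_Inter) (auto intro: closedin_Int)
    moreover have "\<Inter>(insert (topspace T)
        ((\<lambda>p. {g \<in> topspace T. g \<otimes> p \<in> P <#> Y} \<inter> {g \<in> topspace T. inv g \<otimes> p \<in> P <#> Y}) ` (P <#> Y))) = A"
      by (auto simp: A_def topspace_eq)
    ultimately show ?thesis by (simp add: closed_subgroup_def)
  qed
  moreover have "S0 \<subseteq> A"
    using step S0(2) by (auto simp: A_def S1_def)
  ultimately have "carrier G \<subseteq> A" using closed_generate_least S0(3) by blast
  have "F \<subseteq> Y"
  proof
    fix f assume f: "f \<in> F"
    have "\<one> \<in> P <#> Y" using set_mult_memI[OF one_P Y'(4)] by simp
    moreover have "f \<in> A" using f F' \<open>carrier G \<subseteq> A\<close> by auto
    ultimately have "f \<otimes> \<one> \<in> P <#> Y" by (auto simp: A_def)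
    then obtain r y where ry: "r \<in> P" "y \<in> Y" "f \<otimes> \<one> = r \<otimes> y" by (rule set_mult_memE)
    have car: "f \<in> carrier G" "r \<in> carrier G" "y \<in> carrier G" using f ry F' P Y' by auto
    have "r = f \<otimes> inv y" using ry(3) car by (simp add: word_simps)
    then have "r \<in> F" using f ry(2) YF F' by (auto intro: subgroup.m_closed subgroup.m_inv_closed)
    obtain g where g: "g \<in> carrier G" "r = \<tau> g" using ry(1) by (auto simp: P_def)
    have "g = r \<otimes> (inv r \<otimes> g)" using g(1) car by (simp add: inv_mult_cancel)
    moreover have "r \<otimes> (inv r \<otimes> g) \<in> F"
      using \<open>r \<in> F\<close> \<tau>(3)[OF g(1)] g(2) F'(1) by (simp add: subgroup.m_closed)
    ultimately have "r = \<one>" using g(2) by (simp add: \<tau>_def)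
    then show "f \<in> Y" using ry car by simp
  qed
  then show thesis using that[OF S] YF by (simp add: Y_def)
qed

section \<open>Lower central factors\<close>

text \<open>\<open>A / B\<close> is abelian of exponent dividing \<open>N\<close>. When
  \<open>s\<close> is adjoined to a closed \<open>C\<close> containing \<open>B\<close>, the powers
  of \<open>s\<close> below \<open>N\<close> suffice because \<open>s [^] N\<close> lies in
  \<open>C\<close>. Thus \<open>generate G {s} <#> C\<close> is a finite union of translates of
  \<open>C\<close>, hence already closed.\<close>

lemma finite_modulo_of_abelian_torsion:
  assumes A: "closed_sg A" and B: "closed_sg B" "B \<subseteq> A"
    and comm: "\<And>x y. x \<in> A \<Longrightarrow> y \<in> A \<Longrightarrow> commutator G x y \<in> B"
    and N: "N > 0" "\<And>x. x \<in> A \<Longrightarrow> x [^] (N::nat) \<in> B"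
    and S: "finite S" "S \<subseteq> A"
  shows "finite_modulo (closed_generate G T (S \<union> B)) B"
  using S
proof (induction S)
  case empty
  have "closed_generate G T B \<subseteq> B" by (rule closed_generate_least[OF subset_refl B(1)])
  with finite_modulo_mono[OF finite_modulo_refl[OF closed_sgD(3)[OF B(1)]] this subset_refl]
  show ?case by simp
next
  case (insert s S)
  note A' = closed_sgD[OF A] and B' = closed_sgD[OF B(1)]
  define C where "C = closed_generate G T (S \<union> B)"
  have SB: "S \<union> B \<subseteq> A" using insert.prems B(2) by auto
  have C: "closed_sg C" unfolding C_def using SB A'(3) by (intro closed_sg_closed_generate) auto
  note C' = closed_sgD[OF C]
  have BC: "B \<subseteq> C" and SC: "S \<subseteq> C" unfolding C_def using subset_closed_generate[of "S \<union> B"] by auto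
  have CA: "C \<subseteq> A" unfolding C_def by (rule closed_generate_least[OF SB A])
  have s: "s \<in> A" "s \<in> carrier G" using insert.prems A' by auto
  have AC: "normalizes A C"
    unfolding normalizes_def
  proof (intro ballI)
    fix g x assume gx: "g \<in> A" "x \<in> C"
    have "x \<otimes> commutator G x (inv g) \<in> C"
      using gx CA BC comm[of x "inv g"] C'(1) A'(1) by (auto intro!: subgroup.m_closed subgroup.m_inv_closed)
    moreover have "x \<in> carrier G" "g \<in> carrier G" using gx A' C' by auto
    then have "x \<otimes> commutator G x (inv g) = g \<otimes> x \<otimes> inv g"
      by (simp add: commutator_def word_simps)
    ultimately show "g \<otimes> x \<otimes> inv g \<in> C" by simp
  qed
  let ?P = "(\<lambda>e::nat. s [^] e) ` {..<N}"
  have P: "finite ?P" "?P \<subseteq> carrier G" using s by auto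
  have gen: "subgroup (generate G {s}) G" using s by (intro generate_is_subgroup) auto
  have gA: "generate G {s} \<subseteq> A" using s A' by (intro generate_subgroup_incl) auto
  have "generate G {s} <#> C = ?P <#> C"
  proof
    show "generate G {s} <#> C \<subseteq> ?P <#> C"
    proof
      fix x assume "x \<in> generate G {s} <#> C"
      then obtain y c where y: "y \<in> generate G {s}" "c \<in> C" "x = y \<otimes> c" by (rule set_mult_memE)
      then obtain k :: int where k: "y = s [^] k" using generate_pow[OF s(2)] by auto
      have "y = s [^] (k mod int N + int N * (k div int N))" using k by simp
      also have "\<dots> = s [^] (k mod int N) \<otimes> s [^] (int N * (k div int N))"
        using s(2) by (rule int_pow_mult)
      also have "s [^] (int N * (k div int N)) = (s [^] N) [^] (k div int N)"
        using s(2) by (simp add: int_pow_pow[symmetric] int_pow_int)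
      also have "s [^] (k mod int N) = s [^] nat (k mod int N)"
        using N(1) by (simp add: int_pow_int[symmetric])
      finally have "x = s [^] nat (k mod int N) \<otimes> ((s [^] N) [^] (k div int N) \<otimes> c)"
        using y(2,3) s(2) C'(3) by (simp add: m_assoc subsetD)
      moreover have "(s [^] N) [^] (k div int N) \<in> C"
        using N(2)[OF s(1)] BC C'(1) by (intro subgroup_int_pow_closed) auto
      then have "(s [^] N) [^] (k div int N) \<otimes> c \<in> C"
        using y(2) C'(1) by (simp add: subgroup.m_closed)
      moreover have "nat (k mod int N) < N" using N(1) by (simp add: nat_less_iff)
      then have "s [^] nat (k mod int N) \<in> ?P" by (intro imageI) simp
      ultimately show "x \<in> ?P <#> C" by (simp only: set_mult_memI)
    qed
    have "?P \<subseteq> generate G {s}"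
      using subgroup_nat_pow_closed[OF gen] generate.incl[of s "{s}" G] by auto
    then show "?P <#> C \<subseteq> generate G {s} <#> C" by (rule set_mult_mono) simp
  qed
  moreover have "subgroup (generate G {s} <#> C) G"
    by (rule subgroup_set_mult[OF gen C'(1) normalizes_mono[OF AC gA]])
  ultimately have D: "closed_sg (?P <#> C)"
    using closedin_set_mult[OF closedin_finite[OF P] C'(2)] by (simp add: closed_subgroup_def)
  have "insert s S \<union> B \<subseteq> ?P <#> C"
  proof -
    have "\<one> \<in> ?P" using N(1) by (auto simp: image_iff intro!: bexI[of _ 0])
    then have CD: "C \<subseteq> ?P <#> C"
      using set_mult_memI[of \<one> ?P _ C] C'(3) by (auto simp: subsetD)
    have "s \<in> generate G {s} <#> C"
      using set_mult_memI[of s "generate G {s}" \<one> C] generate.incl[of s "{s}" G] C'(4) s(2) by simp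
    with CD show ?thesis using BC SC \<open>generate G {s} <#> C = ?P <#> C\<close> by auto
  qed
  then have "closed_generate G T (insert s S \<union> B) \<subseteq> ?P <#> C"
    by (rule closed_generate_least[OF _ D])
  then have "finite_modulo (closed_generate G T (insert s S \<union> B)) C"
    unfolding finite_modulo_def using P by blast
  moreover have "finite_modulo C B" unfolding C_def using insert by auto
  ultimately show ?case by (rule finite_modulo_trans[OF _ _ B'(3)])
qed

text \<open>Modulo \<open>\<gamma> F (Suc (Suc i))\<close> the commutator on
  \<open>\<gamma> F i\<close> and \<open>F\<close> is compatible with powers in each entry, so the
  power of [x, f] with exponent n^(i+2) is [x^(n^(i+1)), f^n]. By induction the first entry lies in
  \<open>\<gamma> V i\<close> up to a factor from \<open>\<gamma> F (Suc i)\<close>, and the second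
  lies in \<open>V\<close>.\<close>

lemma nat_pow_lcs:
  assumes F: "closed_sg F" and V: "closed_sg V" "V \<subseteq> F" "normalizes F V"
    and n: "\<And>f. f \<in> F \<Longrightarrow> f [^] (n::nat) \<in> V"
  shows "x \<in> \<gamma> F i \<Longrightarrow> x [^] (n ^ Suc i) \<in> \<gamma> V i <#> \<gamma> F (Suc i)"
proof (induction i arbitrary: x)
  case 0
  then show ?case
    using set_mult_memI[OF n, of x \<one> "\<gamma> F 1"] closed_sgD[OF closed_sg_lcs[OF F, of 1]] closed_sgD(3)[OF V(1)] n
    by (auto simp: subsetD)
next
  case (Suc i)
  note F' = closed_sgD[OF F] and V' = closed_sgD[OF V(1)]
  define B where "B = \<gamma> F (Suc (Suc i))"
  have B: "closed_sg B" "normalizes F B" "B \<subseteq> F"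
    unfolding B_def by (intro closed_sg_lcs F normalizes_lcs normalizes_self F' lcs_subset)+
  note B' = closed_sgD[OF B(1)]
  have comm_B: "commutator G w g \<in> B" if "w \<in> \<gamma> F (Suc i)" "g \<in> F" for w g
    unfolding B_def using that commutator_in_comm_sg by simp
  have lcs_F: "\<gamma> F j \<subseteq> F" and lcs_V: "\<gamma> V j \<subseteq> V" for j by (intro lcs_subset F V)+
  define D where "D = \<gamma> V (Suc i) <#> B"
  have "\<gamma> V (Suc i) \<subseteq> F" using lcs_V V(2) by (rule subset_trans)
  then have D: "closed_sg D"
    unfolding D_def by (intro closed_sg_set_mult closed_sg_lcs V B normalizes_mono[OF B(2)])
  note D' = closed_sgD[OF D]
  have BD: "B \<subseteq> D" unfolding D_def by (intro subset_set_mult2 B' closed_sgD[OF closed_sg_lcs[OF V(1)]])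
  have VD: "\<gamma> V (Suc i) \<subseteq> D" unfolding D_def by (intro subset_set_mult1 B' closed_sgD[OF closed_sg_lcs[OF V(1)]])
  obtain Q :: "'a set monoid" and h where Q: "group Q" "carrier Q = h ` F"
    and mul: "\<And>x y. x \<in> F \<Longrightarrow> y \<in> F \<Longrightarrow> h (x \<otimes> y) = h x \<otimes>\<^bsub>Q\<^esub> h y"
    and inv: "\<And>x. x \<in> F \<Longrightarrow> h (inv x) = inv\<^bsub>Q\<^esub> (h x)"
    and comm: "\<And>x y. x \<in> F \<Longrightarrow> y \<in> F \<Longrightarrow> h (commutator G x y) = commutator Q (h x) (h y)"
    and pow: "\<And>x (k::nat). x \<in> F \<Longrightarrow> h (x [^] k) = h x [^]\<^bsub>Q\<^esub> k"
    and one: "\<And>x. x \<in> F \<Longrightarrow> h x = \<one>\<^bsub>Q\<^esub> \<longleftrightarrow> x \<in> B"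
    by (rule quotient_hom[OF F'(1) B'(1) B(3,2)]) blast
  interpret Q: group Q by (rule Q(1))
  have hQ: "h x \<in> carrier Q" if "x \<in> F" for x using that Q(2) by simp
  have transfer_D: "x \<in> D" if "x \<in> F" "y \<in> F" "y \<in> D" "h x = h y" for x y
  proof -
    have "h (inv y \<otimes> x) = \<one>\<^bsub>Q\<^esub>"
      using that F'(1) hQ by (simp add: mul inv subgroup.m_inv_closed)
    then have "inv y \<otimes> x \<in> D"
      using one[of "inv y \<otimes> x"] that F'(1) BD by (auto simp: subgroup.m_inv_closed subgroup.m_closed)
    then have "y \<otimes> (inv y \<otimes> x) \<in> D" using that D'(1) by (simp add: subgroup.m_closed)
    then show ?thesis using that F'(3) by (simp add: inv_mult_cancel subsetD)
  qed
  have central: "h w \<otimes>\<^bsub>Q\<^esub> h g = h g \<otimes>\<^bsub>Q\<^esub> h w" if "w \<in> \<gamma> F (Suc i)" "g \<in> F" for w g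
  proof -
    have "w \<in> F" using that(1) lcs_F[of "Suc i"] by blast
    then have "commutator Q (h w) (h g) = \<one>\<^bsub>Q\<^esub>"
      using comm[of w g] one[of "commutator G w g"] comm_B[OF that] that B(3) by auto
    then show ?thesis
      using Q.commutator_eq_one_iff hQ \<open>w \<in> F\<close> that(2) by blast
  qed
  define N where "N = n ^ Suc (Suc i)"
  \<comment> \<open>Elements of \<open>\<gamma> F (Suc i)\<close> are central modulo
    \<open>B\<close>, so \<open>N\<close>-th powers are multiplicative on them and \<open>A\<close>
    is a subgroup. It then suffices to treat single commutators.\<close>
  define A where "A = {x \<in> \<gamma> F (Suc i). x [^] N \<in> D}"
  have "closed_sg A"
  proof -
    note L = closed_sgD[OF closed_sg_lcs[OF F, of "Suc i"]]
    have "subgroup A G"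
    proof
      fix x y assume "x \<in> A" "y \<in> A"
      then have xy: "x \<in> \<gamma> F (Suc i)" "y \<in> \<gamma> F (Suc i)" "x [^] N \<in> D" "y [^] N \<in> D"
        by (auto simp: A_def)
      then have F: "x \<in> F" "y \<in> F" using lcs_F[of "Suc i"] by blast+
      have xyF: "x \<otimes> y \<in> F" "x [^] N \<in> F" "y [^] N \<in> F"
        using F F'(1) by (simp_all add: subgroup.m_closed subgroup_nat_pow_closed)
      have "h ((x \<otimes> y) [^] N) = (h x \<otimes>\<^bsub>Q\<^esub> h y) [^]\<^bsub>Q\<^esub> N"
        using F xyF by (simp add: pow mul)
      also have "\<dots> = h x [^]\<^bsub>Q\<^esub> N \<otimes>\<^bsub>Q\<^esub> h y [^]\<^bsub>Q\<^esub> N"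
        using central[OF xy(1) F(2)] hQ F by (intro Q.pow_mult_distrib) auto
      also have "\<dots> = h (x [^] N \<otimes> y [^] N)"
        using F xyF by (simp add: pow mul)
      finally have "h ((x \<otimes> y) [^] N) = h (x [^] N \<otimes> y [^] N)" .
      then have "(x \<otimes> y) [^] N \<in> D"
        by (rule transfer_D[rotated 3])
          (intro subgroup.m_closed[OF F'(1)] subgroup.m_closed[OF D'(1)] subgroup_nat_pow_closed[OF F'(1)] F xy(3,4))+
      then show "x \<otimes> y \<in> A"
        using xy L(1) by (simp add: A_def subgroup.m_closed)
    next
      fix x assume "x \<in> A"
      then show "inv x \<in> A"
        using L(1,3) D'(1) by (auto simp: A_def nat_pow_inv subgroup.m_inv_closed subsetD)
    qed (use L D'(4) in \<open>auto simp: A_def\<close>)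
    moreover have "closedin T {x \<in> topspace T. x [^] N \<in> D}"
      by (rule closedin_continuous_map_preimage[OF continuous_map_nat_pow D'(2)])
    then have "closedin T (\<gamma> F (Suc i) \<inter> {x \<in> topspace T. x [^] N \<in> D})"
      by (rule closedin_Int[OF L(2)])
    moreover have "\<gamma> F (Suc i) \<inter> {x \<in> topspace T. x [^] N \<in> D} = A"
      using L(3) by (auto simp: A_def topspace_eq)
    ultimately show ?thesis by (simp add: closed_subgroup_def)
  qed
  moreover have "commutator G x f \<in> A" if x: "x \<in> \<gamma> F i" and f: "f \<in> F" for x f
  proof -
    let ?z = "commutator G x f" and ?a = "n ^ Suc i"
    have xF: "x \<in> F" using x lcs_F by auto
    have z: "?z \<in> \<gamma> F (Suc i)" using x f by (simp add: commutator_in_comm_sg)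
    have zF: "?z \<in> F" by (rule subsetD[OF lcs_F z])
    have fn: "f [^] n \<in> V" "f [^] n \<in> F" using n f V(2) by auto
    have "x [^] ?a \<in> \<gamma> V i <#> \<gamma> F (Suc i)" using Suc.IH x by simp
    then obtain v w where vw: "v \<in> \<gamma> V i" "w \<in> \<gamma> F (Suc i)" "x [^] ?a = v \<otimes> w"
      by (rule set_mult_memE)
    have vwF: "v \<in> F" "w \<in> F" using vw(1,2) lcs_F[of "Suc i"] lcs_V[of i] V(2) by blast+
    let ?g = "commutator G v (f [^] n)"
    have g: "?g \<in> \<gamma> V (Suc i)" using vw fn by (simp add: commutator_in_comm_sg)
    have gF: "?g \<in> F" by (rule subsetD[OF \<open>\<gamma> V (Suc i) \<subseteq> F\<close> g])
    have wg: "commutator G w (f [^] n) \<in> B" using comm_B vw(2) fn(2) .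
    have hz: "h ?z = commutator Q (h x) (h f)" using comm xF f .
    have xfn: "commutator Q (h x) (h f [^]\<^bsub>Q\<^esub> n) = h ?z [^]\<^bsub>Q\<^esub> n"
      using Q.commutator_nat_pow_right[of "h x" "h f" n] central[OF z f] hQ xF f hz by simp
    have zn: "h ?z [^]\<^bsub>Q\<^esub> n \<otimes>\<^bsub>Q\<^esub> h x = h x \<otimes>\<^bsub>Q\<^esub> h ?z [^]\<^bsub>Q\<^esub> n"
      using Q.group_commutes_pow[OF central[OF z xF]] hQ zF xF by simp
    have "h (?z [^] N) = (h ?z [^]\<^bsub>Q\<^esub> n) [^]\<^bsub>Q\<^esub> ?a"
      using zF hQ by (simp add: pow Q.nat_pow_pow N_def)
    also have "\<dots> = commutator Q (h x [^]\<^bsub>Q\<^esub> ?a) (h f [^]\<^bsub>Q\<^esub> n)"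
      using Q.commutator_nat_pow_left[of "h x" "h f [^]\<^bsub>Q\<^esub> n" ?a] xfn zn hQ xF f by simp
    also have "\<dots> = h (commutator G (v \<otimes> w) (f [^] n))"
      using comm[of "x [^] ?a" "f [^] n"] pow xF f fn vw(3) F'(1)
      by (simp add: subgroup_nat_pow_closed)
    \<comment> \<open>The factor \<open>w\<close> is central modulo \<open>B\<close>: its own
      commutator vanishes there, and so does the effect of conjugating by it.\<close>
    also have "commutator G (v \<otimes> w) (f [^] n) = (inv w \<otimes> ?g \<otimes> w) \<otimes> commutator G w (f [^] n)"
      using vwF fn F'(3) by (intro commutator_mult_left) auto
    also have "h \<dots> = (inv\<^bsub>Q\<^esub> (h w) \<otimes>\<^bsub>Q\<^esub> h ?g \<otimes>\<^bsub>Q\<^esub> h w) \<otimes>\<^bsub>Q\<^esub> \<one>\<^bsub>Q\<^esub>"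
    proof -
      have "commutator G w (f [^] n) \<in> F" "inv w \<otimes> ?g \<otimes> w \<in> F" "inv w \<otimes> ?g \<in> F" "inv w \<in> F"
        using wg B(3) vwF gF F'(1) by (auto intro!: subgroup.m_closed subgroup.m_inv_closed)
      then show ?thesis using vwF gF wg one[of "commutator G w (f [^] n)"]
        by (simp add: mul inv)
    qed
    also have "\<dots> = h ?g"
      using central[OF vw(2) gF] hQ[OF gF] hQ[OF vwF(2)] by (simp add: Q.m_assoc Q.inv_mult_cancel flip: central[OF vw(2) gF])
    finally have "h (?z [^] N) = h ?g" .
    then have "?z [^] N \<in> D"
      by (rule transfer_D[rotated 3]) (intro subgroup_nat_pow_closed[OF F'(1) zF] gF subsetD[OF VD g])+
    then show ?thesis using z by (simp add: A_def)
  qed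
  ultimately have "\<gamma> F (Suc i) \<subseteq> A"
    unfolding lower_central.simps by (intro comm_sg_least)
  then show ?case using Suc.prems by (auto simp: A_def D_def B_def N_def)
qed

text \<open>The commutators of generators of one factor with generators of \<open>F\<close> generate
  the next factor. Let \<open>B\<close> be generated by them and the term after it: centralizing
  modulo \<open>B\<close> is a closed subgroup condition, so it spreads from \<open>S\<close> to
  \<open>F\<close> in one entry and then from \<open>R\<close> to \<open>\<gamma> F i\<close> in the
  other.\<close>

lemma lcs_generators:
  assumes F: "closed_sg F" and S: "finite S" "S \<subseteq> F" "closed_generate G T S = F"
  shows "\<exists>R. finite R \<and> R \<subseteq> \<gamma> F i \<and> \<gamma> F i \<subseteq> closed_generate G T (R \<union> \<gamma> F (Suc i))"
proof (induction i)
  case 0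
  have "F \<subseteq> closed_generate G T (S \<union> \<gamma> F (Suc 0))"
    unfolding S(3)[symmetric] closed_generate_def by (rule hull_mono) simp
  then show ?case using S by auto
next
  case (Suc i)
  note F' = closed_sgD[OF F]
  obtain R where R: "finite R" "R \<subseteq> \<gamma> F i" "\<gamma> F i \<subseteq> closed_generate G T (R \<union> \<gamma> F (Suc i))"
    using Suc.IH by blast
  have lcs_F: "\<gamma> F j \<subseteq> F" for j by (rule lcs_subset[OF F])
  define R' where "R' = (\<lambda>(r, s). commutator G r s) ` (R \<times> S)"
  have R': "finite R'" "R' \<subseteq> \<gamma> F (Suc i)"
    using R S by (auto simp: R'_def subsetD intro!: commutator_in_comm_sg)
  define B where "B = closed_generate G T (R' \<union> \<gamma> F (Suc (Suc i)))"
  have sub: "R' \<union> \<gamma> F (Suc (Suc i)) \<subseteq> \<gamma> F (Suc i)"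
    using R'(2) lcs_Suc_subset[OF F] by (rule Un_least)
  have B: "closed_sg B"
    unfolding B_def using sub lcs_F[of "Suc i"] F'(3) by (intro closed_sg_closed_generate) blast
  note B' = closed_sgD[OF B]
  have BL: "B \<subseteq> \<gamma> F (Suc i)"
    unfolding B_def by (rule closed_generate_least[OF sub closed_sg_lcs[OF F]])
  have R'B: "R' \<subseteq> B" and LB: "\<gamma> F (Suc (Suc i)) \<subseteq> B"
    unfolding B_def using subset_closed_generate[of "R' \<union> \<gamma> F (Suc (Suc i))"] by auto
  have FB: "normalizes F B"
    unfolding normalizes_def
  proof (intro ballI)
    fix g x assume gx: "g \<in> F" "x \<in> B"
    then have "commutator G x (inv g) \<in> \<gamma> F (Suc (Suc i))"
      using BL F'(1) commutator_in_comm_sg[of x "\<gamma> F (Suc i)" "inv g" F] by (auto simp: subgroup.m_inv_closed)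
    then have "x \<otimes> commutator G x (inv g) \<in> B"
      using gx LB B'(1) by (auto intro!: subgroup.m_closed)
    moreover have "x \<in> carrier G" "g \<in> carrier G" using gx F' B' by auto
    then have "x \<otimes> commutator G x (inv g) = g \<otimes> x \<otimes> inv g"
      by (simp add: commutator_def word_simps)
    ultimately show "g \<otimes> x \<otimes> inv g \<in> B" by simp
  qed
  have RF: "R \<subseteq> F" using R(2) lcs_F by (rule subset_trans)
  have "F \<subseteq> {f \<in> F. \<forall>r\<in>R. commutator G f r \<in> B}"
    unfolding S(3)[symmetric]
  proof (rule closed_generate_least)
    show "closed_sg {f \<in> closed_generate G T S. \<forall>r\<in>R. commutator G f r \<in> B}"
      unfolding S(3) using closed_sg_commutator_vimage[OF F B FB] RF F'(3) by blast
    have "commutator G s r \<in> B" if "s \<in> S" "r \<in> R" for s r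
    proof -
      have "commutator G r s \<in> B" using that R'B by (auto simp: R'_def)
      then show ?thesis using commutator_mem_swap[OF B'(1), of r s] that S(2) RF F'(3) by auto
    qed
    then show "S \<subseteq> {f \<in> closed_generate G T S. \<forall>r\<in>R. commutator G f r \<in> B}"
      using S by auto
  qed
  then have rf: "commutator G r f \<in> B" if "r \<in> R" "f \<in> F" for r f
    using commutator_mem_swap[OF B'(1), of r f] that RF F'(3) by auto
  have "closed_generate G T (R \<union> \<gamma> F (Suc i)) \<subseteq> {x \<in> F. \<forall>f\<in>F. commutator G x f \<in> B}"
  proof (rule closed_generate_least)
    show "R \<union> \<gamma> F (Suc i) \<subseteq> {x \<in> F. \<forall>f\<in>F. commutator G x f \<in> B}"
      using rf RF lcs_F[of "Suc i"] LB commutator_in_comm_sg[of _ "\<gamma> F (Suc i)" _ F] by auto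
    show "closed_sg {x \<in> F. \<forall>f\<in>F. commutator G x f \<in> B}"
      by (rule closed_sg_commutator_vimage[OF F B FB F'(3)])
  qed
  then have "commutator G x f \<in> B" if "x \<in> \<gamma> F i" "f \<in> F" for x f
    using that R(3) by blast
  then have "comm_sg (\<gamma> F i) F \<subseteq> B" by (intro comm_sg_least[OF _ B])
  then have "\<gamma> F (Suc i) \<subseteq> B" by simp
  then show ?case unfolding B_def using R' by auto
qed

text \<open>The factor is abelian because two elements of \<open>\<gamma> F i\<close> commute modulo
  \<open>\<gamma> F (Suc i)\<close>. The bound \<open>c \<le> i\<close> puts
  \<open>\<gamma> V i\<close> inside \<open>\<gamma> V c\<close>, so the powers supplied by
  \<open>nat_pow_lcs\<close> vanish in the factor.\<close>

lemma finite_modulo_lcs_factor: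
  assumes F: "closed_sg F" and S: "finite S" "S \<subseteq> F" "closed_generate G T S = F"
    and V: "closed_sg V" "V \<subseteq> F" "normalizes F V" "finite_modulo F V" and i: "c \<le> i"
  shows "finite_modulo (\<gamma> F i) (\<gamma> F (Suc i) <#> \<gamma> V c)"
proof -
  note F' = closed_sgD[OF F] and V' = closed_sgD[OF V(1)]
  obtain n :: nat where n: "n > 0" "\<And>f. f \<in> F \<Longrightarrow> f [^] n \<in> V"
    using nat_pow_mem_of_finite_modulo[OF F'(1) V'(1) V(2,3,4)] by blast
  obtain R where R: "finite R" "R \<subseteq> \<gamma> F i" "\<gamma> F i \<subseteq> closed_generate G T (R \<union> \<gamma> F (Suc i))"
    using lcs_generators[OF F S] by blast
  define E where "E = \<gamma> V c"
  define A where "A = \<gamma> F i <#> E"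
  define B where "B = \<gamma> F (Suc i) <#> E"
  have E: "closed_sg E" "normalizes F E" "E \<subseteq> F"
    unfolding E_def
    by (rule closed_sg_lcs[OF V(1)] normalizes_lcs[OF V(3) F'(3) V(1)] subset_trans[OF lcs_subset[OF V(1)] V(2)])+
  note E' = closed_sgD[OF E(1)]
  have lcs_F: "\<gamma> F j \<subseteq> F" for j by (rule lcs_subset[OF F])
  have lcs_cl: "closed_sg (\<gamma> F j)" for j by (rule closed_sg_lcs[OF F])
  have A: "closed_sg A" and B: "closed_sg B"
    unfolding A_def B_def by (intro closed_sg_set_mult lcs_cl E normalizes_mono[OF E(2) lcs_F])+
  have BA: "B \<subseteq> A" unfolding A_def B_def by (intro set_mult_mono lcs_Suc_subset[OF F] subset_refl)
  have EB: "E \<subseteq> B" and LB: "\<gamma> F (Suc i) \<subseteq> B" and LA: "\<gamma> F i \<subseteq> A"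
    unfolding A_def B_def by (intro subset_set_mult1 subset_set_mult2 E' closed_sgD[OF lcs_cl])+
  have comm: "commutator G x y \<in> B" if "x \<in> A" "y \<in> A" for x y
  proof -
    obtain a u where a: "a \<in> \<gamma> F i" "u \<in> E" "x = a \<otimes> u"
      using \<open>x \<in> A\<close> unfolding A_def by (rule set_mult_memE)
    obtain b v where b: "b \<in> \<gamma> F i" "v \<in> E" "y = b \<otimes> v"
      using \<open>y \<in> A\<close> unfolding A_def by (rule set_mult_memE)
    have aF: "a \<in> F" "b \<in> F" using a b lcs_F by auto
    obtain w where "w \<in> E" "commutator G x y = commutator G a b \<otimes> w"
      using commutator_cong_mod[OF F'(1) E'(1) E(2) aF(1) a(2) aF(2) b(2)] a b by auto
    moreover have "commutator G a b \<in> \<gamma> F (Suc i)"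
      using a aF by (simp add: commutator_in_comm_sg)
    ultimately show ?thesis unfolding B_def by (simp add: set_mult_memI)
  qed
  have pow: "x [^] (n ^ Suc i) \<in> B" if "x \<in> A" for x
  proof -
    obtain a u where a: "a \<in> \<gamma> F i" "u \<in> E" "x = a \<otimes> u"
      using \<open>x \<in> A\<close> unfolding A_def by (rule set_mult_memE)
    have aF: "a \<in> F" "u \<in> F" using a lcs_F E(3) by auto
    obtain Q :: "'a set monoid" and h where Q: "group Q" "carrier Q = h ` F"
      and mul: "\<And>x y. x \<in> F \<Longrightarrow> y \<in> F \<Longrightarrow> h (x \<otimes> y) = h x \<otimes>\<^bsub>Q\<^esub> h y"
      and inv: "\<And>x. x \<in> F \<Longrightarrow> h (inv x) = inv\<^bsub>Q\<^esub> (h x)"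
      and pow: "\<And>x (k::nat). x \<in> F \<Longrightarrow> h (x [^] k) = h x [^]\<^bsub>Q\<^esub> k"
      and one: "\<And>x. x \<in> F \<Longrightarrow> h x = \<one>\<^bsub>Q\<^esub> \<longleftrightarrow> x \<in> E"
      by (rule quotient_hom[OF F'(1) E'(1) E(3,2)]) blast
    interpret Q: group Q by (rule Q(1))
    let ?N = "n ^ Suc i"
    have hQ: "h x \<in> carrier Q" if "x \<in> F" for x using that Q(2) by simp
    have xF: "x \<in> F" using a(3) aF F'(1) by (simp add: subgroup.m_closed)
    have pF: "x [^] ?N \<in> F" "a [^] ?N \<in> F" "inv (a [^] ?N) \<in> F"
      using xF aF F'(1) by (auto intro: subgroup_nat_pow_closed subgroup.m_inv_closed)
    have "h x = h a" using a mul[OF aF] one[OF aF(2)] hQ aF by simp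
    then have "h (inv (a [^] ?N) \<otimes> x [^] ?N) = \<one>\<^bsub>Q\<^esub>"
      using pF xF aF hQ by (simp only: mul inv pow) simp
    then have 1: "inv (a [^] ?N) \<otimes> x [^] ?N \<in> B"
      using one[of "inv (a [^] ?N) \<otimes> x [^] ?N"] pF F'(1) EB by (auto simp: subgroup.m_closed)
    have "a [^] ?N \<in> \<gamma> V i <#> \<gamma> F (Suc i)" by (rule nat_pow_lcs[OF F V(1,2,3) n(2) a(1)])
    also have "\<dots> \<subseteq> B"
      using lcs_antimono[OF V(1) i] EB LB closed_sgD(1)[OF B] by (intro set_mult_least) (auto simp: E_def)
    finally have "a [^] ?N \<otimes> (inv (a [^] ?N) \<otimes> x [^] ?N) \<in> B"
      using 1 closed_sgD(1)[OF B] by (simp add: subgroup.m_closed)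
    then show ?thesis using pF F'(3) by (simp add: inv_mult_cancel subsetD)
  qed
  have "finite_modulo (closed_generate G T (R \<union> B)) B"
    using R(2) LA n(1)
    by (intro finite_modulo_of_abelian_torsion[OF A B BA comm _ pow R(1)]) auto
  moreover have "closed_generate G T (R \<union> \<gamma> F (Suc i)) \<subseteq> closed_generate G T (R \<union> B)"
    unfolding closed_generate_def using LB by (intro hull_mono) auto
  ultimately show ?thesis
    unfolding B_def E_def using R(3) by (meson finite_modulo_mono subset_refl subset_trans)
qed

text \<open>Composes the finite factors from \<open>c\<close> up to \<open>m\<close>, with
  \<open>\<gamma> V c\<close> multiplied into every term.\<close>

lemma finite_modulo_lcs:
  assumes F: "closed_sg F" and S: "finite S" "S \<subseteq> F" "closed_generate G T S = F"
    and V: "closed_sg V" "V \<subseteq> F" "normalizes F V" "finite_modulo F V" and "c \<le> m"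
  shows "finite_modulo (\<gamma> F c) (\<gamma> F m <#> \<gamma> V c)"
  using \<open>c \<le> m\<close>
proof (induction m rule: dec_induct)
  case base
  note L = closed_sgD[OF closed_sg_lcs[OF F, of c]] and E = closed_sgD[OF closed_sg_lcs[OF V(1), of c]]
  show ?case
    by (rule finite_modulo_mono[OF finite_modulo_refl[OF L(3)] subset_refl subset_set_mult1[OF L(3) E(1)]])
next
  case (step m)
  let ?E = "\<gamma> V c" and ?B = "\<gamma> F (Suc m) <#> \<gamma> V c"
  note L = closed_sgD[OF closed_sg_lcs[OF F, of "Suc m"]] and E = closed_sgD[OF closed_sg_lcs[OF V(1), of c]]
  have Bc: "?B \<subseteq> carrier G" by (intro set_mult_closed L E)
  obtain R where R: "finite R" "R \<subseteq> carrier G" "\<gamma> F m \<subseteq> R <#> ?B"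
    using finite_modulo_lcs_factor[OF F S V step(1)] by (auto simp: finite_modulo_def)
  have "\<gamma> F m <#> ?E \<subseteq> (R <#> ?B) <#> ?E"
    by (intro set_mult_mono R subset_refl)
  also have "\<dots> = R <#> ?B"
    using R(2) L E Bc by (simp add: set_mult_assoc subgroup_mult_id del: lower_central.simps)
  finally have "finite_modulo (\<gamma> F m <#> ?E) ?B"
    unfolding finite_modulo_def using R by blast
  then show ?case by (rule finite_modulo_trans[OF step.IH _ Bc])
qed

text \<open>Both \<open>K\<close> and \<open>V\<close> are normal in \<open>F = KV\<close>, so Fitting's theorem modulo \<open>\<gamma> K c\<close> traps \<open>\<gamma> K c\<close>
  between \<open>\<gamma> F (2c + 1) \<gamma> V c\<close> and \<open>\<gamma> F c\<close>; there are finitely many groups \<open>F\<close>.\<close>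

lemma finite_lcs_above:
  assumes fg: "topologically_fg G T" and V: "open_normal V"
  shows "finite {\<gamma> K c |K. closed_sg K \<and> normalizes V K \<and> \<gamma> V c \<subseteq> \<gamma> K c}"
proof -
  note V' = open_normalD[OF V] and Vc = open_normal_closed[OF V]
  let ?\<F> = "(\<lambda>K. K <#> V) ` {K. K \<subseteq> carrier G}"
  let ?\<B> = "\<lambda>F. {C. subgroup C G \<and> \<gamma> F (2 * c + 1) <#> \<gamma> V c \<subseteq> C \<and> C \<subseteq> \<gamma> F c}"
  have fin: "finite (?\<B> F)" if F: "open_sg F" "V \<subseteq> F" for F
  proof -
    note F' = open_sgD[OF F(1)]
    obtain S where S: "finite S" "S \<subseteq> F" "closed_generate G T S = F"
      by (rule open_subgroup_fg[OF fg F(1)])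
    have "finite_modulo F V"
      by (rule finite_modulo_mono[OF finite_modulo_open[OF V'(1)] F'(3) subset_refl])
    then show ?thesis
      using open_sg_closed[OF F(1)] S Vc F(2) normalizes_mono[OF V'(5) F'(3)]
      by (intro finite_subgroups_between finite_modulo_lcs) auto
  qed
  have "finite ?\<F>"
    by (rule finite_set_mult_images[OF V'(2) finite_modulo_open[OF V'(1)]])
  then have "finite (\<Union>F\<in>{F \<in> ?\<F>. open_sg F \<and> V \<subseteq> F}. ?\<B> F)"
    using fin by (intro finite_UN_I) auto
  moreover have "{\<gamma> K c |K. closed_sg K \<and> normalizes V K \<and> \<gamma> V c \<subseteq> \<gamma> K c}
      \<subseteq> (\<Union>F\<in>{F \<in> ?\<F>. open_sg F \<and> V \<subseteq> F}. ?\<B> F)"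
  proof
    fix L assume "L \<in> {\<gamma> K c |K. closed_sg K \<and> normalizes V K \<and> \<gamma> V c \<subseteq> \<gamma> K c}"
    then obtain K where K: "closed_sg K" "normalizes V K" "\<gamma> V c \<subseteq> \<gamma> K c" and L: "L = \<gamma> K c" by auto
    note K' = closed_sgD[OF K(1)]
    define F where "F = K <#> V"
    have F: "open_sg F"
      unfolding F_def by (intro open_sg_set_mult K' V' normalizes_mono[OF V'(5)])
    note F' = open_sgD[OF F] and Fc = open_sg_closed[OF F]
    have KF: "K \<subseteq> F" and VF: "V \<subseteq> F"
      unfolding F_def by (intro subset_set_mult1 subset_set_mult2 K' V')+
    have FK: "normalizes F K"
      unfolding normalizes_def
    proof (intro ballI)
      fix g x assume "g \<in> F" and x: "x \<in> K"
      then obtain k v where g: "k \<in> K" "v \<in> V" "g = k \<otimes> v"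
        unfolding F_def by (auto elim: set_mult_memE)
      have "v \<otimes> x \<otimes> inv v \<in> K" using normalizesD[OF K(2) g(2) x] .
      then have "k \<otimes> (v \<otimes> x \<otimes> inv v) \<otimes> inv k \<in> K"
        using g(1) K'(1) by (simp add: subgroup.m_closed subgroup.m_inv_closed)
      moreover have "k \<in> carrier G" "v \<in> carrier G" "x \<in> carrier G" using g x K' V' by auto
      then have "k \<otimes> (v \<otimes> x \<otimes> inv v) \<otimes> inv k = g \<otimes> x \<otimes> inv g" using g by (simp add: word_simps)
      ultimately show "g \<otimes> x \<otimes> inv g \<in> K" by simp
    qed
    have FV: "normalizes F V" using normalizes_mono[OF V'(5) F'(3)] .
    have cl: "closed_sg (\<gamma> K c)" by (rule closed_sg_lcs[OF K(1)])
    have "\<gamma> F (2 * c + 1) \<subseteq> \<gamma> K c"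
      by (rule fitting[OF K(1) Vc Fc F_def FK FV cl normalizes_lcs[OF FK F'(3) K(1)] subset_refl K(3)])
    then have "\<gamma> F (2 * c + 1) <#> \<gamma> V c \<subseteq> \<gamma> K c"
      by (rule set_mult_least[OF _ K(3) closed_sgD(1)[OF cl]])
    then have "L \<in> ?\<B> F"
      using L lcs_mono[OF KF, of c] closed_sgD(1)[OF cl] by simp
    moreover have "F \<in> ?\<F>" unfolding F_def using K'(3) by auto
    ultimately show "L \<in> (\<Union>F\<in>{F \<in> ?\<F>. open_sg F \<and> V \<subseteq> F}. ?\<B> F)"
      using F VF by blast
  qed
  ultimately show ?thesis by (rule finite_subset[rotated])
qed

end

section \<open>Fitting-free groups\<close>

context profinite_group
begin

text \<open>Stated inside \<open>G\<close>, with the closed subgroups and conjugations of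
  \<open>G\<close>, so that restricted groups and subspace topologies are confined to the final
  translation.\<close>

definition fitting_free_sg :: "'a set \<Rightarrow> bool" where
  "fitting_free_sg L \<longleftrightarrow> (\<forall>A. closed_sg A \<and> A \<subseteq> L \<and> normalizes L A \<and>
     (\<forall>x\<in>A. \<forall>y\<in>A. x \<otimes> y = y \<otimes> x) \<longrightarrow> A = {\<one>})"

lemma fitting_free_sgD:
  assumes "fitting_free_sg L" "closed_sg A" "A \<subseteq> L" "normalizes L A"
    and "\<And>x y. x \<in> A \<Longrightarrow> y \<in> A \<Longrightarrow> x \<otimes> y = y \<otimes> x"
  shows "A = {\<one>}"
  using assms unfolding fitting_free_sg_def by simp

lemma Fitting_free_carrier:
  assumes "Fitting_free G T"
  shows "fitting_free_sg (carrier G)"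
  unfolding fitting_free_sg_def
proof (intro allI impI, elim conjE)
  fix A assume A: "closed_sg A" "normalizes (carrier G) A" and comm: "\<forall>x\<in>A. \<forall>y\<in>A. x \<otimes> y = y \<otimes> x"
  have "closed_normal_subgroup G T A"
    using A closed_sgD[OF A(1)] by (simp add: closed_normal_subgroup_def normal_iff_normalizes)
  moreover have "comm_group (G\<lparr>carrier := A\<rparr>)"
    using comm by (intro group.group_comm_groupI subgroup_imp_group closed_sgD[OF A(1)]) auto
  ultimately show "A = {\<one>}" using assms unfolding Fitting_free_def by blast
qed

abbreviation conj_set :: "'a \<Rightarrow> 'a set \<Rightarrow> 'a set" where
  "conj_set g A \<equiv> (\<lambda>x. g \<otimes> x \<otimes> inv g) ` A"

lemma conj_set_mult:
  assumes "g \<in> carrier G" "h \<in> carrier G" "A \<subseteq> carrier G"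
  shows "conj_set (g \<otimes> h) A = conj_set g (conj_set h A)"
  unfolding image_image using assms by (intro image_cong refl) (auto simp: word_simps subsetD)

lemma conj_set_normalizes:
  assumes n: "normalizes H A" and H: "subgroup H G" and h: "h \<in> H" and A: "A \<subseteq> carrier G"
  shows "conj_set h A = A"
proof
  show "conj_set h A \<subseteq> A" using normalizesD[OF n h] by auto
  show "A \<subseteq> conj_set h A"
  proof
    fix a assume a: "a \<in> A"
    have car: "h \<in> carrier G" "a \<in> carrier G" using a h H A by (auto simp: subgroup.mem_carrier)
    then have "a = h \<otimes> (inv h \<otimes> a \<otimes> h) \<otimes> inv h" by (simp add: word_simps)
    then show "a \<in> conj_set h A" using normalizesD_inv[OF n H h a] by (rule image_eqI)
  qed
qed

lemma commuting_closed_generate: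
  assumes S: "S \<subseteq> carrier G" and comm: "\<And>x y. x \<in> S \<Longrightarrow> y \<in> S \<Longrightarrow> x \<otimes> y = y \<otimes> x"
    and xy: "x \<in> closed_generate G T S" "y \<in> closed_generate G T S"
  shows "x \<otimes> y = y \<otimes> x"
proof -
  let ?C = "\<lambda>S. {g \<in> carrier G. \<forall>s\<in>S. g \<otimes> s = s \<otimes> g}"
  let ?N = "closed_generate G T S"
  have N: "?N \<subseteq> carrier G" using closed_sgD(3)[OF closed_sg_closed_generate[OF S]] .
  have "?N \<subseteq> ?C S"
    using S comm by (intro closed_generate_least centralizer_closed_sg Hausdorff) auto
  then have "S \<subseteq> ?C ?N" using S by auto
  then have "?N \<subseteq> ?C ?N"
    by (intro closed_generate_least centralizer_closed_sg Hausdorff N)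
  then show ?thesis using xy by auto
qed

text \<open>Among the non-trivial intersections of conjugates of an abelian normal subgroup of \<open>H\<close> take a
  minimal one, \<open>B\<close>. For every conjugate \<open>C\<close> of \<open>B\<close>, either \<open>B \<subseteq> C\<close> or \<open>B \<inter> C = {\<one>}\<close>; in both cases
  \<open>B\<close> and \<open>C\<close> commute, so the conjugates of \<open>B\<close> generate an abelian normal subgroup of \<open>G\<close>.\<close>

lemma fitting_free_open_normal:
  assumes ff: "fitting_free_sg (carrier G)" and H: "open_normal H"
  shows "fitting_free_sg H"
  unfolding fitting_free_sg_def
proof (intro allI impI, elim conjE, rule ccontr)
  fix A assume A: "closed_sg A" "A \<subseteq> H" "normalizes H A" and comm: "\<forall>x\<in>A. \<forall>y\<in>A. x \<otimes> y = y \<otimes> x"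
    and "A \<noteq> {\<one>}"
  note H' = open_normalD[OF H] and A' = closed_sgD[OF A(1)]
  define \<C> where "\<C> = (\<lambda>g. conj_set g A) ` carrier G"
  have \<C>: "closed_sg C" "C \<subseteq> H" "normalizes H C" "\<And>x y. x \<in> C \<Longrightarrow> y \<in> C \<Longrightarrow> x \<otimes> y = y \<otimes> x"
    if C: "C \<in> \<C>" for C
  proof -
    obtain g where g: "g \<in> carrier G" "C = conj_set g A" using C by (auto simp: \<C>_def)
    show "closed_sg C" using g A by (simp add: closed_sg_conj)
    show "C \<subseteq> H" using g A normalizesD[OF H'(5)] by auto
    show "normalizes H C"
      unfolding normalizes_def
    proof (intro ballI)
      fix h x assume h: "h \<in> H" and "x \<in> C"
      then obtain a where a: "a \<in> A" "x = g \<otimes> a \<otimes> inv g" using g by auto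
      have car: "h \<in> carrier G" "a \<in> carrier G" using h a H' A' by auto
      have "inv g \<otimes> h \<otimes> g \<in> H" using normalizesD_inv[OF H'(5) subgroup_self g(1) h] .
      then have "(inv g \<otimes> h \<otimes> g) \<otimes> a \<otimes> inv (inv g \<otimes> h \<otimes> g) \<in> A" using normalizesD[OF A(3)] a by blast
      moreover have "h \<otimes> x \<otimes> inv h = g \<otimes> ((inv g \<otimes> h \<otimes> g) \<otimes> a \<otimes> inv (inv g \<otimes> h \<otimes> g)) \<otimes> inv g"
        using car g a by (simp add: word_simps)
      ultimately show "h \<otimes> x \<otimes> inv h \<in> C" using g by blast
    qed
    fix x y assume "x \<in> C" "y \<in> C"
    then obtain a b where ab: "a \<in> A" "x = g \<otimes> a \<otimes> inv g" "b \<in> A" "y = g \<otimes> b \<otimes> inv g" using g by auto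
    have car: "a \<in> carrier G" "b \<in> carrier G" using ab A' by auto
    have "x \<otimes> y = g \<otimes> (a \<otimes> b) \<otimes> inv g" using ab car g by (simp add: word_simps)
    also have "a \<otimes> b = b \<otimes> a" using comm ab by simp
    also have "g \<otimes> (b \<otimes> a) \<otimes> inv g = y \<otimes> x" using ab car g by (simp add: word_simps)
    finally show "x \<otimes> y = y \<otimes> x" .
  qed
  have \<C>_conj: "conj_set g C \<in> \<C>" if g: "g \<in> carrier G" and C: "C \<in> \<C>" for g C
  proof -
    obtain k where k: "k \<in> carrier G" "C = conj_set k A" using C by (auto simp: \<C>_def)
    then have "conj_set g C = conj_set (g \<otimes> k) A" using conj_set_mult[OF g k(1) A'(3)] by simp
    then show ?thesis unfolding \<C>_def using g k by blast
  qed
  \<comment> \<open>Conjugation by elements of \<open>H\<close> fixes \<open>A\<close>, so a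
    conjugate of \<open>A\<close> depends on the coset \<open>g H\<close> alone.\<close>
  have "finite \<C>"
  proof -
    obtain R where R: "finite R" "R \<subseteq> carrier G" "carrier G = R <#> H" by (rule finite_cosets[OF H'(1)])
    have "\<C> \<subseteq> (\<lambda>g. conj_set g A) ` R"
    proof
      fix C assume "C \<in> \<C>"
      then obtain g where g: "g \<in> carrier G" "C = conj_set g A" by (auto simp: \<C>_def)
      have "g \<in> R <#> H" using g(1) R(3) by simp
      then obtain r h where r: "r \<in> R" "h \<in> H" "g = r \<otimes> h" by (rule set_mult_memE)
      have "conj_set g A = conj_set r (conj_set h A)"
        unfolding r(3) using r R(2) H'(4) A'(3) by (intro conj_set_mult) auto
      also have "conj_set h A = A" by (rule conj_set_normalizes[OF A(3) H'(2) r(2) A'(3)])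
      finally show "C \<in> (\<lambda>g. conj_set g A) ` R" using g r by auto
    qed
    then show ?thesis using R(1) finite_surj by blast
  qed
  define \<F> where "\<F> = {\<Inter>\<S> |\<S>. \<S> \<subseteq> \<C> \<and> \<S> \<noteq> {} \<and> \<Inter>\<S> \<noteq> {\<one>}}"
  have "\<F> \<subseteq> Inter ` Pow \<C>" by (auto simp: \<F>_def)
  then have "finite \<F>" using \<open>finite \<C>\<close> by (meson finite_Pow_iff finite_surj)
  moreover have "A \<in> \<F>"
  proof -
    have "A = conj_set \<one> A" using conj_set_normalizes[OF A(3) H'(2) subgroup.one_closed[OF H'(2)] A'(3)] by simp
    then have "A \<in> \<C>" unfolding \<C>_def by blast
    then have "{A} \<subseteq> \<C> \<and> {A} \<noteq> {} \<and> \<Inter>{A} \<noteq> {\<one>}" using \<open>A \<noteq> {\<one>}\<close> by simp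
    then show ?thesis unfolding \<F>_def by (intro CollectI exI[of _ "{A}"]) simp
  qed
  ultimately obtain B where B: "B \<in> \<F>" and min: "\<And>C. C \<in> \<F> \<Longrightarrow> C \<subseteq> B \<Longrightarrow> C = B"
    using finite_has_minimal[of \<F>] by blast
  have \<F>: "\<exists>D\<in>\<C>. C \<subseteq> D" "closed_sg C" "normalizes H C" if C: "C \<in> \<F>" for C
  proof -
    obtain \<S> where S: "C = \<Inter>\<S>" "\<S> \<subseteq> \<C>" "\<S> \<noteq> {}" using C by (auto simp: \<F>_def)
    then show "\<exists>D\<in>\<C>. C \<subseteq> D" by blast
    show "closed_sg C" unfolding S(1) using S \<C>(1) by (intro closed_sg_Inter) auto
    show "normalizes H C" unfolding normalizes_def S(1)
      using S(2) \<C>(3)[THEN normalizesD] by blast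
  qed
  have F_Int: "B \<inter> C = {\<one>} \<or> B \<subseteq> C" if C: "C \<in> \<F>" for C
  proof (rule disjCI)
    assume "\<not> B \<subseteq> C"
    obtain \<S> where S: "C = \<Inter>\<S>" "\<S> \<subseteq> \<C>" "\<S> \<noteq> {}" using C by (auto simp: \<F>_def)
    obtain \<R> where R: "B = \<Inter>\<R>" "\<R> \<subseteq> \<C>" "\<R> \<noteq> {}" using B by (auto simp: \<F>_def)
    have "B \<inter> C = \<Inter>(\<R> \<union> \<S>)" using S R by auto
    moreover have "B \<inter> C \<notin> \<F>" using min[of "B \<inter> C"] \<open>\<not> B \<subseteq> C\<close> by auto
    ultimately show "B \<inter> C = {\<one>}"
      unfolding \<F>_def using S R by (metis (mono_tags, lifting) Un_empty Un_subset_iff mem_Collect_eq)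
  qed
  have \<F>_conj: "conj_set g C \<in> \<F>" if g: "g \<in> carrier G" and C: "C \<in> \<F>" for g C
  proof -
    obtain \<S> where S: "C = \<Inter>\<S>" "\<S> \<subseteq> \<C>" "\<S> \<noteq> {}" "C \<noteq> {\<one>}" using C by (auto simp: \<F>_def)
    have sub: "D \<subseteq> carrier G" if "D \<in> \<C>" for D using closed_sgD(3)[OF \<C>(1)[OF that]] .
    have "inj_on (\<lambda>x. g \<otimes> x \<otimes> inv g) (carrier G)" using g by (intro inj_onI) simp
    moreover have "\<forall>D\<in>\<S>. D \<subseteq> carrier G" using S(2) sub by blast
    moreover obtain D where "D \<in> \<S>" using S(3) by blast
    ultimately have "conj_set g (\<Inter>\<S>) = \<Inter>((\<lambda>D. conj_set g D) ` \<S>)"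
      using image_INT[of "\<lambda>x. g \<otimes> x \<otimes> inv g" "carrier G" \<S> "\<lambda>x. x" D] by simp
    moreover have "conj_set g C \<noteq> {\<one>}"
    proof
      assume eq: "conj_set g C = {\<one>}"
      have "x = \<one>" if "x \<in> C" for x
      proof -
        have x: "x \<in> carrier G" using that closed_sgD(3)[OF \<F>(2)[OF C]] by auto
        have "g \<otimes> x \<otimes> inv g = \<one>" using that eq by blast
        then have "inv g \<otimes> (g \<otimes> x \<otimes> inv g) \<otimes> g = \<one>" using g by simp
        then show ?thesis using x g by (simp add: word_simps)
      qed
      then have "C \<subseteq> {\<one>}" by blast
      then show False using S(4) closed_sgD(4)[OF \<F>(2)[OF C]] by blast
    qed
    ultimately have "conj_set g C = \<Inter>((\<lambda>D. conj_set g D) ` \<S>)" "\<Inter>((\<lambda>D. conj_set g D) ` \<S>) \<noteq> {\<one>}"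
      using S(1) by simp_all
    moreover have "(\<lambda>D. conj_set g D) ` \<S> \<subseteq> \<C>" "(\<lambda>D. conj_set g D) ` \<S> \<noteq> {}"
      using S(2,3) \<C>_conj[OF g] by blast+
    ultimately show ?thesis
      unfolding \<F>_def by (intro CollectI exI conjI)
  qed
  have comm1: "x \<otimes> y = y \<otimes> x" if x: "x \<in> B" and y: "y \<in> C" and C: "C \<in> \<F>" for x y C
    using F_Int[OF C]
  proof
    assume "B \<subseteq> C"
    then show ?thesis using \<F>(1)[OF C] \<C>(4) x y by blast
  next
    assume BC: "B \<inter> C = {\<one>}"
    have "x \<in> H" "y \<in> H" using x y \<F>(1)[OF C] \<F>(1)[OF B] \<C>(2) by blast+
    then have "commutator G x y \<in> B \<inter> C"
      using commutator_mem_left[OF \<F>(3)[OF B] H'(2) closed_sgD(1)[OF \<F>(2)[OF B]] x]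
        commutator_mem_right[OF \<F>(3)[OF C] H'(2) closed_sgD(1)[OF \<F>(2)[OF C]] _ y] by blast
    then show ?thesis
      using BC commutator_eq_one_iff[of x y] \<open>x \<in> H\<close> \<open>y \<in> H\<close> H'(4) by auto
  qed
  note B' = closed_sgD[OF \<F>(2)[OF B]]
  define S where "S = (\<Union>g\<in>carrier G. conj_set g B)"
  have S: "S \<subseteq> carrier G" using B'(3) by (auto simp: S_def)
  have S_comm: "x \<otimes> y = y \<otimes> x" if "x \<in> S" "y \<in> S" for x y
  proof -
    obtain g a where x: "g \<in> carrier G" "a \<in> B" "x = g \<otimes> a \<otimes> inv g" using \<open>x \<in> S\<close> by (auto simp: S_def)
    obtain k b where y: "k \<in> carrier G" "b \<in> B" "y = k \<otimes> b \<otimes> inv k" using \<open>y \<in> S\<close> by (auto simp: S_def)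
    have car: "a \<in> carrier G" "b \<in> carrier G" using x y B' by auto
    \<comment> \<open>Conjugating both elements by \<open>inv g\<close> moves the first one into
      \<open>B\<close> itself, where \<open>comm1\<close> applies.\<close>
    let ?b = "(inv g \<otimes> k) \<otimes> b \<otimes> inv (inv g \<otimes> k)"
    have "?b \<in> conj_set (inv g \<otimes> k) B" using y by blast
    then have "a \<otimes> ?b = ?b \<otimes> a"
      using x(1) y(1) by (intro comm1[OF x(2) _ \<F>_conj[of "inv g \<otimes> k", OF _ B]]) simp_all
    then have "g \<otimes> (a \<otimes> ?b) \<otimes> inv g = g \<otimes> (?b \<otimes> a) \<otimes> inv g" by simp
    then show ?thesis using x y car by (simp add: word_simps)
  qed
  define N where "N = closed_generate G T S"
  have Ncl: "closed_sg N" unfolding N_def using S by (rule closed_sg_closed_generate)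
  have "normalizes (carrier G) N"
    unfolding normalizes_def
  proof (intro ballI)
    fix g x assume g: "g \<in> carrier G" and x: "x \<in> N"
    have "S \<subseteq> {x \<in> carrier G. g \<otimes> x \<otimes> inv g \<in> N}"
    proof
      fix s assume "s \<in> S"
      then obtain k b where s: "k \<in> carrier G" "b \<in> B" "s = k \<otimes> b \<otimes> inv k" by (auto simp: S_def)
      have "b \<in> carrier G" using s B' by auto
      then have eq: "g \<otimes> s \<otimes> inv g = (g \<otimes> k) \<otimes> b \<otimes> inv (g \<otimes> k)" and "s \<in> carrier G"
        using s g by (simp_all add: word_simps)
      have "g \<otimes> s \<otimes> inv g \<in> S" unfolding eq S_def using s g by blast
      then show "s \<in> {x \<in> carrier G. g \<otimes> x \<otimes> inv g \<in> N}"
        using \<open>s \<in> carrier G\<close> subset_closed_generate[of S] by (auto simp: N_def)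
    qed
    then have "N \<subseteq> {x \<in> carrier G. g \<otimes> x \<otimes> inv g \<in> N}"
      unfolding N_def by (rule closed_generate_least) (rule closed_sg_conj_vimage[OF g Ncl[unfolded N_def]])
    then show "g \<otimes> x \<otimes> inv g \<in> N" using x by auto
  qed
  then have "N = {\<one>}"
    using commuting_closed_generate[OF S S_comm]
    by (intro fitting_free_sgD[OF ff Ncl closed_sgD(3)[OF Ncl]]) (auto simp: N_def)
  moreover have "B \<subseteq> N"
  proof -
    have "B = conj_set \<one> B" using conj_set_normalizes[OF \<F>(3)[OF B] H'(2) subgroup.one_closed[OF H'(2)] B'(3)] by simp
    then have "B \<subseteq> S" unfolding S_def by blast
    then show ?thesis unfolding N_def using subset_closed_generate[of S] by (rule subset_trans)
  qed
  moreover have "B \<noteq> {\<one>}" using B by (auto simp: \<F>_def)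
  ultimately show False using B'(4) by auto
qed

text \<open>The last lower central term before the trivial one is abelian and normalized by
  \<open>L\<close>, hence trivial too.\<close>

lemma nilpotent_trivial:
  assumes ff: "fitting_free_sg L" and L: "L \<subseteq> carrier G"
    and N: "closed_sg N" "N \<subseteq> L" "normalizes L N"
  shows "\<gamma> N i = {\<one>} \<Longrightarrow> N = {\<one>}"
proof (induction i)
  case (Suc i)
  let ?A = "\<gamma> N i"
  have A: "closed_sg ?A" by (rule closed_sg_lcs[OF N(1)])
  have AN: "?A \<subseteq> N" by (rule lcs_subset[OF N(1)])
  have "?A = {\<one>}"
  proof (rule fitting_free_sgD[OF ff A])
    show "?A \<subseteq> L" using AN N(2) by (rule subset_trans)
    show "normalizes L ?A" by (rule normalizes_lcs[OF N(3) L N(1)])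
    fix x y assume xy: "x \<in> ?A" "y \<in> ?A"
    then have "commutator G x y \<in> \<gamma> N (Suc i)"
      using AN by (auto intro: commutator_in_comm_sg)
    then have "commutator G x y = \<one>" using Suc.prems by simp
    then show "x \<otimes> y = y \<otimes> x"
      using xy closed_sgD(3)[OF A] by (subst (asm) commutator_eq_one_iff) auto
  qed
  then show ?case by (rule Suc.IH)
qed simp

lemma lcs_eq_one_iff: "closed_sg K \<Longrightarrow> \<gamma> K c = {\<one>} \<longleftrightarrow> \<gamma> K c \<subseteq> {\<one>}"
  using closed_sgD(4)[OF closed_sg_lcs[of K c]] by auto

section \<open>Centralizers of open normal subgroups\<close>

definition centralizer :: "'a set \<Rightarrow> 'a set" where
  "centralizer S = {g \<in> carrier G. \<forall>s\<in>S. g \<otimes> s = s \<otimes> g}"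

lemma closed_sg_centralizer: "S \<subseteq> carrier G \<Longrightarrow> closed_sg (centralizer S)"
  unfolding centralizer_def using Hausdorff by (rule centralizer_closed_sg[rotated])

lemma normalizes_centralizer:
  assumes "normalizes (carrier G) H" "H \<subseteq> carrier G"
  shows "normalizes (carrier G) (centralizer H)"
  unfolding normalizes_def
proof (intro ballI)
  fix g x assume g: "g \<in> carrier G" and x: "x \<in> centralizer H"
  then have xc: "x \<in> carrier G" by (simp add: centralizer_def)
  have "g \<otimes> x \<otimes> inv g \<otimes> s = s \<otimes> (g \<otimes> x \<otimes> inv g)" if s: "s \<in> H" for s
  proof -
    have sc: "s \<in> carrier G" using s assms(2) by auto
    have "inv g \<otimes> s \<otimes> g \<in> H" using normalizesD_inv[OF assms(1) subgroup_self g s] .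
    then have "x \<otimes> (inv g \<otimes> s \<otimes> g) = (inv g \<otimes> s \<otimes> g) \<otimes> x" using x by (simp add: centralizer_def)
    then have "g \<otimes> (x \<otimes> (inv g \<otimes> s \<otimes> g)) \<otimes> inv g = g \<otimes> ((inv g \<otimes> s \<otimes> g) \<otimes> x) \<otimes> inv g" by simp
    then show ?thesis using g xc sc by (simp add: word_simps)
  qed
  then show "g \<otimes> x \<otimes> inv g \<in> centralizer H" using g xc by (simp add: centralizer_def)
qed

text \<open>The intersection is the centre of \<open>H\<close>.\<close>

lemma centralizer_Int_trivial:
  assumes "fitting_free_sg H" "open_normal H"
  shows "centralizer H \<inter> H = {\<one>}"
proof (rule fitting_free_sgD[OF assms(1)])
  note H = open_normalD[OF assms(2)]
  show "closed_sg (centralizer H \<inter> H)"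
    by (intro closed_sg_Int closed_sg_centralizer H open_normal_closed[OF assms(2)])
  show "normalizes H (centralizer H \<inter> H)"
    by (intro normalizes_Int normalizes_mono[OF normalizes_centralizer[OF H(5,4)] H(4)] normalizes_self H)
  show "x \<otimes> y = y \<otimes> x" if "x \<in> centralizer H \<inter> H" "y \<in> centralizer H \<inter> H" for x y
    using that unfolding centralizer_def by blast
qed blast

lemma mem_centralizer_if_disjoint:
  assumes A: "subgroup A G" and H: "subgroup H G" and AH: "A \<inter> H = {\<one>}"
    and n: "normalizes H A" "normalizes A H"
  shows "A \<subseteq> centralizer H"
proof
  fix a assume a: "a \<in> A"
  have "a \<otimes> h = h \<otimes> a" if h: "h \<in> H" for h
  proof -
    have "commutator G a h \<in> A \<inter> H"
      using commutator_mem_left[OF n(1) H A a h] commutator_mem_right[OF n(2) A H a h] by simp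
    then show ?thesis
      using AH commutator_eq_one_iff[of a h] a h subgroup.mem_carrier[OF A] subgroup.mem_carrier[OF H] by simp
  qed
  then show "a \<in> centralizer H" using a subgroup.mem_carrier[OF A] by (simp add: centralizer_def)
qed

lemma open_normal_finite_Inter:
  assumes "finite \<I>" "\<And>i. i \<in> \<I> \<Longrightarrow> open_normal (u i)"
  shows "\<exists>U. open_normal U \<and> (\<forall>i\<in>\<I>. U \<subseteq> u i)"
  using assms
proof (induction \<I>)
  case empty
  then show ?case using open_normal_carrier by blast
next
  case (insert i \<I>)
  then obtain U where U: "open_normal U" "\<forall>i\<in>\<I>. U \<subseteq> u i" by auto
  then show ?case
    using insert.prems[of i] by (intro exI[of _ "U \<inter> u i"]) (auto simp: open_normal_Int)
qed

lemma mem_closed_iff_open_normal: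
  assumes "closedin T C" "x \<notin> C"
  obtains U where "open_normal U" "x \<notin> C <#> U"
  using mem_closed_iff_cosets[OF assms(1), of x] assms(2) by blast

text \<open>For each of the finitely many listed terms not inside \<open>N\<close> choose an open
  normal subgroup modulo which it still sticks out of \<open>N\<close>, and let \<open>U\<close> lie
  in all of these. Then \<gamma>(NU) is itself on the list and lies in \<open>N <#> U\<close>, so it
  cannot stick out.\<close>

lemma lcs_open_normal_subset:
  assumes N: "closed_sg N" and H: "open_sg H" "normalizes H N" "\<not> \<gamma> N c \<subseteq> H"
    and fin: "finite {\<gamma> K c |K. open_sg K \<and> normalizes H K \<and> \<not> \<gamma> K c \<subseteq> H}" (is "finite ?\<A>")
  shows "\<exists>U. open_normal U \<and> \<gamma> U c \<subseteq> N"
proof -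
  note N' = closed_sgD[OF N] and H' = open_sgD[OF H(1)]
  define u where "u M = (SOME U. open_normal U \<and> \<not> M \<subseteq> N <#> U)" for M
  have u: "open_normal (u M) \<and> \<not> M \<subseteq> N <#> u M" if M: "\<not> M \<subseteq> N" for M
  proof -
    obtain x where x: "x \<in> M" "x \<notin> N" using M by auto
    obtain U where "open_normal U" "x \<notin> N <#> U" by (rule mem_closed_iff_open_normal[OF N'(2) x(2)])
    then have "open_normal U \<and> \<not> M \<subseteq> N <#> U" using x by auto
    then show ?thesis unfolding u_def by (rule someI)
  qed
  obtain U where U: "open_normal U" "\<forall>M\<in>{M \<in> ?\<A>. \<not> M \<subseteq> N}. U \<subseteq> u M"
    using open_normal_finite_Inter[of "{M \<in> ?\<A>. \<not> M \<subseteq> N}" u] fin u by auto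
  note U' = open_normalD[OF U(1)]
  have NU: "open_sg (N <#> U)"
    by (intro open_sg_set_mult N' U' normalizes_mono[OF U'(5)])
  have sub: "N \<subseteq> N <#> U" "U \<subseteq> N <#> U" by (intro subset_set_mult1 subset_set_mult2 N' U')+
  let ?M = "\<gamma> (N <#> U) c"
  have "\<not> ?M \<subseteq> H" using H(3) lcs_mono[OF sub(1), of c] by blast
  moreover have "normalizes H (N <#> U)"
    by (intro normalizes_set_mult H normalizes_mono[OF U'(5)] H' N' U')
  ultimately have "?M \<in> ?\<A>" using NU by blast
  moreover have "?M \<subseteq> N <#> u ?M" if "\<not> ?M \<subseteq> N"
  proof -
    have Uu: "U \<subseteq> u ?M" using U(2) \<open>?M \<in> ?\<A>\<close> that by blast
    then show ?thesis
      using lcs_subset[OF open_sg_closed[OF NU], of c] set_mult_mono[OF subset_refl[of N] Uu] by blast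
  qed
  ultimately have "?M \<subseteq> N" using u by blast
  then show ?thesis using U(1) lcs_mono[OF sub(2), of c] by blast
qed

text \<open>The JNN property of \<open>L\<close> phrased inside \<open>G\<close>: virtual nilpotency
  of \<open>L / N\<close> becomes the existence of an open \<open>K \<subseteq> L\<close> with
  \<open>\<gamma> K c \<subseteq> N\<close>, and no quotient is formed.\<close>

definition jnn_sg :: "nat \<Rightarrow> 'a set \<Rightarrow> bool" where
  "jnn_sg c L \<longleftrightarrow> (\<forall>K. open_sg K \<and> K \<subseteq> L \<longrightarrow> \<gamma> K c \<noteq> {\<one>}) \<and>
     (\<forall>N. closed_sg N \<and> N \<subseteq> L \<and> normalizes L N \<and> N \<noteq> {\<one>} \<longrightarrow>
        (\<exists>K. open_sg K \<and> K \<subseteq> L \<and> \<gamma> K c \<subseteq> N))"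

text \<open>A nilpotent open normal subgroup would be trivial, and a trivial open subgroup has
  finitely many cosets, so \<open>G\<close> would be finite.\<close>

lemma open_not_nilpotent:
  assumes ff: "fitting_free_sg (carrier G)" and inf: "infinite (carrier G)" and K: "open_sg K"
  shows "\<gamma> K c \<noteq> {\<one>}"
proof
  assume "\<gamma> K c = {\<one>}"
  obtain U where U: "open_normal U" "U \<subseteq> K" by (rule open_normal_in_open_sg[OF K])
  note U' = open_normalD[OF U(1)] and Uc = open_normal_closed[OF U(1)]
  have "\<gamma> U c = {\<one>}" using lcs_mono[OF U(2), of c] \<open>\<gamma> K c = {\<one>}\<close> lcs_eq_one_iff[OF Uc] by simp
  then have "U = {\<one>}"
    using nilpotent_trivial[OF fitting_free_open_normal[OF ff U(1)] U'(4) Uc subset_refl normalizes_self[OF U'(2)]] by blast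
  moreover obtain R where "finite R" "R \<subseteq> carrier G" "carrier G = R <#> U" by (rule finite_cosets[OF U'(1)])
  ultimately have "finite (carrier G)" using finite_set_mult[of R U] by simp
  then show False using inf by simp
qed

text \<open>Fitting-freeness passes to the open normal subgroup \<open>C\<close> inside
  \<open>L\<close>. An abelian normal subgroup of \<open>L\<close> then meets \<open>C\<close>
  trivially and so centralizes \<open>C\<close>; hence the centralizer of \<open>C\<close> must be
  trivial, and showing this already uses the finiteness assumption.\<close>

lemma jnn_sg_if_finite:
  assumes ff: "fitting_free_sg (carrier G)" and inf: "infinite (carrier G)"
    and fin: "\<And>H. open_sg H \<Longrightarrow> finite {\<gamma> K c |K. open_sg K \<and> normalizes H K \<and> \<not> \<gamma> K c \<subseteq> H}"
    and L: "open_sg L"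
  shows "jnn_sg c L"
proof -
  note L' = open_sgD[OF L]
  obtain C where C: "open_normal C" "C \<subseteq> L" by (rule open_normal_in_open_sg[OF L])
  note C' = open_normalD[OF C(1)]
  have ffC: "fitting_free_sg C" by (rule fitting_free_open_normal[OF ff C(1)])
  have E_trivial: "centralizer C = {\<one>}"
  proof (rule ccontr)
    let ?E = "centralizer C"
    assume ne: "?E \<noteq> {\<one>}"
    have E: "closed_sg ?E" "normalizes (carrier G) ?E"
      by (intro closed_sg_centralizer normalizes_centralizer C')+
    have EC: "?E \<inter> C = {\<one>}" by (rule centralizer_Int_trivial[OF ffC C(1)])
    \<comment> \<open>A non-trivial \<open>?E\<close> contains \<open>\<gamma> U c\<close> for some
      open normal \<open>U\<close>; since \<open>?E\<close> meets \<open>C\<close> trivially,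
      \<open>U \<inter> C\<close> would be nilpotent.\<close>
    have "\<gamma> ?E c \<noteq> {\<one>}"
      using nilpotent_trivial[OF ff subset_refl E(1) closed_sgD(3)[OF E(1)] E(2), of c] ne by blast
    then have "\<not> \<gamma> ?E c \<subseteq> C"
      using EC lcs_subset[OF E(1), of c] lcs_eq_one_iff[OF E(1)] by blast
    then obtain U where U: "open_normal U" "\<gamma> U c \<subseteq> ?E"
      using lcs_open_normal_subset[OF E(1) C'(1) normalizes_mono[OF E(2) C'(4)] _ fin[OF C'(1)]] by blast
    have UC: "open_normal (U \<inter> C)" by (rule open_normal_Int[OF U(1) C(1)])
    have "\<gamma> (U \<inter> C) c \<subseteq> ?E \<inter> C"
      using U(2) lcs_mono[of "U \<inter> C" U c] lcs_subset[OF open_normal_closed[OF UC], of c] by blast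
    then have "\<gamma> (U \<inter> C) c = {\<one>}"
      using EC lcs_eq_one_iff[OF open_normal_closed[OF UC]] by simp
    then show False using open_not_nilpotent[OF ff inf open_normalD(1)[OF UC]] by blast
  qed
  have ffL: "fitting_free_sg L"
    unfolding fitting_free_sg_def
  proof (intro allI impI, elim conjE)
    fix A assume A: "closed_sg A" "A \<subseteq> L" "normalizes L A" and comm: "\<forall>x\<in>A. \<forall>y\<in>A. x \<otimes> y = y \<otimes> x"
    note A' = closed_sgD[OF A(1)]
    have CA: "normalizes C A" using normalizes_mono[OF A(3) C(2)] .
    have "A \<inter> C = {\<one>}"
      using comm by (intro fitting_free_sgD[OF ffC] closed_sg_Int A open_normal_closed[OF C(1)]
          normalizes_Int CA normalizes_self C') auto
    then have "A \<subseteq> centralizer C"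
      using CA normalizes_mono[OF C'(5) A'(3)] by (intro mem_centralizer_if_disjoint A' C')
    then show "A = {\<one>}" using E_trivial A'(4) by auto
  qed
  have "\<exists>K. open_sg K \<and> K \<subseteq> L \<and> \<gamma> K c \<subseteq> N"
    if N: "closed_sg N" "N \<subseteq> L" "normalizes L N" "N \<noteq> {\<one>}" for N
  proof -
    have cl: "closed_sg (\<gamma> N c)" by (rule closed_sg_lcs[OF N(1)])
    have "\<gamma> N c \<noteq> {\<one>}"
      using nilpotent_trivial[OF ffL L'(3) N(1-3), of c] N(4) by blast
    then obtain x where x: "x \<in> \<gamma> N c" "x \<noteq> \<one>" using closed_sgD(4)[OF cl] by auto
    then obtain V where V: "open_normal V" "x \<notin> V" using open_normal_avoiding[of x] closed_sgD(3)[OF cl] by auto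
    \<comment> \<open>\<open>V\<close> misses the point \<open>x\<close> of
      \<open>\<gamma> N c\<close>, so \<open>V \<inter> L\<close> normalizes \<open>N\<close>
      without containing \<open>\<gamma> N c\<close>.\<close>
    have H: "open_sg (V \<inter> L)"
      using open_normalD[OF V(1)] L' unfolding open_subgroup_def
      by (simp add: openin_Int subgroups_Inter_pair)
    have "\<exists>U. open_normal U \<and> \<gamma> U c \<subseteq> N"
      using x V by (intro lcs_open_normal_subset[OF N(1) H _ _ fin[OF H]] normalizes_mono[OF N(3)]) auto
    then obtain U where U: "open_normal U" "\<gamma> U c \<subseteq> N" by blast
    have "open_sg (U \<inter> L)"
      using open_normalD[OF U(1)] L' unfolding open_subgroup_def
      by (simp add: openin_Int subgroups_Inter_pair)
    then show ?thesis using U(2) lcs_mono[of "U \<inter> L" U c] by blast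
  qed
  then show ?thesis
    unfolding jnn_sg_def using open_not_nilpotent[OF ff inf] by blast
qed

end

section \<open>Uniform lower bounds for lower central terms\<close>

context profinite_group
begin

lemma set_mult_commute_normalizes:
  assumes "normalizes K N" "subgroup K G" "N \<subseteq> carrier G"
  shows "N <#> K = K <#> N"
proof (intro equalityI subsetI)
  fix x assume "x \<in> N <#> K"
  then obtain n k where x: "n \<in> N" "k \<in> K" "x = n \<otimes> k" by (rule set_mult_memE)
  then have "n \<in> carrier G" "k \<in> carrier G" using assms subgroup.mem_carrier by auto
  then have "x = k \<otimes> (inv k \<otimes> n \<otimes> k)" using x by (simp add: word_simps)
  then show "x \<in> K <#> N" using x normalizesD_inv[OF assms(1,2)] by (simp add: set_mult_memI)
next
  fix x assume "x \<in> K <#> N"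
  then obtain k n where x: "k \<in> K" "n \<in> N" "x = k \<otimes> n" by (rule set_mult_memE)
  then have "n \<in> carrier G" "k \<in> carrier G" using assms subgroup.mem_carrier by auto
  then have "x = (k \<otimes> n \<otimes> inv k) \<otimes> k" using x by (simp add: word_simps)
  also have "\<dots> \<in> N <#> K" using normalizesD[OF assms(1) x(1,2)] x(1) by (rule set_mult_memI)
  finally show "x \<in> N <#> K" .
qed

section \<open>Closed normal subgroups of a fixed open normal subgroup\<close>

definition closed_normal_in :: "'a set \<Rightarrow> 'a set \<Rightarrow> bool" where
  "closed_normal_in H N \<longleftrightarrow> closed_sg N \<and> N \<subseteq> H \<and> normalizes H N"

lemma closed_normal_inD:
  assumes "closed_normal_in H N"
  shows "closed_sg N" "N \<subseteq> H" "normalizes H N" "subgroup N G" "closedin T N" "N \<subseteq> carrier G" "\<one> \<in> N"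
  using assms closed_sgD[of N] unfolding closed_normal_in_def by auto

lemma closed_normal_in_Int:
  "closed_normal_in H M \<Longrightarrow> closed_normal_in H N \<Longrightarrow> closed_normal_in H (M \<inter> N)"
  unfolding closed_normal_in_def by (auto simp: closed_sg_Int normalizes_Int)

lemma closed_normal_in_set_mult:
  assumes H: "subgroup H G" and M: "closed_normal_in H M" and N: "closed_normal_in H N"
  shows "closed_normal_in H (M <#> N)"
  unfolding closed_normal_in_def
  by (intro conjI closed_sg_set_mult set_mult_least normalizes_set_mult H subgroup.subset[OF H]
      closed_normal_inD[OF M] closed_normal_inD[OF N] normalizes_mono[OF closed_normal_inD(3)[OF N]])

lemma closed_normal_in_lcs:
  assumes H: "subgroup H G" and N: "closed_normal_in H N"
  shows "closed_normal_in H (\<gamma> N i)"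
  unfolding closed_normal_in_def
  by (intro conjI closed_sg_lcs normalizes_lcs subset_trans[OF lcs_subset] subgroup.subset[OF H]
      closed_normal_inD[OF N])

lemma closed_normal_in_open_normal:
  assumes "open_normal W" "open_normal H"
  shows "closed_normal_in H (W \<inter> H)"
  unfolding closed_normal_in_def
  using open_normal_Int[OF assms] open_normal_closed normalizes_mono[OF open_normalD(5) open_normalD(4)[OF assms(2)]]
  by blast

context
  fixes H :: "'a set" and c :: nat
  assumes H: "open_normal H" and jnn: "jnn_sg c H" and ff: "fitting_free_sg H"
begin

lemma lcs_neq_one:
  assumes "closed_normal_in H N" "N \<noteq> {\<one>}"
  shows "\<gamma> N i \<noteq> {\<one>}"
  using nilpotent_trivial[OF ff open_normalD(4)[OF H] closed_normal_inD(1-3)[OF assms(1)]] assms(2) by blast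

lemma jnn_open_normal:
  assumes N: "closed_normal_in H N" "N \<noteq> {\<one>}"
  obtains V where "open_normal V" "V \<subseteq> H" "\<gamma> V c \<subseteq> N"
proof -
  obtain K where K: "open_sg K" "K \<subseteq> H" "\<gamma> K c \<subseteq> N"
    using jnn closed_normal_inD(1-3)[OF N(1)] N(2) unfolding jnn_sg_def by blast
  obtain V where V: "open_normal V" "V \<subseteq> K" by (rule open_normal_in_open_sg[OF K(1)])
  show thesis using that[OF V(1)] V(2) K lcs_mono[OF V(2), of c] by blast
qed

text \<open>The two subgroups contain \<gamma>(V) and \<gamma>(W); if they met trivially,
  \<open>V \<inter> W\<close> would be a nilpotent open subgroup.\<close>

lemma closed_normal_in_Int_neq_one:
  assumes "closed_normal_in H M" "M \<noteq> {\<one>}" "closed_normal_in H N" "N \<noteq> {\<one>}"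
  shows "M \<inter> N \<noteq> {\<one>}"
proof
  assume MN: "M \<inter> N = {\<one>}"
  obtain V where V: "open_normal V" "V \<subseteq> H" "\<gamma> V c \<subseteq> M" by (rule jnn_open_normal[OF assms(1,2)])
  obtain W where W: "open_normal W" "W \<subseteq> H" "\<gamma> W c \<subseteq> N" by (rule jnn_open_normal[OF assms(3,4)])
  have VW: "open_normal (V \<inter> W)" by (rule open_normal_Int[OF V(1) W(1)])
  have "\<gamma> (V \<inter> W) c \<subseteq> {\<one>}"
    using lcs_mono[of "V \<inter> W" V c] lcs_mono[of "V \<inter> W" W c] V(3) W(3) MN by blast
  then have "\<gamma> (V \<inter> W) c = {\<one>}" using lcs_eq_one_iff[OF open_normal_closed[OF VW]] by simp
  moreover have "V \<inter> W \<subseteq> H" using V(2) by blast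
  ultimately show False
    using jnn open_normalD(1)[OF VW] unfolding jnn_sg_def by blast
qed

text \<open>The image of \<open>S\<close> modulo \<open>M\<close> is perfect, hence equal to each of
  its lower central terms.\<close>

lemma subset_set_mult_lcs:
  assumes S: "closed_normal_in H S" and M: "closed_normal_in H M" and perf: "S \<subseteq> M <#> comm_sg S S"
  shows "S \<subseteq> M <#> \<gamma> S k"
proof (induction k)
  case 0
  show ?case unfolding lower_central.simps
    by (intro subset_set_mult2 closed_normal_inD[OF M] closed_normal_inD[OF S])
next
  case (Suc k)
  note S' = closed_normal_inD[OF S] and M' = closed_normal_inD[OF M] and H' = open_normalD[OF H]
  have L: "closed_normal_in H (\<gamma> S i)" for i by (rule closed_normal_in_lcs[OF H'(2) S])
  have MS: "closed_normal_in H (M <#> \<gamma> S (Suc k))"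
    by (rule closed_normal_in_set_mult[OF H'(2) M L])
  note MS' = closed_normal_inD[OF MS]
  have "comm_sg S S \<subseteq> M <#> \<gamma> S (Suc k)"
  proof (rule comm_sg_least[OF _ MS'(1)])
    fix x y assume xy: "x \<in> S" "y \<in> S"
    have "x \<in> M <#> \<gamma> S k" using Suc.IH xy(1) by blast
    then obtain m a where x: "m \<in> M" "a \<in> \<gamma> S k" "x = m \<otimes> a" by (rule set_mult_memE)
    have H: "a \<in> H" "y \<in> H" using closed_normal_inD(2)[OF L, of k] x(2) S'(2) xy(2) by blast+
    have car: "m \<in> carrier G" "a \<in> carrier G" "y \<in> carrier G" using x(1) M'(6) H H'(4) by auto
    have "commutator G m y \<in> M" by (rule commutator_mem_left[OF M'(3) H'(2) M'(4) x(1) H(2)])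
    then have "inv a \<otimes> commutator G m y \<otimes> a \<in> M" by (rule normalizesD_inv[OF M'(3) H'(2) H(1)])
    moreover have "commutator G a y \<in> \<gamma> S (Suc k)"
      using x(2) xy(2) by (simp add: commutator_in_comm_sg)
    moreover have "commutator G x y = (inv a \<otimes> commutator G m y \<otimes> a) \<otimes> commutator G a y"
      unfolding x(3) using car by (rule commutator_mult_left)
    ultimately show "commutator G x y \<in> M <#> \<gamma> S (Suc k)" by (simp only: set_mult_memI)
  qed
  moreover have "M \<subseteq> M <#> \<gamma> S (Suc k)"
    by (intro subset_set_mult1 M' closed_normal_inD(4)[OF L])
  ultimately have "M <#> comm_sg S S \<subseteq> M <#> \<gamma> S (Suc k)"
    by (intro set_mult_least MS')
  with perf show ?case by (rule subset_trans)
qed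

text \<open>\<open>S / M\<close> is a finite perfect \<open>H\<close>-chief quotient: the condition
  on \<open>W\<close> makes \<open>M\<close> open in \<open>S\<close>, and maximality is meant among
  proper subgroups of \<open>S\<close> that are closed and normal in \<open>H\<close>.\<close>

definition perfect_maximal :: "'a set \<Rightarrow> 'a set \<Rightarrow> bool" where
  "perfect_maximal S M \<longleftrightarrow> closed_normal_in H M \<and> M \<subset> S \<and> S \<subseteq> M <#> comm_sg S S \<and>
     (\<exists>W. open_normal W \<and> W \<inter> S \<subseteq> M) \<and>
     (\<forall>M'. closed_normal_in H M' \<and> M \<subseteq> M' \<and> M' \<subset> S \<longrightarrow> M' = M)"

lemma perfect_maximalD:
  assumes "perfect_maximal S M"
  shows "closed_normal_in H M" "M \<subset> S" "S \<subseteq> M <#> comm_sg S S"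
    "\<And>M'. closed_normal_in H M' \<Longrightarrow> M \<subseteq> M' \<Longrightarrow> M' \<subseteq> S \<Longrightarrow> M' = M \<or> M' = S"
  using assms unfolding perfect_maximal_def by (simp_all add: psubset_eq, blast)

text \<open>If \<open>V \<inter> S\<close> were not inside \<open>M\<close>, maximality would give
  \<open>(V \<inter> S) <#> M = S\<close>; then \<open>S / M\<close> would be both nilpotent and
  perfect, hence trivial.\<close>

lemma perfect_maximal_contains:
  assumes S: "closed_normal_in H S" and M: "perfect_maximal S M"
    and V: "open_normal V" "\<gamma> V c \<subseteq> M"
  shows "V \<inter> S \<subseteq> M"
proof (rule ccontr)
  assume VM: "\<not> V \<inter> S \<subseteq> M"
  note H' = open_normalD[OF H] and MD = perfect_maximalD[OF M]
  note S' = closed_normal_inD[OF S] and M' = closed_normal_inD[OF MD(1)]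
  have "V \<inter> S = (V \<inter> H) \<inter> S" using S'(2) by blast
  then have VS: "closed_normal_in H (V \<inter> S)"
    using closed_normal_in_Int[OF closed_normal_in_open_normal[OF V(1) H] S] by simp
  note VS' = closed_normal_inD[OF VS]
  let ?M = "(V \<inter> S) <#> M"
  have sub: "M \<subseteq> ?M" "V \<inter> S \<subseteq> ?M"
    by (intro subset_set_mult1 subset_set_mult2 VS' M')+
  have "?M \<subseteq> S" using MD(2) by (intro set_mult_least S') auto
  then have "?M = S"
    using MD(4)[OF closed_normal_in_set_mult[OF H'(2) VS MD(1)] sub(1)] sub(2) VM by blast
  then have "\<gamma> S c \<subseteq> \<gamma> (V \<inter> S) c <#> M"
    using lcs_set_mult[OF VS'(1) M'(1) normalizes_mono[OF M'(3) VS'(2)], of c] by simp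
  also have "\<dots> \<subseteq> M"
    using lcs_mono[of "V \<inter> S" V c] V(2) by (intro set_mult_least M') auto
  finally have "M <#> \<gamma> S c \<subseteq> M" by (intro set_mult_least M') auto
  then have "S \<subseteq> M" using subset_set_mult_lcs[OF S MD(1,3), of c] by (rule subset_trans[rotated])
  then show False using MD(2) by blast
qed

text \<open>The induction step is Goursat's argument: \<open>[S, S] \<subseteq> [I M\<^sub>1, M M\<^sub>1] \<subseteq> (I \<inter> M) M\<^sub>1\<close>, and \<open>S\<close> is perfect
  modulo \<open>M\<^sub>1\<close>.\<close>

lemma perfect_maximal_independent:
  assumes S: "closed_normal_in H S" and M1: "perfect_maximal S M1"
    and F: "finite \<F>" "\<And>M. M \<in> \<F> \<Longrightarrow> perfect_maximal S M" "M1 \<notin> \<F>"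
  shows "closed_normal_in H (S \<inter> \<Inter>\<F>) \<and> S \<subseteq> (S \<inter> \<Inter>\<F>) <#> M1"
  using F
proof (induction \<F>)
  case empty
  then show ?case
    using S subset_set_mult1[OF closed_normal_inD(6)[OF S] closed_normal_inD(4)[OF perfect_maximalD(1)[OF M1]]] by simp
next
  case (insert M \<F>)
  note H' = open_normalD[OF H] and M1D = perfect_maximalD[OF M1]
  note S' = closed_normal_inD[OF S] and M1' = closed_normal_inD[OF M1D(1)]
  have M: "perfect_maximal S M" "M \<noteq> M1" using insert.prems by auto
  note MD = perfect_maximalD[OF M(1)]
  note M' = closed_normal_inD[OF MD(1)]
  let ?I = "S \<inter> \<Inter>\<F>"
  have IH: "closed_normal_in H ?I" "S \<subseteq> ?I <#> M1" using insert by auto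
  have I: "closed_normal_in H (?I \<inter> M)" by (rule closed_normal_in_Int[OF IH(1) MD(1)])
  have sub: "M \<subseteq> M <#> M1" "M1 \<subseteq> M <#> M1" by (intro subset_set_mult1 subset_set_mult2 M' M1')+
  have MM: "M <#> M1 = S"
  proof -
    have cn: "closed_normal_in H (M <#> M1)" by (rule closed_normal_in_set_mult[OF H'(2) MD(1) M1D(1)])
    have le: "M <#> M1 \<subseteq> S" using MD(2) M1D(2) by (intro set_mult_least S') auto
    show ?thesis
      using M1D(4)[OF cn sub(2) le] MD(4)[OF cn sub(1) le] M(2) by blast
  qed
  have J: "closed_normal_in H ((?I \<inter> M) <#> M1)"
    by (rule closed_normal_in_set_mult[OF H'(2) I M1D(1)])
  note J' = closed_normal_inD[OF J]
  have "comm_sg S S \<subseteq> (?I \<inter> M) <#> M1"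
  proof (rule comm_sg_least[OF _ J'(1)])
    fix x y assume "x \<in> S" "y \<in> S"
    then have "x \<in> ?I <#> M1" "y \<in> M <#> M1" using IH(2) MM by auto
    then obtain i u m v where xy: "i \<in> ?I" "u \<in> M1" "x = i \<otimes> u" "m \<in> M" "v \<in> M1" "y = m \<otimes> v"
      by (elim set_mult_memE)
    note I' = closed_normal_inD[OF IH(1)]
    have imH: "i \<in> H" "m \<in> H" using xy(1,4) I'(2) M'(2) by auto
    obtain w where w: "w \<in> M1" "commutator G x y = commutator G i m \<otimes> w"
      using commutator_cong_mod[OF H'(2) M1'(4,3) imH(1) xy(2) imH(2) xy(5)] xy(3,6) by auto
    have "commutator G i m \<in> ?I \<inter> M"
      using commutator_mem_left[OF I'(3) H'(2) I'(4) xy(1) imH(2)]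
        commutator_mem_right[OF M'(3) H'(2) M'(4) imH(1) xy(4)] by blast
    then show "commutator G x y \<in> (?I \<inter> M) <#> M1" unfolding w(2) using w(1) by (rule set_mult_memI)
  qed
  then have "M1 <#> comm_sg S S \<subseteq> (?I \<inter> M) <#> M1"
    by (intro set_mult_least J' subset_set_mult2 M1' closed_normal_inD(4)[OF I])
  then have "S \<subseteq> (?I \<inter> M) <#> M1" using M1D(3) by blast
  moreover have "?I \<inter> M = S \<inter> \<Inter>(insert M \<F>)" by blast
  ultimately show ?case using I by simp
qed

text \<open>Fix one kernel \<open>M1\<close> and intersect all the others with \<open>S\<close> to
  get \<open>D\<close>. Once \<open>D \<inter> M1\<close> is non-trivial it contains some
  \<gamma>(V), and this single \<open>V\<close> serves every kernel by
  \<open>perfect_maximal_contains\<close>.\<close>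

lemma perfect_maximal_bound:
  assumes S: "closed_normal_in H S" "S \<noteq> {\<one>}"
  shows "\<exists>V. open_normal V \<and> V \<subseteq> H \<and> (\<forall>M. perfect_maximal S M \<longrightarrow> V \<inter> S \<subseteq> M)"
proof (cases "\<exists>M. perfect_maximal S M")
  case False
  then show ?thesis using H by blast
next
  case True
  then obtain M1 where M1: "perfect_maximal S M1" by blast
  note H' = open_normalD[OF H] and M1D = perfect_maximalD[OF M1]
  note S' = closed_normal_inD[OF S(1)] and M1' = closed_normal_inD[OF M1D(1)]
  obtain W where W: "open_normal W" "W \<inter> S \<subseteq> M1" using M1 by (auto simp: perfect_maximal_def)
  note W' = open_normalD[OF W(1)]
  let ?\<M> = "{M. perfect_maximal S M \<and> M \<noteq> M1}"
  define D where "D = \<Inter>(insert S ?\<M>)"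
  have D: "closed_normal_in H D"
    unfolding closed_normal_in_def
  proof (intro conjI)
    show "closed_sg D" unfolding D_def
      using S'(1) closed_normal_inD(1)[OF perfect_maximalD(1)] by (intro closed_sg_Inter) auto
    show "D \<subseteq> H" unfolding D_def using S'(2) by blast
    have nM: "normalizes H M" if "M \<in> insert S ?\<M>" for M
      using that S'(3) by (auto dest: perfect_maximalD(1) closed_normal_inD(3))
    show "normalizes H D"
      unfolding D_def normalizes_def[of H "\<Inter>(insert S ?\<M>)"]
      by (intro ballI InterI) (rule normalizesD[OF nM], assumption, assumption, erule InterD)
  qed
  \<comment> \<open>Each finite intersection of the other kernels covers \<open>S\<close> modulo
    \<open>M1\<close>, so it leaves the open set \<open>?O\<close>, whose trace on \<open>S\<close>
    is \<open>M1\<close>. By compactness some point of \<open>D\<close> lies outside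
    \<open>?O\<close> as well.\<close>
  have "\<not> D \<subseteq> M1"
  proof
    assume DM: "D \<subseteq> M1"
    let ?O = "M1 <#> W"
    have O: "openin T ?O" by (intro openin_set_mult M1' W')
    have OS: "?O \<inter> S \<subseteq> M1"
    proof
      fix x assume x: "x \<in> ?O \<inter> S"
      then obtain m w where mw: "m \<in> M1" "w \<in> W" "x = m \<otimes> w" by (auto elim: set_mult_memE)
      have "w = inv m \<otimes> x" using mw M1'(6) W'(4) by (simp add: inv_mult_cancel subsetD)
      moreover have "inv m \<otimes> x \<in> S"
        using mw(1) M1D(2) x S'(4) by (auto intro!: subgroup.m_closed subgroup.m_inv_closed)
      ultimately have "w \<in> M1" using W(2) mw(2) by blast
      then show "x \<in> M1" unfolding mw(3) using mw(1) M1'(4) by (simp add: subgroup.m_closed)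
    qed
    let ?\<D> = "{(S \<inter> \<Inter>\<F>) - ?O |\<F>. finite \<F> \<and> \<F> \<subseteq> ?\<M>}"
    have indep: "closed_normal_in H (S \<inter> \<Inter>\<F>) \<and> S \<subseteq> (S \<inter> \<Inter>\<F>) <#> M1" if "finite \<F>" "\<F> \<subseteq> ?\<M>" for \<F>
      using that by (intro perfect_maximal_independent S M1) auto
    have "\<Inter>?\<D> \<noteq> {}"
    proof (rule directed_Inter_nonempty[OF compact])
      show "?\<D> \<noteq> {}" by blast
      fix C assume "C \<in> ?\<D>"
      then obtain \<F> where F: "C = (S \<inter> \<Inter>\<F>) - ?O" "finite \<F>" "\<F> \<subseteq> ?\<M>" by auto
      note cn = indep[OF F(2,3)]
      show "closedin T C"
        unfolding F(1) using cn closed_normal_inD(5) by (intro closedin_diff O) blast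
      show "C \<noteq> {}"
      proof
        assume "C = {}"
        then have "S \<inter> \<Inter>\<F> \<subseteq> M1" using OS F(1) by blast
        then have "(S \<inter> \<Inter>\<F>) <#> M1 \<subseteq> M1" by (intro set_mult_least M1') auto
        then show False using cn M1D(2) by blast
      qed
    next
      fix A B assume "A \<in> ?\<D>" "B \<in> ?\<D>"
      then obtain \<F> \<E> where F: "A = (S \<inter> \<Inter>\<F>) - ?O" "finite \<F>" "\<F> \<subseteq> ?\<M>"
        "B = (S \<inter> \<Inter>\<E>) - ?O" "finite \<E>" "\<E> \<subseteq> ?\<M>" by auto
      show "\<exists>C\<in>?\<D>. C \<subseteq> A \<inter> B"
      proof (rule bexI)
        show "(S \<inter> \<Inter>(\<F> \<union> \<E>)) - ?O \<subseteq> A \<inter> B" using F by auto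
        show "(S \<inter> \<Inter>(\<F> \<union> \<E>)) - ?O \<in> ?\<D>" using F by (intro CollectI exI[of _ "\<F> \<union> \<E>"]) auto
      qed
    qed
    then obtain x where x: "\<And>C. C \<in> ?\<D> \<Longrightarrow> x \<in> C" by auto
    have "S \<inter> \<Inter>{} - ?O \<in> ?\<D>" by (intro CollectI exI[of _ "{}"]) auto
    then have xS: "x \<in> S" "x \<notin> ?O" using x by blast+
    have "x \<in> M" if "M \<in> ?\<M>" for M
    proof -
      have "S \<inter> \<Inter>{M} - ?O \<in> ?\<D>" using that by (intro CollectI exI[of _ "{M}"]) auto
      then show ?thesis using x by blast
    qed
    then have "x \<in> M1" using DM xS(1) unfolding D_def by blast
    moreover have "M1 \<subseteq> ?O" by (intro subset_set_mult1 M1' W')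
    ultimately show False using xS(2) by blast
  qed
  then have D1: "D \<noteq> {\<one>}" using M1'(7) by blast
  \<comment> \<open>If \<open>M1\<close> were trivial, so would be \<open>W \<inter> S\<close>,
    although \<open>W \<inter> H\<close> and \<open>S\<close> are non-trivial normal subgroups of
    \<open>H\<close>.\<close>
  have "M1 \<noteq> {\<one>}"
  proof
    assume M1_one: "M1 = {\<one>}"
    have WH: "open_normal (W \<inter> H)" by (rule open_normal_Int[OF W(1) H])
    have "W \<inter> H \<noteq> {\<one>}"
    proof
      assume eq: "W \<inter> H = {\<one>}"
      have "\<gamma> (W \<inter> H) c \<subseteq> W \<inter> H" by (rule lcs_subset[OF open_normal_closed[OF WH]])
      then have "\<gamma> (W \<inter> H) c = {\<one>}" using eq lcs_eq_one_iff[OF open_normal_closed[OF WH]] by simp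
      then show False using jnn open_normalD(1)[OF WH] unfolding jnn_sg_def by blast
    qed
    then have "(W \<inter> H) \<inter> S \<noteq> {\<one>}"
      by (rule closed_normal_in_Int_neq_one[OF closed_normal_in_open_normal[OF W(1) H] _ S])
    then show False using W(2) M1_one W' H' S' subgroup.one_closed by blast
  qed
  then have "D \<inter> M1 \<noteq> {\<one>}" by (rule closed_normal_in_Int_neq_one[OF D D1 M1D(1)])
  then obtain V where V: "open_normal V" "V \<subseteq> H" "\<gamma> V c \<subseteq> D \<inter> M1"
    by (rule jnn_open_normal[OF closed_normal_in_Int[OF D M1D(1)]])
  have "V \<inter> S \<subseteq> M" if M: "perfect_maximal S M" for M
  proof (rule perfect_maximal_contains[OF S(1) M V(1)])
    show "\<gamma> V c \<subseteq> M" using V(3) M unfolding D_def by (cases "M = M1") auto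
  qed
  then show ?thesis using V by blast
qed

text \<open>If \<open>\<gamma> P c\<close> is not contained in \<open>P'\<close> although \<open>P'U = PU\<close>, then \<open>\<gamma> P c / (P' \<inter> \<gamma> P c)\<close> is
  non-trivial and perfect, and a maximal kernel above \<open>P' \<inter> \<gamma> P c\<close> contradicts the choice of
  \<open>U\<close>.\<close>

lemma lcs_subset_of_close:
  assumes P: "closed_normal_in H P" "P \<noteq> {\<one>}"
  shows "\<exists>U. open_normal U \<and> U \<subseteq> H \<and>
    (\<forall>P'. closed_normal_in H P' \<and> P' <#> U = P <#> U \<longrightarrow> \<gamma> P c \<subseteq> P')"
proof -
  note H' = open_normalD[OF H] and P' = closed_normal_inD[OF P(1)]
  define S where "S = \<gamma> P c"
  have S: "closed_normal_in H S" "S \<noteq> {\<one>}"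
    unfolding S_def by (intro closed_normal_in_lcs lcs_neq_one H' P)+
  have SP: "S \<subseteq> P" unfolding S_def by (rule lcs_subset[OF P'(1)])
  note S' = closed_normal_inD[OF S(1)]
  let ?S1 = "comm_sg S S"
  have S1: "closed_normal_in H ?S1" "?S1 \<noteq> {\<one>}"
    using closed_normal_in_lcs[OF H'(2) S(1), of 1] lcs_neq_one[OF S, of 1] by simp_all
  note S1' = closed_normal_inD[OF S1(1)]
  have S1S: "?S1 \<subseteq> S" using lcs_subset[OF S'(1), of 1] by simp
  \<comment> \<open>\<open>V1\<close> will make \<open>S / (P' \<inter> S)\<close> perfect, while
    \<open>V2\<close> controls the maximal kernels.\<close>
  obtain V1 where V1: "open_normal V1" "V1 \<subseteq> H" "\<gamma> V1 c \<subseteq> ?S1" by (rule jnn_open_normal[OF S1])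
  obtain V2 where V2: "open_normal V2" "V2 \<subseteq> H" "\<And>M. perfect_maximal S M \<Longrightarrow> V2 \<inter> S \<subseteq> M"
    using perfect_maximal_bound[OF S] by blast
  define U where "U = V1 \<inter> V2"
  have U: "open_normal U" "U \<subseteq> H" unfolding U_def using open_normal_Int[OF V1(1) V2(1)] V1(2) by auto
  note U' = open_normalD[OF U(1)] and Uc = open_normal_closed[OF U(1)]
  have UV: "U \<subseteq> V1" "U \<subseteq> V2" unfolding U_def by auto
  have "S \<subseteq> P'" if Q: "closed_normal_in H P'" and eq: "P' <#> U = P <#> U" for P'
  proof (rule ccontr)
    assume SnP: "\<not> S \<subseteq> P'"
    note Q' = closed_normal_inD[OF Q]
    have PU: "P \<subseteq> P' <#> U" unfolding eq by (intro subset_set_mult1 P' U')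
    have UQ: "P' <#> U = U <#> P'"
      by (rule set_mult_commute_normalizes[OF normalizes_mono[OF Q'(3) U(2)] U'(2) Q'(6)])
    define L where "L = P' \<inter> S"
    have L: "closed_normal_in H L" unfolding L_def by (rule closed_normal_in_Int[OF Q S(1)])
    note L' = closed_normal_inD[OF L]
    have SL: "S \<subseteq> L <#> ?S1"
    proof
      fix x assume x: "x \<in> S"
      have "S \<subseteq> \<gamma> (U <#> P') c" unfolding S_def by (rule lcs_mono) (use PU UQ in simp)
      also have "\<dots> \<subseteq> \<gamma> U c <#> P'"
        by (rule lcs_set_mult[OF Uc Q'(1) normalizes_mono[OF Q'(3) U(2)]])
      also have "\<dots> \<subseteq> ?S1 <#> P'"
        using lcs_mono[OF UV(1), of c] V1(3) by (intro set_mult_mono subset_refl) blast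
      finally have "x \<in> ?S1 <#> P'" using x by blast
      then obtain s p where sp: "s \<in> ?S1" "p \<in> P'" "x = s \<otimes> p" by (rule set_mult_memE)
      have "p = inv s \<otimes> x" using sp S1'(6) Q'(6) by (simp add: inv_mult_cancel subsetD)
      moreover have "inv s \<otimes> x \<in> S"
        using sp(1) S1S x S'(4) by (auto intro!: subgroup.m_closed subgroup.m_inv_closed)
      ultimately have "p \<in> L" using sp(2) by (simp add: L_def)
      then have "x \<in> ?S1 <#> L" unfolding sp(3) using sp(1) by (intro set_mult_memI)
      then show "x \<in> L <#> ?S1"
        using set_mult_commute_normalizes[OF normalizes_mono[OF L'(3) S1'(2)] S1'(4) L'(6)] by simp
    qed
    obtain x where x: "x \<in> S" "x \<notin> L" using SnP by (auto simp: L_def)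
    obtain W where W: "open_normal W" "x \<notin> L <#> W" by (rule mem_closed_iff_open_normal[OF L'(5) x(2)])
    note W' = open_normalD[OF W(1)]
    \<comment> \<open>\<open>L\<close> need not be open in \<open>S\<close>. Thickening it by
      \<open>W\<close>, which keeps \<open>x\<close> outside, leaves finitely many subgroups above
      it, so a maximal proper one exists.\<close>
    define M0 where "M0 = (L <#> (W \<inter> H)) \<inter> S"
    have M0: "closed_normal_in H M0"
      unfolding M0_def
      by (intro closed_normal_in_Int closed_normal_in_set_mult H' L closed_normal_in_open_normal W(1) H S(1))
    have WH: "subgroup (W \<inter> H) G" by (rule subgroups_Inter_pair[OF W'(2) H'(2)])
    have "L \<subseteq> L <#> (W \<inter> H)" "W \<inter> H \<subseteq> L <#> (W \<inter> H)"
      using W'(4) by (intro subset_set_mult1 subset_set_mult2 L' WH; blast)+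
    then have LM0: "L \<subseteq> M0" and WM0: "W \<inter> S \<subseteq> M0"
      unfolding M0_def using S'(2) by (auto simp: L_def)
    have "x \<notin> M0" using W(2) set_mult_mono[of L L "W \<inter> H" W] unfolding M0_def by blast
    then have M0S: "M0 \<subset> S" using x(1) by (auto simp: M0_def)
    let ?\<K> = "{M. closed_normal_in H M \<and> M0 \<subseteq> M \<and> M \<subset> S}"
    have "?\<K> \<subseteq> (\<lambda>Z. Z \<inter> S) ` ((\<lambda>K. K <#> W) ` {K. K \<subseteq> carrier G})"
    proof
      fix M assume M: "M \<in> ?\<K>"
      then have "closed_normal_in H M" by blast
      note M' = closed_normal_inD[OF this]
      have "M = (M <#> W) \<inter> S"
      proof
        show "M \<subseteq> (M <#> W) \<inter> S" using M subset_set_mult1[OF M'(6) W'(2)] by blast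
        show "(M <#> W) \<inter> S \<subseteq> M"
        proof
          fix y assume y: "y \<in> (M <#> W) \<inter> S"
          then obtain m w where mw: "m \<in> M" "w \<in> W" "y = m \<otimes> w" by (auto elim: set_mult_memE)
          have "w = inv m \<otimes> y" using mw M'(6) W'(4) by (simp add: inv_mult_cancel subsetD)
          moreover have "inv m \<otimes> y \<in> S"
            using mw(1) M y S'(4) by (auto intro!: subgroup.m_closed subgroup.m_inv_closed)
          ultimately have "w \<in> M" using WM0 M mw(2) by blast
          then show "y \<in> M" unfolding mw(3) using mw(1) M'(4) by (simp add: subgroup.m_closed)
        qed
      qed
      then show "M \<in> (\<lambda>Z. Z \<inter> S) ` ((\<lambda>K. K <#> W) ` {K. K \<subseteq> carrier G})" using M'(6) by blast
    qed
    then have "finite ?\<K>"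
      by (rule finite_surj[OF finite_set_mult_images[OF W'(2) finite_modulo_open[OF W'(1)]]])
    moreover have "M0 \<in> ?\<K>" using M0 M0S by blast
    then have "?\<K> \<noteq> {}" by blast
    ultimately have "\<exists>M\<in>?\<K>. \<forall>M'\<in>?\<K>. M \<subseteq> M' \<longrightarrow> M = M'" by (rule finite_has_maximal)
    then obtain M where M: "M \<in> ?\<K>" and max: "\<forall>M'\<in>?\<K>. M \<subseteq> M' \<longrightarrow> M = M'" by (elim bexE)
    have cM: "closed_normal_in H M" using M by blast
    note M' = closed_normal_inD[OF cM]
    have LM: "L \<subseteq> M" using LM0 M by blast
    have SM: "S \<subseteq> M <#> ?S1" using SL set_mult_mono[OF LM subset_refl[of ?S1]] by blast
    have "perfect_maximal S M"
      unfolding perfect_maximal_def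
    proof (intro conjI allI impI)
      show "\<exists>W. open_normal W \<and> W \<inter> S \<subseteq> M" using W(1) WM0 M by blast
      fix M' assume "closed_normal_in H M' \<and> M \<subseteq> M' \<and> M' \<subset> S"
      then show "M' = M" using bspec[OF max, of M'] M by blast
    qed (use cM M SM in auto)
    then have UM: "U \<inter> S \<subseteq> M" using V2(3) UV(2) by blast
    \<comment> \<open>An element of \<open>S\<close> is a product of elements of \<open>P'\<close>
      and \<open>U\<close>. Brackets of \<open>S\<close> with \<open>P'\<close> fall into
      \<open>L\<close> and brackets with \<open>U\<close> into \<open>U \<inter> S\<close>, both
      inside \<open>M\<close>; so \<open>S / M\<close> is abelian as well as perfect.\<close>
    have "?S1 \<subseteq> M"
    proof (rule comm_sg_least[OF _ M'(1)])
      fix s t assume st: "s \<in> S" "t \<in> S"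
      have "t \<in> P' <#> U" using st(2) SP PU by blast
      then obtain p u where t: "p \<in> P'" "u \<in> U" "t = p \<otimes> u" by (rule set_mult_memE)
      have inH: "s \<in> H" "p \<in> H" "u \<in> H" using st(1) S'(2) t(1,2) Q'(2) U(2) by auto
      then have car: "s \<in> carrier G" "p \<in> carrier G" "u \<in> carrier G" using H'(4) by auto
      have "commutator G s u \<in> S" "commutator G s p \<in> S"
        using commutator_mem_left[OF S'(3) H'(2) S'(4) st(1)] inH by auto
      moreover have "commutator G s u \<in> U"
        using commutator_mem_right[OF U'(5) subgroup_self U'(2) car(1) t(2)] .
      moreover have "commutator G s p \<in> P'"
        using commutator_mem_right[OF Q'(3) H'(2) Q'(4) inH(1) t(1)] .
      ultimately have M: "commutator G s u \<in> M" "commutator G s p \<in> M"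
        using UM LM by (auto simp: L_def)
      have "inv u \<otimes> commutator G s p \<otimes> u \<in> M" by (rule normalizesD_inv[OF M'(3) H'(2) inH(3) M(2)])
      with M(1) have "commutator G s u \<otimes> (inv u \<otimes> commutator G s p \<otimes> u) \<in> M"
        by (rule subgroup.m_closed[OF M'(4)])
      then show "commutator G s t \<in> M" unfolding t(3) using car by (simp add: commutator_mult_right)
    qed
    then have "M <#> ?S1 \<subseteq> M" by (intro set_mult_least M') auto
    then show False using SM M by blast
  qed
  then show ?thesis using U unfolding S_def by blast
qed

end

text \<open>Agreement modulo \<open>W\<close> descends to traces on \<open>H\<close>: if
  \<open>a = b \<otimes> w\<close> with \<open>w \<in> W \<subseteq> H\<close>, then
  \<open>b\<close> lies in \<open>H\<close> as soon as \<open>a\<close> does.\<close>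

lemma set_mult_Int_cong:
  assumes WU: "W \<subseteq> U" "subgroup W G" "subgroup U G" and UH: "U \<subseteq> H" "subgroup H G"
    and A: "A \<subseteq> carrier G" "B \<subseteq> carrier G" and eq: "A <#> W = B <#> W"
  shows "(A \<inter> H) <#> U = (B \<inter> H) <#> U"
proof -
  have "(A \<inter> H) <#> U \<subseteq> (B \<inter> H) <#> U"
    if A: "A \<subseteq> carrier G" "B \<subseteq> carrier G" and eq: "A <#> W = B <#> W" for A B
  proof
    fix x assume "x \<in> (A \<inter> H) <#> U"
    then obtain a u where x: "a \<in> A \<inter> H" "u \<in> U" "x = a \<otimes> u" by (rule set_mult_memE)
    have "a \<in> A <#> W" using x(1) subset_set_mult1[OF A(1) WU(2)] by blast
    then have "a \<in> B <#> W" using eq by simp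
    then obtain b w where b: "b \<in> B" "w \<in> W" "a = b \<otimes> w" by (rule set_mult_memE)
    have car: "b \<in> carrier G" "w \<in> carrier G" "u \<in> carrier G"
      using b A(2) x WU subgroup.mem_carrier[OF WU(2)] subgroup.mem_carrier[OF WU(3)] by auto
    have "b = a \<otimes> inv w" using b car by (simp add: word_simps)
    moreover have "a \<otimes> inv w \<in> H"
      using x(1) b(2) WU UH by (auto intro!: subgroup.m_closed subgroup.m_inv_closed)
    ultimately have "b \<in> B \<inter> H" using b(1) by simp
    moreover have "w \<otimes> u \<in> U" using b(2) x(2) WU by (auto intro: subgroup.m_closed)
    ultimately have "b \<otimes> (w \<otimes> u) \<in> (B \<inter> H) <#> U" by (rule set_mult_memI)
    then show "x \<in> (B \<inter> H) <#> U" using x(3) b(3) car by (simp add: m_assoc)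
  qed
  then show ?thesis using A eq by (intro subset_antisym) simp_all
qed

section \<open>Subgroups normalized by an open normal subgroup, and the compactness argument\<close>

context
  fixes H :: "'a set" and c :: nat
  assumes H: "open_normal H" and jnnH: "jnn_sg c H" and jnnG: "jnn_sg c (carrier G)"
    and ff: "fitting_free_sg H"
begin

text \<open>The JNN property of \<open>G\<close> itself enters here: a non-trivial centralizer is
  normal in \<open>G\<close>, so it contains \<gamma>(K) for an open \<open>K\<close>, and
  \<gamma>(K \<inter> H) would lie in the trivial centre of \<open>H\<close>.\<close>

lemma centralizer_trivial: "centralizer H = {\<one>}"
proof (rule ccontr)
  note H' = open_normalD[OF H]
  assume ne: "centralizer H \<noteq> {\<one>}"
  have E: "closed_sg (centralizer H)" "normalizes (carrier G) (centralizer H)"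
    by (intro closed_sg_centralizer normalizes_centralizer H')+
  obtain K where K: "open_sg K" "\<gamma> K c \<subseteq> centralizer H"
    using jnnG E closed_sgD(3)[OF E(1)] ne unfolding jnn_sg_def by blast
  have KH: "open_sg (K \<inter> H)"
    using open_sgD[OF K(1)] H' unfolding open_subgroup_def
    by (simp add: openin_Int subgroups_Inter_pair)
  note KHc = open_sg_closed[OF KH]
  have "\<gamma> (K \<inter> H) c \<subseteq> centralizer H \<inter> H"
    using K(2) lcs_mono[of "K \<inter> H" K c] lcs_subset[OF KHc, of c] by blast
  then have "\<gamma> (K \<inter> H) c = {\<one>}"
    unfolding centralizer_Int_trivial[OF ff H] using lcs_eq_one_iff[OF KHc] by blast
  then show False using jnnG KH open_sgD(3)[OF KH] unfolding jnn_sg_def by blast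
qed

definition admissible :: "'a set \<Rightarrow> bool" where
  "admissible K \<longleftrightarrow> closed_sg K \<and> normalizes H K \<and> \<not> \<gamma> K c \<subseteq> H"

text \<open>The trace \<open>P\<close> of \<open>\<gamma> K c\<close> on \<open>H\<close> is
  non-trivial, since otherwise \<open>\<gamma> K c\<close> would centralize \<open>H\<close>.
  Closeness of \<open>K'\<close> to \<open>K\<close> passes to lower central terms and to traces, so
  \<open>\<gamma> K' c\<close> contains \<open>\<gamma> P c\<close> and with it some \<gamma>(V).
  One \<open>W\<close> is both radius and bound, as the sets \<open>\<B> U\<close> of the
  compactness argument require.\<close>

lemma admissible_neighbourhood:
  assumes K: "admissible K"
  shows "\<exists>W. open_normal W \<and> (\<forall>K'. admissible K' \<and> K' <#> W = K <#> W \<longrightarrow> \<gamma> W c \<subseteq> \<gamma> K' c)"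
proof -
  note H' = open_normalD[OF H]
  have trace: "closed_sg (\<gamma> L c)" "closed_normal_in H (\<gamma> L c \<inter> H)" if "admissible L" for L
  proof -
    have L: "closed_sg L" "normalizes H L" using that by (auto simp: admissible_def)
    show "closed_sg (\<gamma> L c)" by (rule closed_sg_lcs[OF L(1)])
    then show "closed_normal_in H (\<gamma> L c \<inter> H)"
      unfolding closed_normal_in_def
      by (intro conjI closed_sg_Int open_normal_closed[OF H] normalizes_Int normalizes_lcs[OF L(2) H'(4) L(1)]
          normalizes_self[OF H'(2)] Int_lower2)
  qed
  define P where "P = \<gamma> K c \<inter> H"
  have P: "closed_normal_in H P" unfolding P_def by (rule trace(2)[OF K])
  have "P \<noteq> {\<one>}"
  proof
    assume "P = {\<one>}"
    moreover have "normalizes H (\<gamma> K c)"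
      using K by (intro normalizes_lcs H') (auto simp: admissible_def)
    moreover have "normalizes (\<gamma> K c) H" by (rule normalizes_mono[OF H'(5) closed_sgD(3)[OF trace(1)[OF K]]])
    ultimately have "\<gamma> K c \<subseteq> centralizer H"
      unfolding P_def by (intro mem_centralizer_if_disjoint closed_sgD(1)[OF trace(1)[OF K]] H')
    then have "\<gamma> K c \<subseteq> H" using centralizer_trivial closed_sgD(4)[OF open_normal_closed[OF H]] by auto
    then show False using K by (simp add: admissible_def)
  qed
  obtain U where U: "open_normal U" "U \<subseteq> H"
    and close: "\<And>P'. closed_normal_in H P' \<Longrightarrow> P' <#> U = P <#> U \<Longrightarrow> \<gamma> P c \<subseteq> P'"
    using lcs_subset_of_close[OF H jnnH ff P \<open>P \<noteq> {\<one>}\<close>] by blast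
  obtain V where V: "open_normal V" "\<gamma> V c \<subseteq> \<gamma> P c"
    by (rule jnn_open_normal[OF H jnnH ff closed_normal_in_lcs[OF H'(2) P] lcs_neq_one[OF H jnnH ff P \<open>P \<noteq> {\<one>}\<close>]])
  define W where "W = U \<inter> V"
  have W: "open_normal W" unfolding W_def by (rule open_normal_Int[OF U(1) V(1)])
  note W' = open_normalD[OF W] and Wc = open_normal_closed[OF W]
  have "\<gamma> W c \<subseteq> \<gamma> K' c" if K': "admissible K'" and eq: "K' <#> W = K <#> W" for K'
  proof -
    have lcs_eq: "\<gamma> (L <#> W) c <#> W = \<gamma> L c <#> W" if "admissible L" for L
    proof -
      have L: "closed_sg L" using that by (simp add: admissible_def)
      show ?thesis
        by (rule lcs_set_mult_eq[OF L Wc normalizes_mono[OF W'(5) closed_sgD(3)[OF L]]])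
    qed
    have "\<gamma> K' c <#> W = \<gamma> K c <#> W" using lcs_eq[OF K] lcs_eq[OF K'] eq by simp
    then have "(\<gamma> K' c \<inter> H) <#> U = P <#> U"
      unfolding P_def
      by (intro set_mult_Int_cong[of W] W' U(2) open_normalD[OF U(1)] H'
          closed_sgD(3)[OF trace(1)[OF K]] closed_sgD(3)[OF trace(1)[OF K']]) (simp_all add: W_def)
    then have "\<gamma> P c \<subseteq> \<gamma> K' c \<inter> H" by (rule close[OF trace(2)[OF K']])
    then show ?thesis using V(2) lcs_mono[of W V c] unfolding W_def by blast
  qed
  then show ?thesis using W by blast
qed

text \<open>A coherent system of images determines \<open>K\<close> as the intersection of the
  groups \<open>f U\<close>; compactness shows that \<open>K\<close> still covers each of them. That
  \<open>\<gamma> K c\<close> is not inside \<open>H\<close> survives because it is visible modulo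
  \<open>H\<close>.\<close>

lemma admissible_limit:
  assumes f: "\<And>U. open_normal U \<Longrightarrow> \<exists>K. admissible K \<and> f U = K <#> U"
    and coh: "\<And>U V. open_normal U \<Longrightarrow> open_normal V \<Longrightarrow> U \<subseteq> V \<Longrightarrow> f V = f U <#> V"
  obtains K where "admissible K" "\<And>U. open_normal U \<Longrightarrow> K <#> U = f U"
proof -
  note H' = open_normalD[OF H]
  have fU: "closed_sg (f U)" "normalizes H (f U)" if U: "open_normal U" for U
  proof -
    obtain K where K: "admissible K" "f U = K <#> U" using f[OF U] by blast
    then have K': "closed_sg K" "normalizes H K" by (auto simp: admissible_def)
    note U' = open_normalD[OF U]
    show "closed_sg (f U)"
      unfolding K(2) by (intro closed_sg_set_mult K' open_normal_closed U normalizes_mono[OF U'(5) closed_sgD(3)[OF K'(1)]])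
    show "normalizes H (f U)"
      unfolding K(2) by (intro normalizes_set_mult K' normalizes_mono[OF U'(5) H'(4)] H' U' closed_sgD(3)[OF K'(1)])
  qed
  define K where "K = \<Inter>{f U |U. open_normal U}"
  have Kf: "K \<subseteq> f U" if "open_normal U" for U using that by (auto simp: K_def)
  have cl: "closed_sg K" unfolding K_def using fU(1) open_normal_carrier by (intro closed_sg_Inter) auto
  have nH: "normalizes H K"
    unfolding normalizes_def K_def using normalizesD[OF fU(2)] by blast
  have KU: "K <#> U = f U" if U: "open_normal U" for U
  proof
    note U' = open_normalD[OF U]
    have "f U <#> U = f U" using coh[OF U U subset_refl] by simp
    then show "K <#> U \<subseteq> f U" using set_mult_mono[OF Kf[OF U] subset_refl[of U]] by simp
    show "f U \<subseteq> K <#> U"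
    proof
      fix x assume x: "x \<in> f U"
      have xc: "x \<in> carrier G" using x closed_sgD(3)[OF fU(1)[OF U]] by blast
      \<comment> \<open>Points of \<open>f V\<close> in the coset \<open>x U\<close>, for
        \<open>V\<close> shrinking inside \<open>U\<close>: a common point lies in \<open>K\<close>
        and is congruent to \<open>x\<close> modulo \<open>U\<close>.\<close>
      let ?\<D> = "{f V \<inter> ({x} <#> U) |V. open_normal V \<and> V \<subseteq> U}"
      have "\<Inter>?\<D> \<noteq> {}"
      proof (rule directed_Inter_nonempty[OF compact])
        show "?\<D> \<noteq> {}" using U by blast
        fix C assume "C \<in> ?\<D>"
        then obtain V where V: "C = f V \<inter> ({x} <#> U)" "open_normal V" "V \<subseteq> U" by blast
        show "closedin T C"
          unfolding V(1) using xc
          by (intro closedin_Int closedin_set_mult closed_sgD(2)[OF fU(1)[OF V(2)]] closedin_finite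
              closed_sgD(2)[OF open_normal_closed[OF U]]) auto
        have "x \<in> f V <#> U" using x coh[OF V(2) U V(3)] by simp
        then obtain y u where yu: "y \<in> f V" "u \<in> U" "x = y \<otimes> u" by (rule set_mult_memE)
        have "y = x \<otimes> inv u" using yu U'(4) closed_sgD(3)[OF fU(1)[OF V(2)]] by (auto simp: word_simps subsetD)
        moreover have "x \<otimes> inv u \<in> {x} <#> U" using yu(2) U'(2) by (intro set_mult_memI subgroup.m_inv_closed) auto
        ultimately show "C \<noteq> {}" using yu(1) V(1) by auto
      next
        fix A B assume "A \<in> ?\<D>" "B \<in> ?\<D>"
        then obtain V W where V: "A = f V \<inter> ({x} <#> U)" "open_normal V" "V \<subseteq> U"
          and W: "B = f W \<inter> ({x} <#> U)" "open_normal W" "W \<subseteq> U" by blast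
        have VW: "open_normal (V \<inter> W)" by (rule open_normal_Int[OF V(2) W(2)])
        have "f (V \<inter> W) \<subseteq> f Z" if "open_normal Z" "V \<inter> W \<subseteq> Z" for Z
          unfolding coh[OF VW that] by (intro subset_set_mult1 closed_sgD(3)[OF fU(1)[OF VW]] open_normalD(2)[OF that(1)])
        from this[OF V(2)] this[OF W(2)]
        have "f (V \<inter> W) \<inter> ({x} <#> U) \<subseteq> A \<inter> B" unfolding V(1) W(1) by blast
        moreover have "f (V \<inter> W) \<inter> ({x} <#> U) \<in> ?\<D>" using VW V(3) by blast
        ultimately show "\<exists>C\<in>?\<D>. C \<subseteq> A \<inter> B" by blast
      qed
      then obtain y where "y \<in> \<Inter>?\<D>" unfolding ex_in_conv[symmetric] by (elim exE)
      note y = InterD[OF this]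
      have yV: "y \<in> f V" if V: "open_normal V" for V
      proof -
        have VU: "open_normal (V \<inter> U)" by (rule open_normal_Int[OF V U])
        then have "f (V \<inter> U) \<inter> ({x} <#> U) \<in> ?\<D>" by blast
        then have "y \<in> f (V \<inter> U)" using y by blast
        moreover have "f (V \<inter> U) \<subseteq> f V"
          unfolding coh[OF VU V Int_lower1]
          by (intro subset_set_mult1 closed_sgD(3)[OF fU(1)[OF VU]] open_normalD(2)[OF V])
        ultimately show ?thesis by blast
      qed
      then have "y \<in> K" by (auto simp: K_def)
      have "f U \<inter> ({x} <#> U) \<in> ?\<D>" using U by blast
      then have "y \<in> {x} <#> U" using y by blast
      then obtain u where u: "u \<in> U" "y = x \<otimes> u" by (auto elim: set_mult_memE)
      have "x = y \<otimes> inv u" using u xc U'(4) by (auto simp: word_simps subsetD)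
      moreover have "y \<otimes> inv u \<in> K <#> U"
        using \<open>y \<in> K\<close> u(1) U'(2) by (intro set_mult_memI subgroup.m_inv_closed)
      ultimately show "x \<in> K <#> U" by simp
    qed
  qed
  have "\<not> \<gamma> K c \<subseteq> H"
  proof
    assume KH: "\<gamma> K c \<subseteq> H"
    obtain K0 where K0: "admissible K0" "f H = K0 <#> H" using f[OF H] by blast
    then have cl0: "closed_sg K0" and not: "\<not> \<gamma> K0 c \<subseteq> H" by (auto simp: admissible_def)
    have Hc: "closed_sg H" by (rule open_normal_closed[OF H])
    have lcs_eq: "\<gamma> (L <#> H) c <#> H = \<gamma> L c <#> H" if "closed_sg L" for L
      by (rule lcs_set_mult_eq[OF that Hc normalizes_mono[OF H'(5) closed_sgD(3)[OF that]]])
    have "\<gamma> K0 c \<subseteq> \<gamma> K0 c <#> H"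
      by (intro subset_set_mult1 closed_sgD(3)[OF closed_sg_lcs[OF cl0]] H')
    also have "\<dots> = \<gamma> K c <#> H" using lcs_eq[OF cl] lcs_eq[OF cl0] KU[OF H] K0(2) by simp
    also have "\<dots> \<subseteq> H" by (intro set_mult_least KH H' subset_refl)
    finally show False using not by simp
  qed
  then have "admissible K" using cl nH by (simp add: admissible_def)
  then show thesis using that KU by blast
qed

text \<open>If no \<open>V\<close> works, the subgroups that refute \<open>V\<close> have finitely many images \<open>KV\<close>; a point of the
  inverse limit of these finite sets is an admissible subgroup without the neighbourhood found
  above.\<close>

lemma admissible_lcs_bound:
  "\<exists>V. open_normal V \<and> (\<forall>K. admissible K \<longrightarrow> \<gamma> V c \<subseteq> \<gamma> K c)"
proof (rule ccontr)
  assume "\<nexists>V. open_normal V \<and> (\<forall>K. admissible K \<longrightarrow> \<gamma> V c \<subseteq> \<gamma> K c)"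
  then have bad: "\<exists>K. admissible K \<and> \<not> \<gamma> V c \<subseteq> \<gamma> K c" if "open_normal V" for V using that by blast
  define I where "I = {U. open_normal U}"
  \<comment> \<open>The same \<open>U\<close> is used for the failure and for the image. Failure at
    \<open>U\<close> implies failure at every larger \<open>V\<close>, so these finite sets form an
    inverse system.\<close>
  define \<B> where "\<B> U = {K <#> U |K. admissible K \<and> \<not> \<gamma> U c \<subseteq> \<gamma> K c}" for U
  have adm_car: "K \<subseteq> carrier G" if "admissible K" for K
    using that closed_sgD(3) by (auto simp: admissible_def)
  have \<B>_fin: "finite (\<B> U)" if "U \<in> I" for U
  proof (rule finite_subset)
    have U: "open_normal U" using that by (simp add: I_def)
    note U' = open_normalD[OF U]
    show "finite ((\<lambda>K. K <#> U) ` {K. K \<subseteq> carrier G})"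
      by (rule finite_set_mult_images[OF U'(2) finite_modulo_open[OF U'(1)]])
    show "\<B> U \<subseteq> (\<lambda>K. K <#> U) ` {K. K \<subseteq> carrier G}"
      unfolding \<B>_def using adm_car by auto
  qed
  let ?Y = "product_topology (\<lambda>U. discrete_topology (\<B> U)) I"
  have compactY: "compact_space ?Y"
    using \<B>_fin by (simp add: compact_space_product_topology compact_space_discrete_topology)
  \<comment> \<open>Coherence is imposed only from \<open>U\<close> upwards. These sets shrink
    together with \<open>U\<close>, and a point common to all of them is a coherent family.\<close>
  define \<C> where "\<C> U = {f \<in> topspace ?Y. \<forall>V\<in>I. U \<subseteq> V \<longrightarrow> f V = f U <#> V}" for U
  have absorb: "(K <#> U) <#> V = K <#> V" if "K \<subseteq> carrier G" "U \<in> I" "V \<in> I" "U \<subseteq> V" for K U V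
  proof -
    have "open_normal U" "open_normal V" using that by (auto simp: I_def)
    note U' = open_normalD[OF this(1)] and V' = open_normalD[OF this(2)]
    have "U <#> V = V"
      using set_mult_least[OF that(4) subset_refl V'(2)] subset_set_mult2[OF V'(4) U'(2)] by (rule subset_antisym)
    then show ?thesis using that(1) U'(4) V'(4) by (simp add: set_mult_assoc)
  qed
  have "\<Inter>(\<C> ` I) \<noteq> {}"
  proof (rule directed_Inter_nonempty[OF compactY])
    show "\<C> ` I \<noteq> {}" using H by (auto simp: I_def)
    fix C assume "C \<in> \<C> ` I"
    then obtain U where U: "C = \<C> U" "U \<in> I" by auto
    have proj: "closedin ?Y {f \<in> topspace ?Y. f V \<in> S}" if "V \<in> I" for V S
    proof -
      have "closedin ?Y {f \<in> topspace ?Y. f V \<in> S \<inter> \<B> V}"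
        by (rule closedin_continuous_map_preimage[OF continuous_map_product_projection[OF that]]) simp
      moreover have "{f \<in> topspace ?Y. f V \<in> S \<inter> \<B> V} = {f \<in> topspace ?Y. f V \<in> S}"
        using that by (auto simp: PiE_iff)
      ultimately show ?thesis by simp
    qed
    \<comment> \<open>Since \<open>\<B> U\<close> is finite and the coordinates are discrete, the
      condition \<open>f V = f U <#> V\<close> is a finite union of closed cylinders.\<close>
    have "closedin ?Y (\<Union>b\<in>\<B> U. {f \<in> topspace ?Y. f U \<in> {b}} \<inter> {f \<in> topspace ?Y. f V \<in> {b <#> V}})"
      if "V \<in> I" for V
    proof (rule closedin_Union)
      fix D assume "D \<in> (\<lambda>b. {f \<in> topspace ?Y. f U \<in> {b}} \<inter> {f \<in> topspace ?Y. f V \<in> {b <#> V}}) ` \<B> U"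
      then show "closedin ?Y D" by (elim imageE, hypsubst) (intro closedin_Int proj that U(2))
    qed (use \<B>_fin[OF U(2)] in simp)
    moreover have "(\<Union>b\<in>\<B> U. {f \<in> topspace ?Y. f U \<in> {b}} \<inter> {f \<in> topspace ?Y. f V \<in> {b <#> V}})
        = {f \<in> topspace ?Y. f V = f U <#> V}" for V
      using U(2) by (auto simp: PiE_iff)
    ultimately have "closedin ?Y {f \<in> topspace ?Y. f V = f U <#> V}" if "V \<in> I" for V using that by simp
    then have "closedin ?Y (\<Inter>(insert (topspace ?Y) ((\<lambda>V. {f \<in> topspace ?Y. f V = f U <#> V}) ` {V \<in> I. U \<subseteq> V})))"
      by (intro closedin_Inter) (auto simp del: topspace_product_topology)
    moreover have "\<Inter>(insert (topspace ?Y) ((\<lambda>V. {f \<in> topspace ?Y. f V = f U <#> V}) ` {V \<in> I. U \<subseteq> V})) = C"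
      unfolding U(1) \<C>_def by auto
    ultimately show "closedin ?Y C" by simp
    have "open_normal U" using U by (simp add: I_def)
    then obtain K where K: "admissible K" "\<not> \<gamma> U c \<subseteq> \<gamma> K c" using bad by blast
    \<comment> \<open>At subgroups \<open>V\<close> that do not contain \<open>U\<close> any value
      from \<open>\<B> V\<close> will do, since membership in \<open>\<C> U\<close> places no
      coherence condition there.\<close>
    define f where "f = (\<lambda>V\<in>I. if U \<subseteq> V then K <#> V else SOME Z. Z \<in> \<B> V)"
    have "f V \<in> \<B> V" if V: "V \<in> I" for V
    proof (cases "U \<subseteq> V")
      case True
      have "\<not> \<gamma> V c \<subseteq> \<gamma> K c" using K(2) lcs_mono[OF True, of c] by blast
      then show ?thesis using True V K(1) by (auto simp: f_def \<B>_def)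
    next
      case False
      have "\<exists>Z. Z \<in> \<B> V" using bad[of V] V unfolding \<B>_def I_def by blast
      then have "(SOME Z. Z \<in> \<B> V) \<in> \<B> V" by (rule someI_ex)
      then show ?thesis using False V by (simp add: f_def)
    qed
    then have "f \<in> topspace ?Y" by (auto simp: f_def)
    moreover have "f V = f U <#> V" if "V \<in> I" "U \<subseteq> V" for V
      using that U(2) absorb[OF adm_car[OF K(1)] U(2) that] by (simp add: f_def)
    ultimately show "C \<noteq> {}" unfolding U(1) \<C>_def by blast
  next
    fix A B assume "A \<in> \<C> ` I" "B \<in> \<C> ` I"
    then obtain U V where UV: "A = \<C> U" "B = \<C> V" "U \<in> I" "V \<in> I" by auto
    have W: "U \<inter> V \<in> I" using UV open_normal_Int by (simp add: I_def)
    have "\<C> (U \<inter> V) \<subseteq> \<C> Z" if Z: "Z \<in> I" "U \<inter> V \<subseteq> Z" for Z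
    proof
      fix f assume f: "f \<in> \<C> (U \<inter> V)"
      then have "f \<in> Pi\<^sub>E I \<B>" by (simp add: \<C>_def)
      then have "f (U \<inter> V) \<in> \<B> (U \<inter> V)" using W by (rule PiE_mem)
      then obtain K where "admissible K" "f (U \<inter> V) = K <#> (U \<inter> V)" unfolding \<B>_def by blast
      then have car: "f (U \<inter> V) \<subseteq> carrier G"
        using set_mult_closed adm_car open_normalD(4) W unfolding I_def by simp
      have "f Y = f Z <#> Y" if Y: "Y \<in> I" "Z \<subseteq> Y" for Y
      proof -
        have "f Z = f (U \<inter> V) <#> Z" "f Y = f (U \<inter> V) <#> Y" using f Z Y by (auto simp: \<C>_def)
        then show ?thesis using absorb[OF car Z(1) Y] by simp
      qed
      then show "f \<in> \<C> Z" using f by (simp add: \<C>_def)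
    qed
    then show "\<exists>C\<in>\<C> ` I. C \<subseteq> A \<inter> B" using W UV by (intro bexI[of _ "\<C> (U \<inter> V)"]) auto
  qed
  then obtain f where f: "\<And>U. U \<in> I \<Longrightarrow> f \<in> \<C> U" by auto
  have fB: "f U \<in> \<B> U" if "U \<in> I" for U
  proof -
    have "f \<in> Pi\<^sub>E I \<B>" using f[OF that] by (simp add: \<C>_def)
    then show ?thesis using that by (rule PiE_mem)
  qed
  obtain K where K: "admissible K" "\<And>U. open_normal U \<Longrightarrow> K <#> U = f U"
  proof (rule admissible_limit[of f])
    show "\<exists>K. admissible K \<and> f U = K <#> U" if "open_normal U" for U
      using fB[of U] that unfolding \<B>_def I_def by blast
    show "f V = f U <#> V" if "open_normal U" "open_normal V" "U \<subseteq> V" for U V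
      using f[of U] that unfolding \<C>_def I_def by blast
  qed blast
  obtain W where W: "open_normal W" "\<And>K'. admissible K' \<Longrightarrow> K' <#> W = K <#> W \<Longrightarrow> \<gamma> W c \<subseteq> \<gamma> K' c"
    using admissible_neighbourhood[OF K(1)] by blast
  obtain K' where K': "f W = K' <#> W" "admissible K'" "\<not> \<gamma> W c \<subseteq> \<gamma> K' c"
    using fB[of W] W(1) unfolding \<B>_def I_def by blast
  show False using W(2)[OF K'(2)] K'(1,3) K(2)[OF W(1)] by simp
qed

end

text \<open>Shrinking \<open>H0\<close> to an open normal \<open>H\<close> can only enlarge the
  family of subgroups in question, and replacing the uniform \<open>V\<close> by
  \<open>V \<inter> H\<close> makes it normalize each of the original ones.\<close>

lemma finite_if_jnn_sg:
  assumes fg: "topologically_fg G T" and ff: "fitting_free_sg (carrier G)"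
    and jnn: "\<And>L. open_sg L \<Longrightarrow> jnn_sg c L" and H0: "open_sg H0"
  shows "finite {\<gamma> K c |K. closed_sg K \<and> normalizes H0 K \<and> \<not> \<gamma> K c \<subseteq> H0}"
proof -
  obtain H where H: "open_normal H" "H \<subseteq> H0" by (rule open_normal_in_open_sg[OF H0])
  have jnnH: "jnn_sg c H" and jnnG: "jnn_sg c (carrier G)"
    using jnn open_normalD(1)[OF H(1)] open_normalD(1)[OF open_normal_carrier] by blast+
  have ffH: "fitting_free_sg H" by (rule fitting_free_open_normal[OF ff H(1)])
  obtain V where V: "open_normal V" "\<And>K. admissible H c K \<Longrightarrow> \<gamma> V c \<subseteq> \<gamma> K c"
    using admissible_lcs_bound[OF H(1) jnnH jnnG ffH] by blast
  have VH: "open_normal (V \<inter> H)" by (rule open_normal_Int[OF V(1) H(1)])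
  have "{\<gamma> K c |K. closed_sg K \<and> normalizes H0 K \<and> \<not> \<gamma> K c \<subseteq> H0}
      \<subseteq> {\<gamma> K c |K. closed_sg K \<and> normalizes (V \<inter> H) K \<and> \<gamma> (V \<inter> H) c \<subseteq> \<gamma> K c}"
  proof
    fix L assume "L \<in> {\<gamma> K c |K. closed_sg K \<and> normalizes H0 K \<and> \<not> \<gamma> K c \<subseteq> H0}"
    then obtain K where K: "L = \<gamma> K c" "closed_sg K" "normalizes H0 K" "\<not> \<gamma> K c \<subseteq> H0" by blast
    have nH: "normalizes H K" by (rule normalizes_mono[OF K(3) H(2)])
    have "admissible H c K"
      unfolding admissible_def[OF H(1) jnnH jnnG ffH] using K nH H(2) by blast
    then have "\<gamma> (V \<inter> H) c \<subseteq> \<gamma> K c" using V(2) lcs_mono[of "V \<inter> H" V c] by blast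
    moreover have "normalizes (V \<inter> H) K" by (rule normalizes_mono[OF nH]) blast
    ultimately show "L \<in> {\<gamma> K c |K. closed_sg K \<and> normalizes (V \<inter> H) K \<and> \<gamma> (V \<inter> H) c \<subseteq> \<gamma> K c}"
      using K(1,2) by blast
  qed
  then show ?thesis using finite_lcs_above[OF fg VH] by (rule finite_subset)
qed

end

section \<open>Open subgroups and quotients\<close>

context topological_group
begin

lemma topological_group_subgroup:
  assumes L: "subgroup L G"
  shows "topological_group (G\<lparr>carrier := L\<rparr>) (subtopology T L)"
proof -
  interpret L: group "G\<lparr>carrier := L\<rparr>" by (rule subgroup_imp_group[OF L])
  have Lc: "L \<subseteq> carrier G" by (rule subgroup.subset[OF L])
  show ?thesis
  proof
    show "topspace (subtopology T L) = carrier (G\<lparr>carrier := L\<rparr>)"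
      using Lc by (simp add: topspace_eq inf_absorb2)
    have "continuous_map (prod_topology (subtopology T L) (subtopology T L)) T (\<lambda>(x, y). x \<otimes> y)"
      unfolding subtopology_Times[symmetric] by (rule continuous_map_from_subtopology[OF continuous_mult])
    then show "continuous_map (prod_topology (subtopology T L) (subtopology T L)) (subtopology T L)
        (\<lambda>(x, y). x \<otimes>\<^bsub>G\<lparr>carrier := L\<rparr>\<^esub> y)"
      using L by (auto simp: continuous_map_in_subtopology subgroup.m_closed)
    have "continuous_map (subtopology T L) (subtopology T L) (\<lambda>x. inv x)"
      using L continuous_map_from_subtopology[OF continuous_inv]
      by (auto simp: continuous_map_in_subtopology subgroup.m_inv_closed)
    then show "continuous_map (subtopology T L) (subtopology T L) (\<lambda>x. inv\<^bsub>G\<lparr>carrier := L\<rparr>\<^esub> x)"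
      by (rule continuous_map_eq) (use m_inv_consistent[OF L] in auto)
  qed
qed

lemma commutator_subgroup_carrier:
  assumes L: "subgroup L G" and "x \<in> L" "y \<in> L"
  shows "commutator (G\<lparr>carrier := L\<rparr>) x y = commutator G x y"
  using assms by (simp add: commutator_def m_inv_consistent)

lemma subgroup_carrier_iff:
  assumes L: "subgroup L G"
  shows "subgroup K (G\<lparr>carrier := L\<rparr>) \<longleftrightarrow> subgroup K G \<and> K \<subseteq> L"
  using incl_subgroup[OF L] subgroup_incl[OF _ L] subgroup.subset[of K "G\<lparr>carrier := L\<rparr>"] by auto

lemma closed_subgroup_carrier_iff:
  assumes L: "closed_sg L"
  shows "closed_subgroup (G\<lparr>carrier := L\<rparr>) (subtopology T L) K \<longleftrightarrow> closed_sg K \<and> K \<subseteq> L"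
  unfolding closed_subgroup_def subgroup_carrier_iff[OF closed_sgD(1)[OF L]]
    closedin_closed_subtopology[OF closed_sgD(2)[OF L]]
  by blast

lemma open_subgroup_carrier_iff:
  assumes L: "open_sg L"
  shows "open_subgroup (G\<lparr>carrier := L\<rparr>) (subtopology T L) K \<longleftrightarrow> open_sg K \<and> K \<subseteq> L"
  unfolding open_subgroup_def subgroup_carrier_iff[OF open_sgD(1)[OF L]]
    openin_open_subtopology[OF open_sgD(2)[OF L]]
  by blast

text \<open>The closed subgroups of \<open>L\<close> are the closed subgroups of \<open>G\<close>
  inside \<open>L\<close>, and the hull in \<open>G\<close> of a subset of \<open>L\<close> stays
  inside \<open>L\<close>.\<close>

lemma closed_generate_carrier:
  assumes L: "closed_sg L" and S: "S \<subseteq> L"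
  shows "closed_generate (G\<lparr>carrier := L\<rparr>) (subtopology T L) S = closed_generate G T S"
proof
  have "closed_sg (closed_generate G T S)"
    using S closed_sgD(3)[OF L] by (intro closed_sg_closed_generate) (rule subset_trans)
  moreover have "closed_generate G T S \<subseteq> L" by (rule closed_generate_least[OF S L])
  ultimately have "closed_subgroup (G\<lparr>carrier := L\<rparr>) (subtopology T L) (closed_generate G T S)"
    unfolding closed_subgroup_carrier_iff[OF L] by simp
  then show "closed_generate (G\<lparr>carrier := L\<rparr>) (subtopology T L) S \<subseteq> closed_generate G T S"
    unfolding closed_generate_def[of "G\<lparr>carrier := L\<rparr>"] by (rule hull_minimal[OF subset_closed_generate])
  show "closed_generate G T S \<subseteq> closed_generate (G\<lparr>carrier := L\<rparr>) (subtopology T L) S"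
    unfolding closed_generate_def
    by (rule hull_antimono) (use closed_subgroup_carrier_iff[OF L] in blast)
qed

lemma lcs_carrier:
  assumes L: "closed_sg L" and K: "closed_sg K" "K \<subseteq> L"
  shows "lower_central (G\<lparr>carrier := L\<rparr>) (subtopology T L) K (Suc i) = \<gamma> K i"
proof (induction i)
  case (Suc i)
  let ?S = "{commutator G x y |x y. x \<in> \<gamma> K i \<and> y \<in> K}"
  have sub: "\<gamma> K i \<subseteq> L" using lcs_subset[OF K(1)] K(2) by (rule subset_trans)
  have "commutator (G\<lparr>carrier := L\<rparr>) x y = commutator G x y" if "x \<in> \<gamma> K i" "y \<in> K" for x y
    using commutator_subgroup_carrier[OF closed_sgD(1)[OF L], of x y] that sub K(2) by blast
  then have "{commutator (G\<lparr>carrier := L\<rparr>) x y |x y. x \<in> \<gamma> K i \<and> y \<in> K} = ?S"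
    by (intro Collect_cong iff_exI) auto
  moreover have "?S \<subseteq> L"
  proof
    fix z assume "z \<in> ?S"
    then obtain x y where "x \<in> \<gamma> K i" "y \<in> K" "z = commutator G x y" by blast
    moreover then have "x \<in> L" "y \<in> L" using sub K(2) by blast+
    ultimately show "z \<in> L"
      using closed_sgD(1)[OF L] by (simp add: commutator_def subgroup.m_closed subgroup.m_inv_closed)
  qed
  ultimately show ?case
    using Suc by (simp add: commutator_subgroup_def closed_generate_carrier[OF L])
qed simp

end

context profinite_group
begin

lemma profinite_group_closed_subgroup:
  assumes L: "closed_sg L"
  shows "profinite_group (G\<lparr>carrier := L\<rparr>) (subtopology T L)"
proof -
  note L' = closed_sgD[OF L]
  interpret L: topological_group "G\<lparr>carrier := L\<rparr>" "subtopology T L"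
    by (rule topological_group_subgroup[OF L'(1)])
  show ?thesis
  proof
    show "compact_space (subtopology T L)"
      by (rule compact_space_subtopology[OF closedin_compact_space[OF compact L'(2)]])
    show "Hausdorff_space (subtopology T L)"
      by (rule Hausdorff_space_subtopology[OF Hausdorff])
    fix x assume "x \<in> carrier (G\<lparr>carrier := L\<rparr>)"
    then have x: "x \<in> L" "x \<in> carrier G" using L'(3) by auto
    have "y = x" if "connected_component_of (subtopology T L) x y" for y
    proof -
      have "connected_component_of (subtopology T UNIV) x y"
        using that by (rule connected_component_of_mono) simp
      then show ?thesis using totally_disconnected[OF x(2)] by auto
    qed
    moreover have "connected_component_of (subtopology T L) x x"
      using x by (simp add: connected_component_of_refl topspace_eq)
    ultimately show "connected_component_of_set (subtopology T L) x = {x}" by blast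
  qed
qed

text \<open>Images of closed subgroups are closed, because the saturation \<open>N <#> B\<close> is
  closed by compactness, and preimages are closed by continuity. So the projection commutes with
  closed hulls and hence with the lower central series.\<close>

lemma virtually_nilpotent_quotient_iff:
  assumes N: "closed_normal_subgroup G T N"
  shows "virtually_nilpotent c (G Mod N) (quotient_topology G T N) \<longleftrightarrow> (\<exists>K. open_sg K \<and> \<gamma> K c \<subseteq> N)"
proof -
  interpret N: normal N G using N by (simp add: closed_normal_subgroup_def)
  let ?Q = "G Mod N" and ?T = "quotient_topology G T N" and ?p = "\<lambda>x. N #> x"
  have Ncl: "closedin T N" using N by (simp add: closed_normal_subgroup_def)
  have quot: "quotient_map T ?T ?p" by (rule quotient_map_quotient_topology)
  interpret Q: group ?Q by (rule N.factorgroup_is_group)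
  interpret p: group_hom G ?Q ?p
    by (intro group_hom.intro group_hom_axioms.intro group_axioms Q.group_axioms N.r_coset_hom_Mod)
  have surj: "?p ` carrier G = carrier ?Q" by (auto simp: FactGroup_def RCOSETS_def)
  have sat: "{x \<in> topspace T. ?p x \<in> ?p ` B} = N <#> B" if B: "B \<subseteq> carrier G" for B
  proof (intro equalityI subsetI)
    fix x assume "x \<in> {x \<in> topspace T. ?p x \<in> ?p ` B}"
    then obtain b where "x \<in> carrier G" "b \<in> B" "?p x = ?p b" by (auto simp: topspace_eq)
    then have "x \<in> N #> b" using rcos_self[of x N] N.subgroup_axioms by simp
    then show "x \<in> N <#> B" using \<open>b \<in> B\<close> by (auto simp: r_coset_def set_mult_def)
  next
    fix x assume "x \<in> N <#> B"
    then obtain n b where nb: "n \<in> N" "b \<in> B" "x = n \<otimes> b" by (rule set_mult_memE)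
    then have "x \<in> N #> b" by (auto simp: r_coset_def)
    then have "?p x = ?p b" using repr_independence[of x N b] nb B N.subgroup_axioms by auto
    moreover have "x \<in> carrier G" using nb B N.subset by auto
    ultimately show "x \<in> {x \<in> topspace T. ?p x \<in> ?p ` B}" using nb by (auto simp: topspace_eq)
  qed
  have img: "closed_subgroup ?Q ?T (?p ` B)" if B: "closed_sg B" for B
  proof -
    note B' = closed_sgD[OF B]
    have "?p ` B \<subseteq> topspace ?T" using B'(3) surj by (auto simp: topspace_quotient_topology)
    then have "closedin ?T (?p ` B)"
      using quot sat[OF B'(3)] closedin_set_mult[OF Ncl B'(2)] unfolding quotient_map_closedin by auto
    then show ?thesis
      using p.subgroup_img_is_subgroup[OF B'(1)] by (simp add: closed_subgroup_def)
  qed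
  have preimg_sg: "subgroup {x \<in> carrier G. ?p x \<in> A} G" if A: "subgroup A ?Q" for A
  proof
    fix x y assume "x \<in> {x \<in> carrier G. ?p x \<in> A}" "y \<in> {x \<in> carrier G. ?p x \<in> A}"
    then show "x \<otimes> y \<in> {x \<in> carrier G. ?p x \<in> A}"
      using subgroup.m_closed[OF A, of "?p x" "?p y"] p.hom_mult[of x y] by auto
  next
    fix x assume "x \<in> {x \<in> carrier G. ?p x \<in> A}"
    then show "inv x \<in> {x \<in> carrier G. ?p x \<in> A}"
      using subgroup.m_inv_closed[OF A, of "?p x"] p.hom_inv[of x] by auto
  next
    show "\<one> \<in> {x \<in> carrier G. ?p x \<in> A}"
      using subgroup.one_closed[OF A] p.hom_one by simp
  qed auto
  have preimg: "closed_sg {x \<in> carrier G. ?p x \<in> A}" if A: "closed_subgroup ?Q ?T A" for A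
    using A closedin_continuous_map_preimage[OF quotient_imp_continuous_map[OF quot], of A] preimg_sg[of A]
    by (simp add: closed_subgroup_def topspace_eq)
  have gen: "closed_generate ?Q ?T (?p ` S) = ?p ` closed_generate G T S" if S: "S \<subseteq> carrier G" for S
  proof
    show "closed_generate ?Q ?T (?p ` S) \<subseteq> ?p ` closed_generate G T S"
      unfolding closed_generate_def[of ?Q]
      by (rule hull_minimal) (rule image_mono[OF subset_closed_generate], rule img[OF closed_sg_closed_generate[OF S]])
    show "?p ` closed_generate G T S \<subseteq> closed_generate ?Q ?T (?p ` S)"
      unfolding closed_generate_def[of ?Q] hull_def
    proof (intro Inter_greatest)
      fix A assume "A \<in> {t. closed_subgroup ?Q ?T t \<and> ?p ` S \<subseteq> t}"
      then have A: "closed_subgroup ?Q ?T A" "?p ` S \<subseteq> A" by auto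
      have "closed_generate G T S \<subseteq> {x \<in> carrier G. ?p x \<in> A}"
        by (rule closed_generate_least[OF _ preimg[OF A(1)]]) (use A(2) S in auto)
      then show "?p ` closed_generate G T S \<subseteq> A" by auto
    qed
  qed
  have comm: "?p (commutator G x y) = commutator ?Q (?p x) (?p y)" if "x \<in> carrier G" "y \<in> carrier G" for x y
  proof -
    obtain q where q: "q = ?p" by blast
    have hom: "q (x \<otimes> y) = q x \<otimes>\<^bsub>?Q\<^esub> q y" "q (inv x) = inv\<^bsub>?Q\<^esub> (q x)"
      if "x \<in> carrier G" "y \<in> carrier G" for x y
      unfolding q using p.hom_mult[of x y] p.hom_inv[of x] that by auto
    have "q (commutator G x y) = commutator ?Q (q x) (q y)"
      unfolding commutator_def using that by (simp only: hom inv_closed m_closed)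
    then show ?thesis unfolding q .
  qed
  have lcs: "lower_central ?Q ?T (?p ` K) (Suc i) = ?p ` \<gamma> K i" if K: "closed_sg K" for K i
  proof (induction i)
    case (Suc i)
    note K' = closed_sgD[OF K] and L' = closed_sgD[OF closed_sg_lcs[OF K, of i]]
    let ?S = "{commutator G x y |x y. x \<in> \<gamma> K i \<and> y \<in> K}"
    have "{commutator ?Q u v |u v. u \<in> ?p ` \<gamma> K i \<and> v \<in> ?p ` K} = ?p ` ?S"
    proof (intro equalityI subsetI)
      fix z assume "z \<in> {commutator ?Q u v |u v. u \<in> ?p ` \<gamma> K i \<and> v \<in> ?p ` K}"
      then obtain x y where xy: "x \<in> \<gamma> K i" "y \<in> K" "z = commutator ?Q (?p x) (?p y)" by blast
      then have "z = ?p (commutator G x y)" using comm[of x y] L'(3) K'(3) by auto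
      then show "z \<in> ?p ` ?S" using xy by blast
    next
      fix z assume "z \<in> ?p ` ?S"
      then obtain x y where xy: "x \<in> \<gamma> K i" "y \<in> K" "z = ?p (commutator G x y)" by blast
      then have "z = commutator ?Q (?p x) (?p y)" using comm[of x y] L'(3) K'(3) by auto
      then show "z \<in> {commutator ?Q u v |u v. u \<in> ?p ` \<gamma> K i \<and> v \<in> ?p ` K}" using xy by blast
    qed
    moreover have "?S \<subseteq> carrier G" using L'(3) K'(3) by auto
    ultimately show ?case
      using Suc by (simp add: commutator_subgroup_def gen)
  qed simp
  have one: "\<one>\<^bsub>?Q\<^esub> = N" by (simp add: FactGroup_def)
  show ?thesis
  proof
    assume "virtually_nilpotent c ?Q ?T"
    then obtain A where A: "open_subgroup ?Q ?T A" "lower_central ?Q ?T A (c + 1) = {\<one>\<^bsub>?Q\<^esub>}"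
      by (auto simp: virtually_nilpotent_def)
    define K where "K = {x \<in> carrier G. ?p x \<in> A}"
    have "openin T {x \<in> topspace T. ?p x \<in> A}"
      using A(1) by (intro openin_continuous_map_preimage[OF quotient_imp_continuous_map[OF quot]])
        (simp add: open_subgroup_def)
    then have K: "open_sg K"
      using preimg_sg[of A] A(1) by (simp add: K_def open_subgroup_def topspace_eq)
    note Kc = open_sg_closed[OF K]
    have "A \<subseteq> carrier ?Q" using A(1) subgroup.subset by (auto simp: open_subgroup_def)
    then have "?p ` K = A" unfolding K_def surj[symmetric] by blast
    then have "?p ` \<gamma> K c = {N}" using A(2) lcs[OF Kc, of c] one by simp
    then have "x \<in> N" if "x \<in> \<gamma> K c" for x
      using that rcos_self[of x N] N.subgroup_axioms closed_sgD(3)[OF closed_sg_lcs[OF Kc, of c]] by blast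
    then show "\<exists>K. open_sg K \<and> \<gamma> K c \<subseteq> N" using K by blast
  next
    assume "\<exists>K. open_sg K \<and> \<gamma> K c \<subseteq> N"
    then obtain K where K: "open_sg K" "\<gamma> K c \<subseteq> N" by blast
    note K' = open_sgD[OF K(1)] and Kc = open_sg_closed[OF K(1)]
    have "openin T (N <#> K)" by (rule openin_set_mult[OF N.subset K'(2)])
    then have "openin ?T (?p ` K)"
      unfolding openin_quotient_topology using sat[OF K'(3)] K'(3) surj by auto
    then have "open_subgroup ?Q ?T (?p ` K)"
      using p.subgroup_img_is_subgroup[OF K'(1)] by (simp add: open_subgroup_def)
    moreover have "?p ` \<gamma> K c = {N}"
    proof -
      have "?p x = N" if "x \<in> \<gamma> K c" for x
        using that K(2) coset_join2[of x N] N.subgroup_axioms N.subset by auto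
      moreover have "\<one> \<in> \<gamma> K c" by (rule closed_sgD(4)[OF closed_sg_lcs[OF Kc]])
      ultimately show ?thesis by auto
    qed
    then have "lower_central ?Q ?T (?p ` K) (c + 1) = {\<one>\<^bsub>?Q\<^esub>}" using lcs[OF Kc, of c] one by simp
    ultimately show "virtually_nilpotent c ?Q ?T" unfolding virtually_nilpotent_def by blast
  qed
qed

lemma JNNF_iff: "JNNF c G T \<longleftrightarrow> jnn_sg c (carrier G)"
proof -
  have "closed_normal_subgroup G T N \<longleftrightarrow> closed_sg N \<and> N \<subseteq> carrier G \<and> normalizes (carrier G) N" for N
    unfolding closed_normal_subgroup_def closed_subgroup_def normal_iff_normalizes
    using subgroup.subset[of N G] by blast
  moreover have "K \<subseteq> carrier G" if "open_sg K" for K using open_sgD(3)[OF that] .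
  ultimately show ?thesis
    unfolding JNNF_def jnn_sg_def virtually_nilpotent_def[of c G T]
    using virtually_nilpotent_quotient_iff by (auto 4 4)
qed

lemma normalizes_carrier_iff:
  assumes "subgroup L G" "N \<subseteq> L"
  shows "group.normalizes (G\<lparr>carrier := L\<rparr>) L N \<longleftrightarrow> normalizes L N"
  unfolding normalizes_def group.normalizes_def[OF subgroup_imp_group[OF assms(1)]]
  using m_inv_consistent[OF assms(1)] by simp

text \<open>\<open>JNNF_iff\<close> is applied to \<open>L\<close> as a profinite group in its own
  right, and the result is then read back in terms of subgroups and conjugations of
  \<open>G\<close>.\<close>

lemma JNNF_open_subgroup_iff:
  assumes L: "open_sg L"
  shows "JNNF c (G\<lparr>carrier := L\<rparr>) (subtopology T L) \<longleftrightarrow> jnn_sg c L"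
proof -
  note L' = open_sgD[OF L] and Lc = open_sg_closed[OF L]
  let ?L = "G\<lparr>carrier := L\<rparr>" and ?T = "subtopology T L"
  have prof: "profinite_group ?L ?T" by (rule profinite_group_closed_subgroup[OF Lc])
  have open_lcs: "lower_central ?L ?T K (Suc c) = \<gamma> K c" if "open_sg K" "K \<subseteq> L" for K
    by (rule lcs_carrier[OF Lc open_sg_closed[OF that(1)] that(2)])
  have "JNNF c ?L ?T \<longleftrightarrow> profinite_group.jnn_sg ?L ?T c L"
    using profinite_group.JNNF_iff[OF prof] by simp
  also have "\<dots> \<longleftrightarrow> jnn_sg c L"
    unfolding jnn_sg_def profinite_group.jnn_sg_def[OF prof]
      open_subgroup_carrier_iff[OF L] closed_subgroup_carrier_iff[OF Lc]
    using open_lcs normalizes_carrier_iff[OF L'(1)] by (simp cong: conj_cong imp_cong)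
  finally show ?thesis .
qed

end

theorem theorem4p4:
  fixes G :: "('a, 'b) monoid_scheme" and T :: "'a topology" and c :: nat
  assumes "profinite_group G T"
    and "topologically_fg G T"
    and "infinite (carrier G)"
    and "Fitting_free G T"
  shows "(hereditarily_JNNF c G T \<longleftrightarrow> (\<forall>H. open_subgroup G T H \<longrightarrow> finite (A_star c G T H))) \<and>
         ((\<forall>H. open_subgroup G T H \<longrightarrow> finite (A_star c G T H)) \<longleftrightarrow>
          (\<forall>H. open_subgroup G T H \<longrightarrow> finite (C_star c G T H)))"
proof -
  interpret profinite_group G T by fact
  have ff: "fitting_free_sg (carrier G)" by (rule Fitting_free_carrier) fact
  have hjnn: "hereditarily_JNNF c G T \<longleftrightarrow> (\<forall>L. open_sg L \<longrightarrow> jnn_sg c L)"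
    unfolding hereditarily_JNNF_def using JNNF_open_subgroup_iff by simp
  have A: "A_star c G T H = {\<gamma> K c |K. open_sg K \<and> normalizes H K \<and> \<not> \<gamma> K c \<subseteq> H}"
    and C: "C_star c G T H = {\<gamma> K c |K. closed_sg K \<and> normalizes H K \<and> \<not> \<gamma> K c \<subseteq> H}" if "open_sg H" for H
  proof -
    have "open_sg K \<and> H \<subseteq> normalizer G K \<longleftrightarrow> open_sg K \<and> normalizes H K" for K
      using normalizer_subset_iff[OF open_sgD(1)[OF that] open_sgD(1)] by blast
    then show "A_star c G T H = {\<gamma> K c |K. open_sg K \<and> normalizes H K \<and> \<not> \<gamma> K c \<subseteq> H}"
      unfolding A_star_def by (simp add: conj_assoc[symmetric] del: conj_assoc)
    have "closed_sg K \<and> H \<subseteq> normalizer G K \<longleftrightarrow> closed_sg K \<and> normalizes H K" for K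
      using normalizer_subset_iff[OF open_sgD(1)[OF that] closed_sgD(1)] by blast
    then show "C_star c G T H = {\<gamma> K c |K. closed_sg K \<and> normalizes H K \<and> \<not> \<gamma> K c \<subseteq> H}"
      unfolding C_star_def by (simp add: conj_assoc[symmetric] del: conj_assoc)
  qed
  have "A_star c G T H \<subseteq> C_star c G T H" for H
    unfolding A_star_def C_star_def using open_sg_closed by blast
  then have iii_ii: "\<forall>H. open_sg H \<longrightarrow> finite (A_star c G T H)"
    if "\<forall>H. open_sg H \<longrightarrow> finite (C_star c G T H)"
    using that finite_subset by blast
  have i_iii: "\<forall>H. open_sg H \<longrightarrow> finite (C_star c G T H)" if "\<forall>L. open_sg L \<longrightarrow> jnn_sg c L"
    using finite_if_jnn_sg[OF assms(2) ff] that C by simp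
  have ii_i: "\<forall>L. open_sg L \<longrightarrow> jnn_sg c L" if "\<forall>H. open_sg H \<longrightarrow> finite (A_star c G T H)"
    using jnn_sg_if_finite[OF ff assms(3)] that A by simp
  show ?thesis
    unfolding hjnn using iii_ii i_iii ii_i by blast
qed

end
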